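(* Suppose the distributional assumption, the nondegeneracy assumption and the all-binding assumption stated in the context hold. Let $\pi$ be the Adaptive Allocation Algorithm. Then its regret satisfies $$\mathrm{Reg}_T^\pi \le \frac{(48m+4n+12)\cdot\|\lambda^*\|_1}{L^2}+o(1),$$ where $\lambda^*$ is the dual optimal solution, $L$ is the stability constant, and $o(1)\to 0$ as $T\to\infty$.
   Context: **Setting (distributional assumption).** There are $T$ periods, $m$ resources and $n$ order types $(\mu_j,c_j)$, $j=1,\dots,n$, with $0\le\mu_j\le1$, $c_j\in\mathbb R^m$, $c_j\ge 0$, $\|c_j\|_\infty\le1$. Orders $(r_t,a_t)$, $t=1,\dots,T$, are i.i.d. with $P((r_t,a_t)=(\mu_j,c_j))=p_j$, where $p_j>0$; the support $\{(\mu_j,c_j)\}_{j=1}^n$ is known and $p=(p_1,\dots,p_n)$ is unknown. The capacity is $B=Tb$ with $b=(b_1,\dots,b_m)^\top>0$. An online policy $\pi$ chooses $x_t\in\{0,1\}$ after observing $(r_t,a_t)$, possibly with randomization, keeping remaining capacities nonnegative. Put $B_1=B$, $B_t=B_{t-1}-a_{t-1}x_{t-1}$ for $t=2,\dots,T+1$ (with entries $B_{i,t}$) and $b_t=B_t/(T-t+1)$ for $t\le T$. Let $n_j(t)$ be the number of type-$j$ orders arriving in periods $1,\dots,t$. **Benchmark and regret.** $\mathrm{OPT}_D=\max\{\sum_j p_j\mu_jy_j:\ \sum_j p_jc_jy_j\le b,\ 0\le y_j\le1\}$. $\tau=\min\{t: B_{i,t}\le 1\text{ for some }i\}-1$ (with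 $\tau=T$ if there is no such $t\le T+1$). $\mathrm{Reg}_T^\pi=E[T\cdot\mathrm{OPT}_D-\sum_{t=1}^\tau r_tx_t]$. **Adaptive Allocation Algorithm.** Set $x_1=1$. For $t=2,\dots,T$: compute $B_t,b_t$; let $y_t^*=(y_{1,t}^*,\dots,y_{n,t}^* )$ be an optimal solution of $\max\sum_j\frac{n_j(t-1)}{t-1}\mu_jy_j$ s.t. $\sum_j\frac{n_j(t-1)}{t-1}c_jy_j\le b_t$, $0\le y_j\le 1$; observe $(r_t,a_t)=(\mu_j,c_j)$; set $x_t=1$ with probability $y_{j,t}^*$ and $x_t=0$ with probability $1-y_{j,t}^*$ when the capacity constraint permits, otherwise $x_t=0$. **Standard form.** Let $\tilde\mu=(p_1\mu_1,\dots,p_n\mu_n)^\top$ and $C=(p_1c_1,\dots,p_nc_n)\in\mathbb R^{m\times n}$. LP (S): $\max\tilde\mu^\top y$ s.t. $Cy+s=b$, $y+z=\mathbf 1$, $y,s,z\ge0$, with optimal solution $(y^*,s^*,z^* )$. The dual is $\min b^\top\lambda+\sum_j\gamma_j$ s.t. $p_jc_j^\top\lambda+\gamma_j\ge p_j\mu_j$, $\lambda\ge0$, $\gamma_j\ge0$; $\lambda^*$ is the $\lambda$-part of its optimal solution. $\mathcal I^*=\{i: b_i=(Cy^* )_i\}$ (binding), $\mathcal I'=\{i: b_i>(Cy^* )_i\}$ (non-binding). **Nondegeneracy assumption.** The optimal solution of (S) is unique and $|\{j:y_j^*\ne0\}|+|\{i:s_i^*\neq0\}|+|\{j:z_j^*\ne0\}|=m+n$.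 **All-binding assumption.** $s^*=0$. **Stability constant $L$.** $L>0$ is a constant, depending on $\tilde\mu,C,b$ (it exists under the first two assumptions), such that whenever $\max\{\|\hat C-C\|_\infty,\|\hat\mu-\tilde\mu\|_\infty,\max_{i\in\mathcal I^*}|b_i-\hat b_i|,\max_{i\in\mathcal I'}(b_i-\hat b_i)\}\le L$ (with $\|\cdot\|_\infty$ the maximum absolute entry), the LP $\max\hat\mu^\top y$ s.t. $\hat Cy+s=\hat b$, $y+z=\mathbf 1$, $y,s,z\ge0$ has the same optimal basis and the same set of binding resource constraints as (S). *)

theory Defs
  imports "HOL-Probability.Probability"
begin

section \<open>Linear programs in standard form\<close>

text \<open>
  The program is: maximise \<open>\<mu> \<bullet> y\<close> subject to \<open>C y + s = b\<close>, \<open>y + z = 1\<close> and \<open>y, s, z \<ge> 0\<close>.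
  On \<open>real^'n\<close> the relation \<open>\<le>\<close> is componentwise and \<open>1\<close> is the all-ones vector.  (The relation \<open><\<close>
  on vectors is not the componentwise strict one, so strict positivity is always spelled out.)
\<close>

definition std_feasible ::
  "real^'n^'m \<Rightarrow> real^'m \<Rightarrow> real^'n \<Rightarrow> real^'m \<Rightarrow> real^'n \<Rightarrow> bool" where
  "std_feasible C b y s z \<longleftrightarrow>
     C *v y + s = b \<and> y + z = 1 \<and> 0 \<le> y \<and> 0 \<le> s \<and> 0 \<le> z"

definition std_optimal ::
  "real^'n \<Rightarrow> real^'n^'m \<Rightarrow> real^'m \<Rightarrow> real^'n \<Rightarrow> real^'m \<Rightarrow> real^'n \<Rightarrow> bool" where
  "std_optimal \<mu> C b y s z \<longleftrightarrow>
     std_feasible C b y s z \<and>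
     (\<forall>y' s' z'. std_feasible C b y' s' z' \<longrightarrow> \<mu> \<bullet> y' \<le> \<mu> \<bullet> y)"

definition dual_feasible ::
  "real^'n \<Rightarrow> real^'n^'m \<Rightarrow> real^'m \<Rightarrow> real^'n \<Rightarrow> bool" where
  "dual_feasible \<mu> C lam \<gamma> \<longleftrightarrow> \<mu> \<le> transpose C *v lam + \<gamma> \<and> 0 \<le> lam \<and> 0 \<le> \<gamma>"

definition dual_optimal ::
  "real^'n \<Rightarrow> real^'n^'m \<Rightarrow> real^'m \<Rightarrow> real^'m \<Rightarrow> real^'n \<Rightarrow> bool" where
  "dual_optimal \<mu> C b lam \<gamma> \<longleftrightarrow>
     dual_feasible \<mu> C lam \<gamma> \<and>
     (\<forall>lam' \<gamma>'. dual_feasible \<mu> C lam' \<gamma>' \<longrightarrow>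
        b \<bullet> lam + (\<Sum>j\<in>UNIV. \<gamma> $ j) \<le> b \<bullet> lam' + (\<Sum>j\<in>UNIV. \<gamma>' $ j))"

definition binding :: "real^'n^'m \<Rightarrow> real^'m \<Rightarrow> real^'n \<Rightarrow> 'm set" where
  "binding C b y = {i. b $ i = (C *v y) $ i}"

definition nonbinding :: "real^'n^'m \<Rightarrow> real^'m \<Rightarrow> real^'n \<Rightarrow> 'm set" where
  "nonbinding C b y = {i. b $ i > (C *v y) $ i}"

definition nondegenerate ::
  "real^'n \<Rightarrow> real^'n^'m \<Rightarrow> real^'m \<Rightarrow> real^'n \<Rightarrow> real^'m \<Rightarrow> real^'n \<Rightarrow> bool" where
  "nondegenerate \<mu> C b y s z \<longleftrightarrow>
     std_optimal \<mu> C b y s z \<and>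
     (\<forall>y' s' z'. std_optimal \<mu> C b y' s' z' \<longrightarrow> y' = y \<and> s' = s \<and> z' = z) \<and>
     card {j. y $ j \<noteq> 0} + card {i. s $ i \<noteq> 0} + card {j. z $ j \<noteq> 0} = CARD('m) + CARD('n)"
  for \<mu> :: "real^'n" and C :: "real^'n^'m"


section \<open>Bases and the stability constant\<close>

text \<open>The decision variables \<open>y\<^sub>j\<close>, \<open>s\<^sub>i\<close>, \<open>z\<^sub>j\<close> of the standard form.\<close>

datatype ('n, 'm) lp_var = YVar 'n | SVar 'm | ZVar 'n

fun var_value :: "real^'n \<Rightarrow> real^'m \<Rightarrow> real^'n \<Rightarrow> ('n, 'm) lp_var \<Rightarrow> real" where
  "var_value y s z (YVar j) = y $ j"
| "var_value y s z (SVar i) = s $ i"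
| "var_value y s z (ZVar j) = z $ j"

text \<open>
  Columns of the constraint matrix; the first component belongs to the rows \<open>C y + s = b\<close>, the second
  to the rows \<open>y + z = 1\<close>.
\<close>

fun lp_column :: "real^'n^'m \<Rightarrow> ('n, 'm) lp_var \<Rightarrow> (real^'m) \<times> (real^'n)" where
  "lp_column C (YVar j) = (column j C, axis j 1)"
| "lp_column C (SVar i) = (axis i 1, 0)"
| "lp_column C (ZVar j) = (0, axis j 1)"

definition is_basis :: "real^'n^'m \<Rightarrow> ('n, 'm) lp_var set \<Rightarrow> bool" where
  "is_basis C \<B> \<longleftrightarrow>
     card \<B> = CARD('m) + CARD('n) \<and> inj_on (lp_column C) \<B> \<and> independent (lp_column C ` \<B>)"
  for C :: "real^'n^'m"

text \<open>
  A basis is optimal if its basic solution is optimal.  The basic solution is the only solution of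
  the equality constraints that vanishes outside the basis, hence the existential quantifier.
\<close>

definition optimal_basis ::
  "real^'n \<Rightarrow> real^'n^'m \<Rightarrow> real^'m \<Rightarrow> ('n, 'm) lp_var set \<Rightarrow> bool" where
  "optimal_basis \<mu> C b \<B> \<longleftrightarrow>
     is_basis C \<B> \<and>
     (\<exists>y s z. std_optimal \<mu> C b y s z \<and> (\<forall>v. v \<notin> \<B> \<longrightarrow> var_value y s z v = 0))"

text \<open>
  \<open>L\<close> is a stability constant of the program with optimal \<open>y\<close>-part \<open>y\<close>.  For vectors and matrices
  \<^const>\<open>infnorm\<close> is the largest absolute value of an entry.
\<close>

definition stability_constant ::
  "real^'n \<Rightarrow> real^'n^'m \<Rightarrow> real^'m \<Rightarrow> real^'n \<Rightarrow> real \<Rightarrow> bool" where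
  "stability_constant \<mu> C b y L \<longleftrightarrow>
     L > 0 \<and>
     (\<forall>\<mu>' C' b'.
        infnorm (C' - C) \<le> L \<and> infnorm (\<mu>' - \<mu>) \<le> L \<and>
        (\<forall>i\<in>binding C b y. \<bar>b $ i - b' $ i\<bar> \<le> L) \<and>
        (\<forall>i\<in>nonbinding C b y. b $ i - b' $ i \<le> L) \<longrightarrow>
        (\<forall>\<B>. optimal_basis \<mu>' C' b' \<B> \<longleftrightarrow> optimal_basis \<mu> C b \<B>) \<and>
        (\<forall>y' s' z'. std_optimal \<mu>' C' b' y' s' z' \<longrightarrow> binding C' b' y' = binding C b y))"


section \<open>The order model\<close>

text \<open>
  The type of an arriving order has law \<open>P\<close>, so \<open>p\<^sub>j\<close> is \<open>pmf P j\<close>.  Injectivity says that the \<open>n\<close>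
  support points are distinct, so that \<open>p\<^sub>j\<close> is the probability of the order \<open>(\<mu>\<^sub>j, c\<^sub>j)\<close>.
\<close>

definition order_model ::
  "('n \<Rightarrow> real) \<Rightarrow> ('n \<Rightarrow> real^'m) \<Rightarrow> 'n pmf \<Rightarrow> real^'m \<Rightarrow> bool" where
  "order_model \<mu> c P b \<longleftrightarrow>
     (\<forall>j. 0 \<le> \<mu> j \<and> \<mu> j \<le> 1) \<and>
     (\<forall>j. 0 \<le> c j \<and> infnorm (c j) \<le> 1) \<and>
     inj (\<lambda>j. (\<mu> j, c j)) \<and>
     (\<forall>j. pmf P j > 0) \<and>
     (\<forall>i. b $ i > 0)"

definition scaled_reward :: "'n pmf \<Rightarrow> ('n \<Rightarrow> real) \<Rightarrow> real^'n" where
  "scaled_reward P \<mu> = (\<chi> j. pmf P j * \<mu> j)"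

definition scaled_consumption :: "'n pmf \<Rightarrow> ('n \<Rightarrow> real^'m) \<Rightarrow> real^'n^'m" where
  "scaled_consumption P c = (\<chi> i j. pmf P j * c j $ i)"

text \<open>
  The allocation program for type weights \<open>w\<close>: with \<open>w = p\<close> its value is the deterministic benchmark,
  with \<open>w\<close> the empirical frequencies it is the program solved in each period.
\<close>

definition alloc_feasible ::
  "('n \<Rightarrow> real) \<Rightarrow> ('n \<Rightarrow> real^'m) \<Rightarrow> real^'m \<Rightarrow> real^'n \<Rightarrow> bool" where
  "alloc_feasible w c b y \<longleftrightarrow>
     (\<Sum>j\<in>UNIV. (w j * y $ j) *\<^sub>R c j) \<le> b \<and> 0 \<le> y \<and> y \<le> 1"

definition alloc_value :: "('n \<Rightarrow> real) \<Rightarrow> ('n \<Rightarrow> real) \<Rightarrow> real^'n \<Rightarrow> real" where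
  "alloc_value w \<mu> y = (\<Sum>j\<in>UNIV. w j * \<mu> j * y $ j)"

definition alloc_optimal ::
  "('n \<Rightarrow> real) \<Rightarrow> ('n \<Rightarrow> real) \<Rightarrow> ('n \<Rightarrow> real^'m) \<Rightarrow> real^'m \<Rightarrow> real^'n \<Rightarrow> bool" where
  "alloc_optimal w \<mu> c b y \<longleftrightarrow>
     alloc_feasible w c b y \<and>
     (\<forall>y'. alloc_feasible w c b y' \<longrightarrow> alloc_value w \<mu> y' \<le> alloc_value w \<mu> y)"

text \<open>For \<open>b \<ge> 0\<close> the feasible set is nonempty and compact, so the supremum is a maximum.\<close>

definition OPT_D ::
  "('n::finite \<Rightarrow> real) \<Rightarrow> ('n \<Rightarrow> real^'m) \<Rightarrow> 'n pmf \<Rightarrow> real^'m \<Rightarrow> real" where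
  "OPT_D \<mu> c P b = (SUP y \<in> {y. alloc_feasible (pmf P) c b y}. alloc_value (pmf P) \<mu> y)"


section \<open>Policies and regret\<close>

text \<open>
  A history of \<open>t\<close> periods is the list of the \<open>t\<close> pairs (order type, accepted?) in order of time.
  A policy maps the history before a period and the type of the order arriving in that period to
  the law of the decision.
\<close>

type_synonym 'n history = "('n \<times> bool) list"
type_synonym 'n policy = "'n history \<Rightarrow> 'n \<Rightarrow> bool pmf"

primrec run :: "'n pmf \<Rightarrow> 'n policy \<Rightarrow> nat \<Rightarrow> 'n history pmf" where
  "run P \<pi> 0 = return_pmf []"
| "run P \<pi> (Suc t) =
     do {
       h \<leftarrow> run P \<pi> t;
       j \<leftarrow> P;
       x \<leftarrow> \<pi> h j;
       return_pmf (h @ [(j, x)])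
     }"

text \<open>
  For a history \<open>h\<close> of length \<open>t - 1\<close>, this is the capacity \<open>B\<^sub>t\<close> remaining at the start of period \<open>t\<close>.
\<close>

definition remaining :: "nat \<Rightarrow> ('n \<Rightarrow> real^'m) \<Rightarrow> real^'m \<Rightarrow> 'n history \<Rightarrow> real^'m" where
  "remaining T c b h = real T *\<^sub>R b - (\<Sum>(j, x)\<leftarrow>h. of_bool x *\<^sub>R c j)"

definition depleted :: "nat \<Rightarrow> ('n \<Rightarrow> real^'m) \<Rightarrow> real^'m \<Rightarrow> 'n history \<Rightarrow> nat \<Rightarrow> bool" where
  "depleted T c b h t \<longleftrightarrow> (\<exists>i. remaining T c b (take (t - 1) h) $ i \<le> 1)"

definition stopping_time :: "nat \<Rightarrow> ('n \<Rightarrow> real^'m) \<Rightarrow> real^'m \<Rightarrow> 'n history \<Rightarrow> nat" where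
  "stopping_time T c b h =
     (if \<exists>t\<in>{1..T+1}. depleted T c b h t
      then Min {t\<in>{1..T+1}. depleted T c b h t} - 1
      else T)"

definition collected ::
  "nat \<Rightarrow> ('n \<Rightarrow> real) \<Rightarrow> ('n \<Rightarrow> real^'m) \<Rightarrow> real^'m \<Rightarrow> 'n history \<Rightarrow> real" where
  "collected T \<mu> c b h =
     (\<Sum>t = 1..stopping_time T c b h. \<mu> (fst (h ! (t - 1))) * of_bool (snd (h ! (t - 1))))"

definition Regret ::
  "('n::finite \<Rightarrow> real) \<Rightarrow> ('n \<Rightarrow> real^'m) \<Rightarrow> 'n pmf \<Rightarrow> real^'m \<Rightarrow> 'n policy \<Rightarrow> nat \<Rightarrow> real" where
  "Regret \<mu> c P b \<pi> T =
     measure_pmf.expectation (run P \<pi> T) (\<lambda>h. real T * OPT_D \<mu> c P b - collected T \<mu> c b h)"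


section \<open>The adaptive allocation algorithm\<close>

definition empirical :: "'n history \<Rightarrow> 'n \<Rightarrow> real" where
  "empirical h j = real (count_list (map fst h) j) / real (length h)"

definition average_remaining ::
  "nat \<Rightarrow> ('n \<Rightarrow> real^'m) \<Rightarrow> real^'m \<Rightarrow> 'n history \<Rightarrow> real^'m" where
  "average_remaining T c b h = (1 / (real T - real (length h))) *\<^sub>R remaining T c b h"

text \<open>
  \<open>Y T h\<close> is the optimal solution \<open>y\<^sub>t\<^sup>*\<close> used with horizon \<open>T\<close> in period \<open>t = length h + 1\<close> after the
  history \<open>h\<close>.  Optimal solutions need not be unique, so any choice is allowed.  The requirement is
  made for nonnegative remaining capacity, which holds along every run and makes the program
  feasible.
\<close>

definition optimal_selection ::
  "('n \<Rightarrow> real) \<Rightarrow> ('n \<Rightarrow> real^'m) \<Rightarrow> real^'m \<Rightarrow> (nat \<Rightarrow> 'n history \<Rightarrow> real^'n) \<Rightarrow> bool" where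
  "optimal_selection \<mu> c b Y \<longleftrightarrow>
     (\<forall>T h. 1 \<le> length h \<and> length h < T \<and> 0 \<le> remaining T c b h \<longrightarrow>
        alloc_optimal (empirical h) \<mu> c (average_remaining T c b h) (Y T h))"

text \<open>
  The capacity check also guards the acceptance in the first period, so that the algorithm is
  a policy with nonnegative capacities for every \<open>T\<close>.  If the check fails there, some initial
  capacity is at most \<open>1\<close> and the stopping time is \<open>0\<close>, so the regret is unaffected.
\<close>

definition adaptive_allocation ::
  "('n \<Rightarrow> real^'m) \<Rightarrow> real^'m \<Rightarrow> (nat \<Rightarrow> 'n history \<Rightarrow> real^'n) \<Rightarrow> nat \<Rightarrow> 'n policy" where
  "adaptive_allocation c b Y T h j =
     (if \<not> c j \<le> remaining T c b h then return_pmf False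
      else if h = [] then return_pmf True
      else bernoulli_pmf (Y T h $ j))"

end

theory Submission
  imports Defs "HOL-Real_Asymp.Real_Asymp"
begin

text \<open>
  Write the excess of a type as its reward minus its consumption priced with the dual solution.
  By complementary slackness, and up to the periods after depletion, the regret is the expected
  priced leftover capacity plus the expected sum of per-period losses, namely excess forgone by
  rejecting profitable types and by accepting unprofitable ones.  While the empirical frequencies and the average remaining capacity
  are within the stability radius \<open>L\<close>, the loss vanishes and the average remaining capacity is nearly
  a martingale.

  Outside that region a loss need not be small compared with the norm \<open>\<Lambda>\<close> of the dual solution, so
  that counting bad periods is too crude.  Comparing the computed optimum with a scaled version of
  accepting exactly the profitable types bounds the loss by a multiple of \<open>\<Lambda>\<close>, which may be summed
  over all bad periods at a cost of order \<open>\<Lambda> / L\<^sup>2\<close>, plus the relative capacity shortages for the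
  profitable types.  The latter have total expectation of order \<open>1 / L\<close> only, and perturbing the
  rewards shows that every dual price is at least \<open>L\<close>, whence \<open>1 / L \<le> \<Lambda> / L\<^sup>2\<close>.

  Tail bounds for the remaining capacity \<open>B\<close> with \<open>k\<close> periods to go come from the
  supermartingales \<open>(1 - d / k) powr B\<close> with \<open>d\<close> of either sign.
\<close>

section \<open>Elementary inequalities\<close>

text \<open>Two sources of randomness, frequencies and capacities, are separated by a cut
  \<open>s\<close> of order \<open>T powr (3 / 4)\<close>. Before the cut no sequence of decisions
  moves the average remaining capacity by more than \<open>L / 20\<close>, so losses come from
  atypical frequencies alone. After it, frequencies stay within \<open>T powr (- 1 / 4)\<close> of
  the type law except with probability \<open>o(1 / T)\<close>, and their accumulated effect on the
  average capacity is of order \<open>T powr (- 1 / 4) * ln T\<close>.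

  The tilt \<open>(1 - d / k) powr B\<close> imitates drawing without replacement: for integers it
  is the chance that \<open>B\<close> marks, each put at random into one of \<open>k\<close> slots,
  all miss \<open>d\<close> given slots. If the mean consumption is \<open>B / k\<close>, passing
  from \<open>k\<close> to \<open>k - 1\<close> is a Bernoulli inequality, valid for both signs of
  \<open>d\<close>, and leaves no second-order error to sum over the periods. Moreover
  \<open>(1 - d / k) powr (D * k)\<close> grows with \<open>k\<close>, so with \<open>d\<close>
  proportional to \<open>T - t\<close> one tilt bounds the chance that the average has passed the
  level \<open>D\<close> in any period up to \<open>t\<close>.\<close>

lemma powr_le_affine:
  fixes y a :: real
  assumes "0 < y" "0 \<le> a" "a \<le> 1"
  shows "y powr a \<le> 1 + a * (y - 1)"
proof -
  have "exp ((1 - a) *\<^sub>R 0 + a *\<^sub>R ln y) \<le> (1 - a) * exp 0 + a * exp (ln y)"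
    using convex_on_exp[of 1] assms by (intro convex_onD[where A = UNIV]) auto
  then show ?thesis using assms by (simp add: powr_def algebra_simps)
qed

text \<open>Bernoulli's inequality for real exponents: if the left-hand side is positive, its root
  of order \<open>r\<close> is at most \<open>1 + u\<close> by
  \<open>powr_le_affine\<close>.\<close>

lemma bernoulli_powr:
  fixes u r :: real
  assumes "-1 < u" "1 \<le> r"
  shows "1 + r * u \<le> (1 + u) powr r"
proof (cases "1 + r * u \<le> 0")
  case False
  have "(1 + r * u) powr (1 / r) \<le> 1 + (1 / r) * (1 + r * u - 1)"
    using False assms by (intro powr_le_affine) auto
  also have "\<dots> = 1 + u" using assms by simp
  finally have "((1 + r * u) powr (1 / r)) powr r \<le> (1 + u) powr r"
    using assms by (intro powr_mono2) auto
  then show ?thesis using False assms by (simp add: powr_powr)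
qed (use powr_ge_zero[of "1 + u" r] in linarith)

lemma exp_minus_le_quadratic:
  fixes g :: real
  assumes "0 \<le> g"
  shows "g - g\<^sup>2 / 2 \<le> 1 - exp (- g)"
proof -
  let ?f = "\<lambda>g :: real. 1 - exp (- g) - g + g\<^sup>2 / 2"
  have "?f 0 \<le> ?f g"
  proof (rule DERIV_nonneg_imp_nondecreasing[OF assms])
    fix x :: real
    have "(?f has_real_derivative (exp (- x) - 1 + x)) (at x)"
      by (auto intro!: derivative_eq_intros)
    moreover have "0 \<le> exp (- x) - 1 + x" using exp_ge_add_one_self[of "- x"] by simp
    ultimately show "\<exists>y. (?f has_real_derivative y) (at x) \<and> 0 \<le> y" by blast
  qed
  then show ?thesis by simp
qed

lemma ln_one_plus_ge_quadratic:
  fixes x :: real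
  assumes "0 \<le> x"
  shows "x - x\<^sup>2 / 2 \<le> ln (1 + x)"
proof -
  let ?f = "\<lambda>x :: real. ln (1 + x) - x + x\<^sup>2 / 2"
  have "?f 0 \<le> ?f x"
  proof (rule DERIV_nonneg_imp_nondecreasing[OF assms])
    fix x :: real assume "0 \<le> x"
    then have "(?f has_real_derivative (1 / (1 + x) - 1 + x)) (at x)"
      by (auto intro!: derivative_eq_intros)
    moreover have "1 / (1 + x) - 1 + x = x\<^sup>2 / (1 + x)"
      using \<open>0 \<le> x\<close> by (simp add: field_simps power2_eq_square)
    ultimately show "\<exists>y. (?f has_real_derivative y) (at x) \<and> 0 \<le> y"
      using \<open>0 \<le> x\<close> by (intro exI[of _ "1 / (1 + x) - 1 + x"]) simp
  qed
  then show ?thesis by simp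
qed

text \<open>The tangent bound touches at \<open>w = 1 / s\<close>. Its right-hand side is positive,
  so it bounds \<open>max 0 w\<close> too and turns mean shortages into moment generating functions;
  the \<open>- 1\<close> later cancels the cost of a shifted exponent.\<close>

lemma le_exp_div:
  fixes s w :: real
  assumes "0 < s"
  shows "w \<le> exp (s * w - 1) / s"
  using exp_ge_add_one_self[of "s * w - 1"] assms by (simp add: field_simps)

section \<open>Sums of tail bounds over the periods\<close>

lemma sum_exp_tail_le:
  fixes a :: real and s N :: nat
  assumes "0 < a"
  shows "(\<Sum>t = s..N. exp (- a * t)) \<le> exp (- a * s) * (1 + 1 / a)"
proof -
  have pos: "0 < 1 - exp (- a)" using assms by simp
  have "a / (1 + a) \<le> 1 - exp (- a)"
    using exp_ge_add_one_self[of a] assms by (simp add: exp_minus field_simps)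
  then have inv: "1 / (1 - exp (- a)) \<le> 1 + 1 / a"
    using assms pos by (simp add: field_simps)
  have "(\<Sum>t = s..N. exp (- a * t)) * (1 - exp (- a)) \<le> exp (- a * s)"
  proof (cases "s \<le> N")
    case True
    have "(\<Sum>t = s..N. exp (- a * t)) * (1 - exp (- a)) = (\<Sum>t = s..N. exp (- a * t) - exp (- a * Suc t))"
      unfolding sum_distrib_right by (intro sum.cong) (auto simp: algebra_simps exp_add[symmetric])
    also have "\<dots> = exp (- a * s) - exp (- a * Suc N)"
      using sum_Suc_diff[OF le_SucI[OF True], of "\<lambda>t. - exp (- a * t)"] True
      by (simp add: atLeastLessThanSuc_atLeastAtMost)
    finally show ?thesis by simp
  qed simp
  then have "(\<Sum>t = s..N. exp (- a * t)) \<le> exp (- a * s) * (1 / (1 - exp (- a)))"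
    using pos by (simp add: field_simps)
  also have "\<dots> \<le> exp (- a * s) * (1 + 1 / a)"
    using inv by (intro mult_left_mono) auto
  finally show ?thesis .
qed

lemma sum_exp_le:
  fixes a :: real
  assumes "0 < a"
  shows "(\<Sum>t = 1..N. exp (- a * real t)) \<le> 1 / a"
proof -
  have "(\<Sum>t = 1..N. exp (- a * real t)) \<le> exp (- a * real 1) * (1 + 1 / a)"
    by (rule sum_exp_tail_le[OF assms])
  also have "\<dots> = exp (- a) * (1 + a) / a" using assms by (simp add: field_simps)
  also have "\<dots> \<le> 1 / a"
    using exp_ge_add_one_self[of a] assms by (intro divide_right_mono) (auto simp: exp_minus divide_simps)
  finally show ?thesis .
qed

lemma sum_inverse_sqrt_le: "(\<Sum>t = 1..N. 1 / sqrt (real t)) \<le> 2 * sqrt (real N)"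
proof (induction N)
  case (Suc N)
  have "1 / sqrt (real (Suc N)) \<le> 2 * (sqrt (real (Suc N)) - sqrt (real N))"
  proof -
    have "2 * sqrt (real (Suc N)) * sqrt (real N) \<le> real (Suc N) + real N"
      using sum_squares_bound[of "sqrt (real (Suc N))" "sqrt (real N)"] by simp
    then have "1 \<le> 2 * (sqrt (real (Suc N)) - sqrt (real N)) * sqrt (real (Suc N))"
      by (simp add: algebra_simps)
    then show ?thesis by (simp add: divide_le_eq)
  qed
  then show ?case using Suc by simp
qed simp

text \<open>The bounds on \<open>f\<close> change from square-root to exponential decay at
  \<open>t = 1 / a\<close>. Both ranges contribute order \<open>1 / sqrt a\<close>, which becomes
  \<open>1 / L\<close> rather than \<open>1 / L\<^sup>2\<close> when \<open>a\<close> is of order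
  \<open>L\<^sup>2\<close>.\<close>

lemma sum_split_le:
  fixes a x y :: real
  assumes a: "0 < a" "a \<le> 1 / 4" and x: "0 \<le> x" "0 \<le> y"
    and small: "\<And>t. 1 \<le> t \<Longrightarrow> a * real t \<le> 1 \<Longrightarrow> f t \<le> x / sqrt (real t)"
    and large: "\<And>t. 1 < a * real t \<Longrightarrow> f t \<le> y * sqrt a * exp (- a * real t)"
  shows "(\<Sum>t = 1..N. f t) \<le> (2 * x + y / 2) / sqrt a"
proof -
  define s where "s = nat \<lfloor>1 / a\<rfloor>"
  have s: "a * real t \<le> 1 \<longleftrightarrow> t \<le> s" for t
  proof -
    have "a * real t \<le> 1 \<longleftrightarrow> real t \<le> 1 / a" using a by (simp add: field_simps)
    also have "\<dots> \<longleftrightarrow> int t \<le> \<lfloor>1 / a\<rfloor>" by (simp add: le_floor_iff)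
    also have "\<dots> \<longleftrightarrow> t \<le> s" using a by (simp add: s_def le_nat_iff)
    finally show ?thesis .
  qed
  have "(\<Sum>t = 1..N. f t) \<le> (\<Sum>t = 1..N. (if t \<le> s then x / sqrt (real t) else 0)
      + (if s < t then y * sqrt a * exp (- a * real t) else 0))"
    using small large s by (intro sum_mono) (auto simp: not_le[symmetric])
  also have "\<dots> = (\<Sum>t\<in>{1..N} \<inter> {..s}. x / sqrt (real t)) + (\<Sum>t\<in>{1..N} \<inter> {s<..}. y * sqrt a * exp (- a * real t))"
    unfolding sum.distrib
    by (simp only: sum.inter_restrict[OF finite_atLeastAtMost] atMost_iff greaterThan_iff)
  also have "(\<Sum>t\<in>{1..N} \<inter> {..s}. x / sqrt (real t)) \<le> (\<Sum>t = 1..s. x / sqrt (real t))"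
    using x by (intro sum_mono2) auto
  also have "(\<Sum>t = 1..s. x / sqrt (real t)) = x * (\<Sum>t = 1..s. 1 / sqrt (real t))"
    by (simp add: sum_distrib_left)
  also have "\<dots> \<le> x * (2 * sqrt (real s))"
    using x sum_inverse_sqrt_le by (intro mult_left_mono) auto
  also have "\<dots> \<le> x * (2 * sqrt (1 / a))"
    using x s[of s] a by (intro mult_left_mono) (auto simp: field_simps)
  also have "(\<Sum>t\<in>{1..N} \<inter> {s<..}. y * sqrt a * exp (- a * real t)) \<le> (\<Sum>t = Suc s..N. y * sqrt a * exp (- a * real t))"
    using x a by (intro sum_mono2) auto
  also have "\<dots> = y * sqrt a * (\<Sum>t = Suc s..N. exp (- a * real t))"
    by (simp add: sum_distrib_left)
  also have "\<dots> \<le> y * sqrt a * (exp (- a * real (Suc s)) * (1 + 1 / a))"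
    using x a by (intro mult_left_mono sum_exp_tail_le) auto
  \<comment> \<open>\<open>2 / 5\<close> bounds \<open>exp (- 1)\<close>, as the tail starts beyond
    \<open>1 / a\<close>, and \<open>5 / 4\<close> bounds \<open>1 + a\<close>. Their product is the
    \<open>1 / 2\<close> of the claim.\<close>
  also have "\<dots> \<le> y * sqrt a * (2 / 5 * (5 / (4 * a)))"
  proof (intro mult_left_mono mult_mono)
    have "1 < a * real (Suc s)" using s[of "Suc s"] by linarith
    then have "exp (- a * real (Suc s)) \<le> exp (- 1)" by simp
    also have "exp (- 1 :: real) \<le> 2 / 5"
      using exp_lower_Taylor_quadratic[of "1 :: real"] by (simp add: exp_minus field_simps)
    finally show "exp (- a * real (Suc s)) \<le> 2 / 5" .
    show "1 + 1 / a \<le> 5 / (4 * a)" using a by (simp add: field_simps)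
  qed (use a x in auto)
  also have "\<dots> = (y / 2) / sqrt a"
  proof -
    have "y * sqrt a * (2 / 5 * (5 / (4 * a))) = y / 2 * (sqrt a / a)" using a by simp
    also have "sqrt a / a = 1 / sqrt a" using a by (simp add: sqrt_divide_self_eq inverse_eq_divide)
    finally show ?thesis by simp
  qed
  also have "x * (2 * sqrt (1 / a)) = 2 * x / sqrt a" by (simp add: real_sqrt_divide)
  finally show ?thesis by (simp add: add_divide_distrib)
qed

lemma sum_exp_div_sqrt_le:
  fixes a C :: real
  assumes "0 < a" "a \<le> 1 / 4" "0 \<le> C"
    and "\<And>t. 1 \<le> t \<Longrightarrow> f t \<le> C / sqrt (real t) * exp (- a * real t)"
  shows "(\<Sum>t = 1..N. f t) \<le> 5 / 2 * C / sqrt a"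
proof -
  have "(\<Sum>t = 1..N. f t) \<le> (2 * C + C / 2) / sqrt a"
  proof (rule sum_split_le[OF assms(1-3) assms(3)])
    fix t :: nat assume t: "1 \<le> t"
    have "C / sqrt (real t) * exp (- a * real t) \<le> C / sqrt (real t) * 1"
      using assms by (intro mult_left_mono) auto
    then show "f t \<le> C / sqrt (real t)" using assms(4)[OF t] by simp
  next
    fix t :: nat assume t: "1 < a * real t"
    then have "1 \<le> t" by (cases t) auto
    have "1 \<le> sqrt (a * real t)" using t by simp
    then have "1 / sqrt (real t) \<le> sqrt a"
      using \<open>1 \<le> t\<close> by (simp add: real_sqrt_mult divide_le_eq)
    then have "C * (1 / sqrt (real t)) * exp (- a * real t) \<le> C * sqrt a * exp (- a * real t)"
      using assms by (intro mult_right_mono mult_left_mono) auto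
    then show "f t \<le> C * sqrt a * exp (- a * real t)" using assms(4)[OF \<open>1 \<le> t\<close>] by simp
  qed
  then show ?thesis by simp
qed

text \<open>
  With \<open>k\<close> periods and capacity \<open>B\<close> left, a mean consumption \<open>q\<close> of about \<open>B / k\<close> makes
  \<open>(1 - d / k) powr B\<close> nearly a supermartingale, for either sign of \<open>d\<close>.
\<close>

lemma powr_drift:
  fixes B k d q e :: real
  defines "x \<equiv> 1 - d / (k - 1)"
  assumes k: "1 < k" and B: "1 \<le> B" and Bk: "d < 0 \<Longrightarrow> B \<le> k" and x: "1 / 8 \<le> x" and e: "0 \<le> e"
    and q: "0 \<le> d \<Longrightarrow> q \<le> B / k + e" "d < 0 \<Longrightarrow> B / k - e \<le> q"
  shows "x powr B * (1 + q * (1 / x - 1)) \<le> (1 - d / k) powr B * (1 + 8 * e * \<bar>d\<bar> / (k - 1))"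
proof -
  \<comment> \<open>\<open>v = 1 / x - 1\<close> is the relative gain of the tilt from one unit
    consumed, and \<open>1 + u\<close> is the ratio of the old base to the new one. The relation
    \<open>u * k = v\<close> lets Bernoulli's inequality balance a mean consumption of
    \<open>B / k\<close>.\<close>
  define u where "u = d / (k * (k - 1 - d))"
  define v where "v = d / (k - 1 - d)"
  have kd: "0 < k - 1 - d"
  proof -
    have "0 < x * (k - 1)" using k x by (intro mult_pos_pos) auto
    also have "x * (k - 1) = k - 1 - d" using k by (simp add: x_def left_diff_distrib)
    finally show ?thesis .
  qed
  have x0: "0 < x" using x by simp
  have xk: "x = (k - 1 - d) / (k - 1)" using k by (simp add: x_def field_simps)
  have v: "1 / x - 1 = v" using kd k by (simp add: xk v_def field_simps)
  have z: "1 - d / k = x * (1 + u)"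
  proof -
    define w where "w = k - 1 - d"
    have w: "0 < w" "k - 1 - d = w" "1 - d / k = (w + 1) / k" "d = k - 1 - w"
      using kd k by (auto simp: w_def field_simps)
    have "x * (1 + u) = w / (k - 1) * (1 + (k - 1 - w) / (k * w))"
      unfolding xk u_def w(2) using w(4) by simp
    also have "1 + (k - 1 - w) / (k * w) = (k - 1) * (w + 1) / (k * w)"
      using k w(1) by (simp add: field_simps)
    also have "w / (k - 1) * ((k - 1) * (w + 1) / (k * w)) = (w + 1) / k"
      using k w(1) by simp
    finally show ?thesis using w(3) by simp
  qed
  have uv: "u * k = v" using k kd by (simp add: u_def v_def)
  have u1: "0 < 1 + u"
  proof -
    have "d < k" using kd by simp
    then have "0 < 1 - d / k" using k by simp
    then show ?thesis using x0 z by (metis zero_less_mult_pos)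
  qed
  have Buv: "B / k * v = B * u" using k by (simp add: uv[symmetric])
  have Bu: "1 + B * u \<le> (1 + u) powr B" using bernoulli_powr[of u B] u1 B by simp
  have expand: "1 + p + r + p * r = (1 + p) * (1 + r)" for p r :: real by (simp add: algebra_simps)
  have v8: "\<bar>v\<bar> * x = \<bar>d\<bar> / (k - 1)"
    using kd k by (simp add: v_def xk abs_mult abs_divide)
  have "1 + q * v \<le> (1 + B * u) * (1 + 8 * e * \<bar>d\<bar> / (k - 1))"
  proof (cases "0 \<le> d")
    case True
    then have v0: "0 \<le> v" "0 \<le> u" using kd k by (auto simp: v_def u_def)
    have "q * v \<le> (B / k + e) * v" using q(1)[OF True] v0(1) by (rule mult_right_mono)
    also have "\<dots> = B * u + e * v" using Buv by (simp add: algebra_simps)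
    \<comment> \<open>The factor 8 comes from \<open>1 / 8 <= x\<close>, since for positive
      \<open>d\<close> the base could otherwise approach 0.\<close>
    also have "e * v \<le> e * (8 * \<bar>d\<bar> / (k - 1))"
    proof (rule mult_left_mono[OF _ e])
      have "v \<le> v * (8 * x)" using x v0 by (simp add: mult_le_cancel_left1)
      also have "\<dots> = 8 * (\<bar>v\<bar> * x)" using v0 by simp
      finally show "v \<le> 8 * \<bar>d\<bar> / (k - 1)" by (simp add: v8)
    qed
    finally have "1 + q * v \<le> 1 + B * u + 8 * e * \<bar>d\<bar> / (k - 1)" by (simp add: algebra_simps)
    also have "\<dots> \<le> 1 + B * u + 8 * e * \<bar>d\<bar> / (k - 1) + B * u * (8 * e * \<bar>d\<bar> / (k - 1))"
      using v0 B e k by simp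
    also have "\<dots> = (1 + B * u) * (1 + 8 * e * \<bar>d\<bar> / (k - 1))" by (rule expand)
    finally show ?thesis .
  next
    case False
    then have v0: "v \<le> 0" "u \<le> 0" using kd k by (auto simp: v_def u_def divide_nonpos_pos)
    have "q * v \<le> (B / k - e) * v" using q(2) False v0 by (intro mult_right_mono_neg) auto
    also have "\<dots> = B * u + e * \<bar>v\<bar>" using Buv v0 by (simp add: algebra_simps)
    finally have 1: "1 + q * v \<le> 1 + B * u + e * \<bar>v\<bar>" by simp
    \<comment> \<open>Here \<open>u\<close> and \<open>v\<close> are nonpositive, so
      \<open>1 + B * u\<close> might be small; \<open>B <= k\<close> keeps it above
      \<open>1 / x\<close>, and the error becomes a multiple of it.\<close>
    have "1 + v \<le> 1 + B * u"
    proof -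
      have "k * u \<le> B * u" using Bk False v0 by (intro mult_right_mono_neg) auto
      then show ?thesis using uv by (simp add: mult.commute)
    qed
    moreover have "1 + v = 1 / x" using v by simp
    ultimately have Bx: "1 / x \<le> 1 + B * u" by simp
    have "e * \<bar>v\<bar> = 1 / x * (e * \<bar>d\<bar> / (k - 1))"
    proof -
      have "\<bar>v\<bar> = 1 / x * (\<bar>d\<bar> / (k - 1))" using x0 unfolding v8[symmetric] by simp
      then show ?thesis by simp
    qed
    also have "\<dots> \<le> (1 + B * u) * (8 * e * \<bar>d\<bar> / (k - 1))"
    proof (rule mult_mono[OF Bx])
      have "e * \<bar>d\<bar> \<le> 8 * e * \<bar>d\<bar>" using e by (simp add: mult_right_mono)
      then show "e * \<bar>d\<bar> / (k - 1) \<le> 8 * e * \<bar>d\<bar> / (k - 1)"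
        using k by (intro divide_right_mono) auto
      show "0 \<le> 1 + B * u" using Bx x0 by (meson order_trans zero_le_divide_1_iff less_imp_le)
    qed (use e k in auto)
    finally have "1 + q * v \<le> 1 + B * u + (1 + B * u) * (8 * e * \<bar>d\<bar> / (k - 1))" using 1 by simp
    also have "\<dots> = (1 + B * u) * (1 + 8 * e * \<bar>d\<bar> / (k - 1))" by (simp add: ring_distribs)
    finally show ?thesis .
  qed
  also have "\<dots> \<le> (1 + u) powr B * (1 + 8 * e * \<bar>d\<bar> / (k - 1))"
    using Bu e k by (intro mult_right_mono) auto
  finally have "x powr B * (1 + q * v) \<le> x powr B * ((1 + u) powr B * (1 + 8 * e * \<bar>d\<bar> / (k - 1)))"
    by (intro mult_left_mono) auto
  also have "\<dots> = (x * (1 + u)) powr B * (1 + 8 * e * \<bar>d\<bar> / (k - 1))"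
    using x0 u1 by (simp add: powr_mult)
  finally show ?thesis by (simp add: v z)
qed

text \<open>Bernoulli's inequality with exponent \<open>k' / k\<close>. On the line
  \<open>B = D * k\<close> the tilt is least in the last period, so normalising there yields one
  threshold for all earlier periods.\<close>

lemma powr_threshold_mono:
  fixes k k' d D :: real
  assumes "0 < k" "k \<le> k'" "d < k" "0 \<le> D"
  shows "(1 - d / k) powr (D * k) \<le> (1 - d / k') powr (D * k')"
proof -
  have "d / k' < 1" using assms by (simp add: divide_less_eq)
  then have "1 + (k' / k) * (- d / k') \<le> (1 + (- d / k')) powr (k' / k)"
    using assms by (intro bernoulli_powr) auto
  then have "1 - d / k \<le> (1 - d / k') powr (k' / k)" using assms by simp
  then have "(1 - d / k) powr (D * k) \<le> ((1 - d / k') powr (k' / k)) powr (D * k)"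
    using assms by (intro powr_mono2) (auto simp: divide_less_eq)
  then show ?thesis using assms by (simp add: powr_powr mult.commute[of D])
qed

section \<open>Linear programs near the benchmark\<close>

lemma infnorm_leI:
  fixes x :: "'a::euclidean_space"
  assumes "\<And>i. i \<in> Basis \<Longrightarrow> \<bar>x \<bullet> i\<bar> \<le> r"
  shows "infnorm x \<le> r"
  unfolding infnorm_def using assms by (intro cSup_least) auto

lemma infnorm_vec_leI:
  fixes x :: "real^'n"
  assumes "\<And>i. \<bar>x $ i\<bar> \<le> r"
  shows "infnorm x \<le> r"
  by (rule infnorm_leI) (auto simp: Basis_vec_def inner_axis assms)

lemma infnorm_mat_leI:
  fixes A :: "real^'n^'m"
  assumes "\<And>i j. \<bar>A $ i $ j\<bar> \<le> r"
  shows "infnorm A \<le> r"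
  by (rule infnorm_leI) (auto simp: Basis_vec_def inner_axis assms)

text \<open>Independence of \<open>f\<close> as an indexed family: injectivity excludes equal
  columns, which forming the image would merge.\<close>

lemma independent_image_iff:
  fixes f :: "'a \<Rightarrow> 'b::euclidean_space"
  assumes "finite B"
  shows "inj_on f B \<and> independent (f ` B) \<longleftrightarrow>
    (\<forall>\<alpha>. (\<Sum>v\<in>B. \<alpha> v *\<^sub>R f v) = 0 \<longrightarrow> (\<forall>v\<in>B. \<alpha> v = 0))"
proof (intro iffI conjI allI impI)
  fix \<alpha> :: "'a \<Rightarrow> real"
  assume inj: "inj_on f B \<and> independent (f ` B)" and 0: "(\<Sum>v\<in>B. \<alpha> v *\<^sub>R f v) = 0"
  have i: "inj_on f B" "independent (f ` B)" using inj by auto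
  have "(\<Sum>w\<in>f ` B. \<alpha> (inv_into B f w) *\<^sub>R w) = (\<Sum>v\<in>B. \<alpha> (inv_into B f (f v)) *\<^sub>R f v)"
    by (rule sum.reindex_cong[OF i(1)]) auto
  also have "\<dots> = 0" using 0 i(1) by (simp cong: sum.cong)
  finally have "\<forall>w\<in>f ` B. \<alpha> (inv_into B f w) = 0"
    using independent_explicit[THEN iffD1, OF i(2)]
    by (elim conjE) (drule spec[where x = "\<lambda>w. \<alpha> (inv_into B f w)"], blast)
  then show "\<forall>v\<in>B. \<alpha> v = 0" using i(1) by simp
next
  assume *: "\<forall>\<alpha>. (\<Sum>v\<in>B. \<alpha> v *\<^sub>R f v) = 0 \<longrightarrow> (\<forall>v\<in>B. \<alpha> v = 0)"
  show inj: "inj_on f B"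
  proof (rule inj_onI, rule ccontr)
    fix u v assume uv: "u \<in> B" "v \<in> B" "f u = f v" "u \<noteq> v"
    let ?\<alpha> = "\<lambda>w. of_bool (w = u) - of_bool (w = v) :: real"
    have "(\<Sum>w\<in>B. ?\<alpha> w *\<^sub>R f w) = (\<Sum>w\<in>B. (if w = u then f w else 0)) - (\<Sum>w\<in>B. (if w = v then f w else 0))"
      unfolding sum_subtractf[symmetric] by (intro sum.cong) (auto simp: algebra_simps)
    also have "\<dots> = 0" using uv assms by simp
    finally show False using * uv by force
  qed
  show "independent (f ` B)"
    unfolding independent_explicit
  proof (intro conjI allI impI)
    fix u :: "'b \<Rightarrow> real" assume "(\<Sum>w\<in>f ` B. u w *\<^sub>R w) = 0"
    then have "(\<Sum>v\<in>B. (u \<circ> f) v *\<^sub>R f v) = 0" using inj by (simp add: sum.reindex)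
    with * have "\<forall>v\<in>B. (u \<circ> f) v = 0" by blast
    then show "\<forall>w\<in>f ` B. u w = 0" by simp
  qed (use assms in simp)
qed

lemma matrix_vector_mult_sum_column:
  fixes C :: "real^'n^'m"
  shows "C *v d = (\<Sum>j\<in>UNIV. d $ j *\<^sub>R column j C)"
  by (simp add: vec_eq_iff matrix_vector_mult_def column_def mult.commute)

lemma sum_lp_var:
  fixes f :: "('n::finite, 'm::finite) lp_var \<Rightarrow> 'b::comm_monoid_add"
  shows "finite (UNIV :: ('n, 'm) lp_var set)"
    and "(\<Sum>v\<in>UNIV. f v) = (\<Sum>j\<in>UNIV. f (YVar j)) + (\<Sum>i\<in>UNIV. f (SVar i)) + (\<Sum>j\<in>UNIV. f (ZVar j))"
proof -
  have eq: "(UNIV :: ('n, 'm) lp_var set) = range YVar \<union> range SVar \<union> range ZVar"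
    by (auto, metis lp_var.exhaust rangeI)
  show "finite (UNIV :: ('n, 'm) lp_var set)" unfolding eq by simp
  have i: "inj (YVar :: 'n \<Rightarrow> ('n,'m) lp_var)" "inj (SVar :: 'm \<Rightarrow> ('n,'m) lp_var)" "inj (ZVar :: 'n \<Rightarrow> ('n,'m) lp_var)"
    by (auto simp: inj_def)
  show "(\<Sum>v\<in>UNIV. f v) = (\<Sum>j\<in>UNIV. f (YVar j)) + (\<Sum>i\<in>UNIV. f (SVar i)) + (\<Sum>j\<in>UNIV. f (ZVar j))"
  proof -
    have "(\<Sum>v\<in>UNIV. f v) = (\<Sum>v\<in>range YVar \<union> range SVar. f v) + (\<Sum>v\<in>range ZVar. f v)"
      unfolding eq by (rule sum.union_disjoint) auto
    also have "(\<Sum>v\<in>range YVar \<union> range SVar. f v) = (\<Sum>v\<in>range YVar. f v) + (\<Sum>v\<in>range SVar. f v)"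
      by (rule sum.union_disjoint) auto
    finally show ?thesis
      by (simp add: sum.reindex[OF i(1)] sum.reindex[OF i(2)] sum.reindex[OF i(3)])
  qed
qed

lemma sum_axis: "(\<Sum>j\<in>UNIV. a j *\<^sub>R axis j 1) = (\<chi> j. (a j :: real))"
  by (simp add: vec_eq_iff axis_def if_distrib cong: if_cong)

lemma sum_lp_column:
  fixes C :: "real^'n^'m"
  assumes "\<And>v. v \<notin> B \<Longrightarrow> \<alpha> v = 0"
  shows "(\<Sum>v\<in>B. \<alpha> v *\<^sub>R lp_column C v) =
    (C *v (\<chi> j. \<alpha> (YVar j)) + (\<chi> i. \<alpha> (SVar i)), (\<chi> j. \<alpha> (YVar j) + \<alpha> (ZVar j)))"
proof -
  have "(\<Sum>v\<in>B. \<alpha> v *\<^sub>R lp_column C v) = (\<Sum>v\<in>UNIV. \<alpha> v *\<^sub>R lp_column C v)"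
    using assms by (intro sum.mono_neutral_left sum_lp_var(1)) auto
  also have "\<dots> = (C *v (\<chi> j. \<alpha> (YVar j)) + (\<chi> i. \<alpha> (SVar i)), (\<chi> j. \<alpha> (YVar j) + \<alpha> (ZVar j)))"
    unfolding sum_lp_var(2)
    by (simp add: prod_eq_iff fst_sum snd_sum matrix_vector_mult_sum_column sum_axis)
       (simp add: vec_eq_iff)
  finally show ?thesis .
qed

lemma std_optimal_dest:
  assumes "std_optimal \<mu> C b y s z"
  shows "C *v y + s = b" "\<And>j. 0 \<le> y $ j" "\<And>j. y $ j \<le> 1" "\<And>j. z $ j = 1 - y $ j" "\<And>i. 0 \<le> s $ i"
proof -
  have f: "std_feasible C b y s z" using assms by (simp add: std_optimal_def)
  then show "C *v y + s = b" "\<And>j. 0 \<le> y $ j" "\<And>i. 0 \<le> s $ i"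
    by (auto simp: std_feasible_def less_eq_vec_def)
  have "y + z = 1" "0 \<le> z" using f by (auto simp: std_feasible_def)
  then show z: "z $ j = 1 - y $ j" for j by (auto simp: vec_eq_iff algebra_simps)
  show "y $ j \<le> 1" for j using z[of j] \<open>0 \<le> z\<close> by (simp add: less_eq_vec_def) (metis diff_ge_0_iff_ge)
qed

lemma std_optimal_le:
  assumes "std_optimal \<mu> C b y s z" "C *v y' \<le> b" "\<And>j. 0 \<le> y' $ j" "\<And>j. y' $ j \<le> 1"
  shows "\<mu> \<bullet> y' \<le> \<mu> \<bullet> y"
proof -
  have "std_feasible C b y' (b - C *v y') (1 - y')"
    using assms by (auto simp: std_feasible_def less_eq_vec_def)
  then show ?thesis using assms(1) by (auto simp: std_optimal_def)
qed

lemma std_optimalI: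
  assumes "C *v y \<le> b" "\<And>j. 0 \<le> y $ j" "\<And>j. y $ j \<le> 1"
    and "\<And>y'. C *v y' \<le> b \<Longrightarrow> (\<And>j. 0 \<le> y' $ j) \<Longrightarrow> (\<And>j. y' $ j \<le> 1) \<Longrightarrow> \<mu> \<bullet> y' \<le> \<mu> \<bullet> y"
  shows "std_optimal \<mu> C b y (b - C *v y) (1 - y)"
  unfolding std_optimal_def
proof (intro conjI allI impI)
  show "std_feasible C b y (b - C *v y) (1 - y)"
    using assms by (auto simp: std_feasible_def less_eq_vec_def)
  fix y' s' z' assume f: "std_feasible C b y' s' z'"
  then have "0 \<le> s'" "C *v y' + s' = b" "0 \<le> z'" "y' + z' = 1" "0 \<le> y'" by (auto simp: std_feasible_def)
  show "\<mu> \<bullet> y' \<le> \<mu> \<bullet> y"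
  proof (rule assms(4))
    show "C *v y' \<le> b" using \<open>C *v y' + s' = b\<close> \<open>0 \<le> s'\<close> by (metis le_add_same_cancel1)
    show "0 \<le> y' $ j" for j using \<open>0 \<le> y'\<close> by (simp add: less_eq_vec_def)
    show "y' $ j \<le> 1" for j
    proof -
      have "(y' + z') $ j = 1" unfolding \<open>y' + z' = 1\<close> by simp
      moreover have "0 \<le> z' $ j" using \<open>0 \<le> z'\<close> by (simp add: less_eq_vec_def)
      ultimately show ?thesis by simp
    qed
  qed
qed

text \<open>The slack part is \<open>0\<close> by the all-binding assumption, so stability allows
  every entry of \<open>b\<close> to move by \<open>L\<close> in both directions.\<close>

locale stable_lp =
  fixes \<mu> :: "real^'n::finite" and C :: "real^'n^'m::finite" and b :: "real^'m"
    and y :: "real^'n" and z :: "real^'n" and L :: real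
  assumes nondeg: "nondegenerate \<mu> C b y 0 z"
    and stab: "stability_constant \<mu> C b y L"
begin

lemma L_pos: "L > 0"
  using stab by (simp add: stability_constant_def)

lemma opt: "std_optimal \<mu> C b y 0 z"
  using nondeg by (simp add: nondegenerate_def)

lemma y_bounds: "0 \<le> y $ j" "y $ j \<le> 1"
  using std_optimal_dest[OF opt] by auto

lemma C_y: "C *v y = b"
  using std_optimal_dest(1)[OF opt] by simp

lemma binding_UNIV: "binding C b y = UNIV" and nonbinding_empty: "nonbinding C b y = {}"
  using C_y by (auto simp: binding_def nonbinding_def)

lemma opt_unique:
  assumes "C *v y' \<le> b" "\<And>j. 0 \<le> y' $ j" "\<And>j. y' $ j \<le> 1" "\<mu> \<bullet> y \<le> \<mu> \<bullet> y'"
  shows "y' = y"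
proof -
  have "std_optimal \<mu> C b y' (b - C *v y') (1 - y')"
    using assms std_optimal_le[OF opt] by (intro std_optimalI) (auto intro: order_trans)
  then show ?thesis using nondeg by (auto simp: nondegenerate_def)
qed

text \<open>The directions along which basic solutions move: at an optimum with zero slack, a
  coordinate is free exactly when its \<open>y\<close> and its \<open>z\<close> are both
  basic.\<close>

definition interior_dir :: "real^'n \<Rightarrow> bool" where
  "interior_dir d \<longleftrightarrow> (\<forall>j. y $ j = 0 \<or> y $ j = 1 \<longrightarrow> d $ j = 0)"

lemma feasible_step:
  assumes "C *v d = 0" and d0: "\<And>j. y $ j = 0 \<Longrightarrow> 0 \<le> d $ j" and d1: "\<And>j. y $ j = 1 \<Longrightarrow> d $ j \<le> 0"
  obtains \<epsilon> where "\<epsilon> > 0" "C *v (y + \<epsilon> *\<^sub>R d) = b" "\<And>j. 0 \<le> (y + \<epsilon> *\<^sub>R d) $ j" "\<And>j. (y + \<epsilon> *\<^sub>R d) $ j \<le> 1"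
proof -
  have "\<exists>e>0. \<forall>\<epsilon>. 0 < \<epsilon> \<and> \<epsilon> \<le> e \<longrightarrow> 0 \<le> y $ j + \<epsilon> * d $ j \<and> y $ j + \<epsilon> * d $ j \<le> 1" for j
  proof -
    consider "y $ j = 0" | "y $ j = 1" | "0 < y $ j" "y $ j < 1"
      using y_bounds[of j] by linarith
    then show ?thesis
    proof cases
      case 1
      have "\<epsilon> * d $ j \<le> 1" if "0 < \<epsilon>" "\<epsilon> \<le> 1 / (1 + d $ j)" for \<epsilon>
      proof -
        have "\<epsilon> * d $ j \<le> \<epsilon> * (1 + d $ j)" using that by (simp add: algebra_simps)
        also have "\<dots> \<le> 1" using that d0[OF 1] by (simp add: field_simps)
        finally show ?thesis .
      qed
      then show ?thesis using 1 d0[OF 1] by (intro exI[of _ "1 / (1 + d $ j)"]) auto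
    next
      case 2
      have "0 \<le> 1 + \<epsilon> * d $ j" if "0 < \<epsilon>" "\<epsilon> \<le> 1 / (1 - d $ j)" for \<epsilon>
      proof -
        have "\<epsilon> * (1 - d $ j) \<le> 1" using that d1[OF 2] by (simp add: field_simps)
        then show ?thesis using that by (simp add: algebra_simps)
      qed
      then show ?thesis using 2 d1[OF 2]
        by (intro exI[of _ "1 / (1 - d $ j)"]) (auto simp: mult_nonneg_nonpos)
    next
      case 3
      define r where "r = min (y $ j) (1 - y $ j)"
      have r: "r > 0" "r \<le> y $ j" "r \<le> 1 - y $ j" using 3 by (auto simp: r_def)
      have "\<bar>\<epsilon> * d $ j\<bar> \<le> r" if "0 < \<epsilon>" "\<epsilon> \<le> r / (1 + \<bar>d $ j\<bar>)" for \<epsilon>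
      proof -
        have "\<bar>\<epsilon> * d $ j\<bar> \<le> \<epsilon> * (1 + \<bar>d $ j\<bar>)" using that by (simp add: abs_mult algebra_simps)
        also have "\<dots> \<le> r" using that by (simp add: field_simps)
        finally show ?thesis .
      qed
      then show ?thesis using r by (intro exI[of _ "r / (1 + \<bar>d $ j\<bar>)"]) (fastforce simp: abs_le_iff)
    qed
  qed
  then obtain e where e: "\<And>j. e j > 0" "\<And>j \<epsilon>. 0 < \<epsilon> \<Longrightarrow> \<epsilon> \<le> e j \<Longrightarrow> 0 \<le> y $ j + \<epsilon> * d $ j \<and> y $ j + \<epsilon> * d $ j \<le> 1"
    by metis
  define \<epsilon> where "\<epsilon> = Min (range e)"
  have "\<epsilon> > 0" "\<And>j. \<epsilon> \<le> e j" using e(1) by (auto simp: \<epsilon>_def)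
  then show thesis using that[of \<epsilon>] e(2) assms(1)
    by (simp add: C_y matrix_vector_right_distrib matrix_vector_mult_scaleR)
qed

lemma feasible_dir_nonpos:
  assumes "C *v d = 0" and "\<And>j. y $ j = 0 \<Longrightarrow> 0 \<le> d $ j" and "\<And>j. y $ j = 1 \<Longrightarrow> d $ j \<le> 0"
  shows "\<mu> \<bullet> d \<le> 0"
proof -
  obtain \<epsilon> where "\<epsilon> > 0" "C *v (y + \<epsilon> *\<^sub>R d) = b" "\<And>j. 0 \<le> (y + \<epsilon> *\<^sub>R d) $ j" "\<And>j. (y + \<epsilon> *\<^sub>R d) $ j \<le> 1"
    using feasible_step[OF assms] by blast
  then have "\<mu> \<bullet> (y + \<epsilon> *\<^sub>R d) \<le> \<mu> \<bullet> y" by (intro std_optimal_le[OF opt]) auto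
  then show ?thesis using \<open>\<epsilon> > 0\<close> by (simp add: inner_add_right mult_le_0_iff)
qed

text \<open>Both \<open>d\<close> and \<open>- d\<close> can be followed a little, so the objective
  is constant along \<open>d\<close>, and uniqueness of the optimum leaves no nonzero move.\<close>

lemma interior_kernel:
  assumes d: "C *v d = 0" "interior_dir d"
  shows "d = 0"
proof -
  have "C *v (- d) = 0" using d(1) by (metis (no_types, lifting) matrix_vector_mult_diff_distrib diff_0 cancel_comm_monoid_add_class.diff_cancel matrix_vector_mult_0_right)
  then have "\<mu> \<bullet> (- d) \<le> 0" using d(2) by (intro feasible_dir_nonpos) (auto simp: interior_dir_def)
  then have le: "0 \<le> \<mu> \<bullet> d" by simp
  obtain \<epsilon> where e: "\<epsilon> > 0" "C *v (y + \<epsilon> *\<^sub>R d) = b" "\<And>j. 0 \<le> (y + \<epsilon> *\<^sub>R d) $ j" "\<And>j. (y + \<epsilon> *\<^sub>R d) $ j \<le> 1"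
    using feasible_step[of d] d by (auto simp: interior_dir_def)
  have "y + \<epsilon> *\<^sub>R d = y"
    using e le by (intro opt_unique) (auto simp: inner_add_right)
  then show ?thesis using e by simp
qed

definition supp :: "('n, 'm) lp_var set" where
  "supp = {v. var_value y 0 z v \<noteq> 0}"

lemma supp_simps: "YVar j \<in> supp \<longleftrightarrow> y $ j \<noteq> 0" "SVar i \<notin> supp" "ZVar j \<in> supp \<longleftrightarrow> y $ j \<noteq> 1"
  using std_optimal_dest(4)[OF opt] by (auto simp: supp_def)

text \<open>Nondegeneracy with zero slack gives the optimum as many nonzero variables as a basis has
  columns, so \<open>supp\<close> is the only candidate for its basis.\<close>

lemma card_supp: "card supp = CARD('m) + CARD('n)"
proof -
  have eq: "supp = YVar ` {j. y $ j \<noteq> 0} \<union> ZVar ` {j. z $ j \<noteq> 0}" (is "_ = ?A \<union> ?B")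
  proof (rule set_eqI)
    show "v \<in> supp \<longleftrightarrow> v \<in> ?A \<union> ?B" for v by (cases v) (auto simp: supp_def)
  qed
  have "card supp = card {j. y $ j \<noteq> 0} + card {j. z $ j \<noteq> 0}"
    unfolding eq by (subst card_Un_disjoint) (auto simp: card_image inj_on_def)
  also have "\<dots> = CARD('m) + CARD('n)" using nondeg by (simp add: nondegenerate_def)
  finally show ?thesis .
qed

lemma finite_supp: "finite supp"
  by (rule finite_subset[OF subset_UNIV sum_lp_var(1)])

text \<open>In a dependency the rows \<open>y + z = 1\<close> force the \<open>z\<close>-part to be
  minus the \<open>y\<close>-part, and slack columns do not occur. What remains is a kernel vector
  of \<open>C'\<close> that vanishes wherever \<open>y\<close> or \<open>z\<close> is
  nonbasic.\<close>

lemma is_basis_supp_iff: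
  "is_basis C' supp \<longleftrightarrow> (\<forall>d. C' *v d = 0 \<and> interior_dir d \<longrightarrow> d = 0)" for C' :: "real^'n^'m"
proof
  assume "is_basis C' supp"
  then have *: "\<forall>\<alpha>. (\<Sum>v\<in>supp. \<alpha> v *\<^sub>R lp_column C' v) = 0 \<longrightarrow> (\<forall>v\<in>supp. \<alpha> v = 0)"
    using independent_image_iff[OF finite_supp, of "lp_column C'"] by (simp add: is_basis_def)
  show "\<forall>d. C' *v d = 0 \<and> interior_dir d \<longrightarrow> d = 0"
  proof (intro allI impI, elim conjE)
    fix d assume d: "C' *v d = 0" "interior_dir d"
    define \<alpha> where "\<alpha> = var_value d (0 :: real^'m) (- d)"
    have out: "\<alpha> v = 0" if "v \<notin> supp" for v
      using that d(2) by (cases v) (auto simp: \<alpha>_def supp_simps interior_dir_def)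
    have "(\<Sum>v\<in>supp. \<alpha> v *\<^sub>R lp_column C' v) = 0"
      using d(1) by (subst sum_lp_column[OF out]) (simp_all add: \<alpha>_def prod_eq_iff vec_eq_iff)
    then have "\<alpha> v = 0" for v using * out by blast
    then have "d $ j = 0" for j by (metis \<alpha>_def var_value.simps(1))
    then show "d = 0" by (simp add: vec_eq_iff)
  qed
next
  assume *: "\<forall>d. C' *v d = 0 \<and> interior_dir d \<longrightarrow> d = 0"
  have "\<forall>v\<in>supp. \<alpha> v = 0" if a: "(\<Sum>v\<in>supp. \<alpha> v *\<^sub>R lp_column C' v) = 0" for \<alpha>
  proof -
    define \<beta> where "\<beta> v = (if v \<in> supp then \<alpha> v else 0)" for v
    define d :: "real^'n" where "d = (\<chi> j. \<beta> (YVar j))"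
    have "(\<Sum>v\<in>supp. \<beta> v *\<^sub>R lp_column C' v) = 0" using a by (simp add: \<beta>_def)
    moreover have "(\<Sum>v\<in>supp. \<beta> v *\<^sub>R lp_column C' v) =
      (C' *v (\<chi> j. \<beta> (YVar j)) + (\<chi> i. \<beta> (SVar i)), (\<chi> j. \<beta> (YVar j) + \<beta> (ZVar j)))"
      by (rule sum_lp_column) (simp add: \<beta>_def)
    moreover have "(\<chi> i. \<beta> (SVar i)) = (0 :: real^'m)"
      by (simp add: \<beta>_def supp_simps vec_eq_iff)
    ultimately have Cd: "C' *v d = 0" and yz: "\<And>j. \<beta> (YVar j) + \<beta> (ZVar j) = 0"
      by (auto simp: prod_eq_iff d_def vec_eq_iff)
    have "interior_dir d"
      unfolding interior_dir_def
    proof (intro allI impI)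
      fix j assume "y $ j = 0 \<or> y $ j = 1"
      then show "d $ j = 0" using yz[of j] by (auto simp: d_def \<beta>_def supp_simps)
    qed
    then have "d = 0" using * Cd by blast
    then have y0: "\<beta> (YVar j) = 0" for j by (simp add: d_def vec_eq_iff)
    then have z0: "\<beta> (ZVar j) = 0" for j using yz[of j] by simp
    show ?thesis
    proof
      fix v assume v: "v \<in> supp"
      have "\<beta> v = 0" using y0 z0 by (cases v) (auto simp: \<beta>_def supp_simps)
      then show "\<alpha> v = 0" using v by (simp add: \<beta>_def)
    qed
  qed
  then show "is_basis C' supp"
    using independent_image_iff[OF finite_supp, of "lp_column C'"] card_supp by (auto simp: is_basis_def)
qed

lemma optimal_basis_supp: "optimal_basis \<mu> C b supp"
  using is_basis_supp_iff[of C] interior_kernel opt by (auto simp: optimal_basis_def supp_def)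

definition near :: "real^'n \<Rightarrow> real^'n^'m \<Rightarrow> real^'m \<Rightarrow> bool" where
  "near \<mu>' C' b' \<longleftrightarrow> (\<forall>j. \<bar>\<mu>' $ j - \<mu> $ j\<bar> \<le> L) \<and> (\<forall>i j. \<bar>C' $ i $ j - C $ i $ j\<bar> \<le> L) \<and> (\<forall>i. \<bar>b' $ i - b $ i\<bar> \<le> L)"

lemma near_stable:
  assumes "near \<mu>' C' b'"
  shows "optimal_basis \<mu>' C' b' supp"
    and "std_optimal \<mu>' C' b' y' s' z' \<Longrightarrow> C' *v y' = b'"
proof -
  have "infnorm (C' - C) \<le> L" "infnorm (\<mu>' - \<mu>) \<le> L" "\<forall>i. \<bar>b $ i - b' $ i\<bar> \<le> L"
    using assms by (auto intro!: infnorm_vec_leI infnorm_mat_leI simp: near_def abs_minus_commute)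
  then have *: "(\<forall>\<B>. optimal_basis \<mu>' C' b' \<B> \<longleftrightarrow> optimal_basis \<mu> C b \<B>) \<and>
        (\<forall>y' s' z'. std_optimal \<mu>' C' b' y' s' z' \<longrightarrow> binding C' b' y' = UNIV)"
    using stab binding_UNIV nonbinding_empty unfolding stability_constant_def by auto
  then show "optimal_basis \<mu>' C' b' supp" using optimal_basis_supp by blast
  assume "std_optimal \<mu>' C' b' y' s' z'"
  with * have "binding C' b' y' = UNIV" by blast
  then have "\<forall>i. b' $ i = (C' *v y') $ i" unfolding binding_def by blast
  then show "C' *v y' = b'" by (simp add: vec_eq_iff)
qed

lemma near_kernel:
  assumes "near \<mu>' C' b'" "C' *v d = 0" "interior_dir d"
  shows "d = 0"
  using near_stable(1)[OF assms(1)] assms is_basis_supp_iff by (auto simp: optimal_basis_def)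

text \<open>The optimal basis is unchanged, so nonbasic \<open>y\<close> stay at 0 and nonbasic
  \<open>z\<close> keep \<open>y\<close> at 1; the stable binding set turns all capacity constraints
  into equations.\<close>

lemma near_solution:
  assumes "near \<mu>' C' b'"
  obtains y' s' z' where "std_optimal \<mu>' C' b' y' s' z'" "C' *v y' = b'"
    "\<And>j. y $ j = 0 \<Longrightarrow> y' $ j = 0" "\<And>j. y $ j = 1 \<Longrightarrow> y' $ j = 1"
proof -
  obtain y' s' z' where o: "std_optimal \<mu>' C' b' y' s' z'" "\<And>v. v \<notin> supp \<Longrightarrow> var_value y' s' z' v = 0"
    using near_stable(1)[OF assms] by (auto simp: optimal_basis_def)
  have "y' $ j = 0" if "y $ j = 0" for j using o(2)[of "YVar j"] that by (simp add: supp_simps)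
  moreover have "y' $ j = 1" if "y $ j = 1" for j
    using o(2)[of "ZVar j"] that std_optimal_dest(4)[OF o(1), of j] by (simp add: supp_simps)
  ultimately show thesis using that o(1) near_stable(2)[OF assms o(1)] by blast
qed

lemma near_solution_unique:
  assumes "near \<mu>' C' b'" "C' *v u = C' *v v"
    "\<And>j. y $ j = 0 \<Longrightarrow> u $ j = v $ j" "\<And>j. y $ j = 1 \<Longrightarrow> u $ j = v $ j"
  shows "u = v"
proof -
  have "u - v = 0"
    by (rule near_kernel[OF assms(1)])
       (use assms in \<open>auto simp: interior_dir_def matrix_vector_mult_diff_distrib\<close>)
  then show ?thesis by simp
qed

text \<open>Strict closeness of the objective leaves room to perturb it in one coordinate, which forces
  every optimal solution, not just the basic one, to agree with \<open>y\<close> at the bounds.\<close>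

lemma near_optimal_at_bounds:
  assumes near: "near \<mu>' C' b'" and strict: "\<And>j. \<bar>\<mu>' $ j - \<mu> $ j\<bar> < L"
    and o: "std_optimal \<mu>' C' b' v s' z'"
  shows "y $ j = 0 \<Longrightarrow> v $ j = 0" "y $ j = 1 \<Longrightarrow> v $ j = 1"
proof -
  obtain u s'' z'' where u: "std_optimal \<mu>' C' b' u s'' z''" "C' *v u = b'"
    "\<And>j. y $ j = 0 \<Longrightarrow> u $ j = 0" "\<And>j. y $ j = 1 \<Longrightarrow> u $ j = 1"
    using near_solution[OF near] by metis
  have v: "C' *v v = b'" using near_stable(2)[OF near o] .
  have vu: "\<mu>' \<bullet> v = \<mu>' \<bullet> u"
    using std_optimal_le[OF u(1), of v] std_optimal_le[OF o, of u] std_optimal_dest[OF u(1)] std_optimal_dest[OF o]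
      u(2) v by (auto intro!: antisym)
  have key: "\<eta> * v $ j \<le> \<eta> * u $ j" if \<eta>: "\<bar>\<eta>\<bar> \<le> L - \<bar>\<mu>' $ j - \<mu> $ j\<bar>" for \<eta> j
  proof -
    define \<mu>2 where "\<mu>2 = \<mu>' + \<eta> *\<^sub>R axis j 1"
    have near2: "near \<mu>2 C' b'"
    proof -
      have "\<bar>\<mu>2 $ k - \<mu> $ k\<bar> \<le> L" for k
      proof (cases "k = j")
        case True
        then have "\<bar>\<mu>2 $ k - \<mu> $ k\<bar> = \<bar>(\<mu>' $ j - \<mu> $ j) + \<eta>\<bar>" by (simp add: \<mu>2_def axis_def algebra_simps)
        then show ?thesis using \<eta> by linarith
      qed (use strict[of k] in \<open>simp add: \<mu>2_def axis_def\<close>)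
      then show ?thesis using near by (simp add: near_def)
    qed
    obtain w s3 z3 where w: "std_optimal \<mu>2 C' b' w s3 z3" "C' *v w = b'"
      "\<And>j. y $ j = 0 \<Longrightarrow> w $ j = 0" "\<And>j. y $ j = 1 \<Longrightarrow> w $ j = 1"
      using near_solution[OF near2] by metis
    \<comment> \<open>The matrix, the right-hand side and the coordinates fixed at bounds are those
      of \<open>u\<close>, so changing a reward does not move the basic solution.\<close>
    have "w = u" by (rule near_solution_unique[OF near]) (use w u in auto)
    then have "\<mu>2 \<bullet> v \<le> \<mu>2 \<bullet> u"
      using std_optimal_le[OF w(1), of v] v std_optimal_dest[OF o] by auto
    then show ?thesis using vu by (simp add: \<mu>2_def inner_add_left inner_axis' )
  qed
  define \<eta> where "\<eta> = L - \<bar>\<mu>' $ j - \<mu> $ j\<bar>"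
  have "\<eta> > 0" using strict[of j] by (simp add: \<eta>_def)
  then have "v $ j = u $ j" using key[of \<eta> j] key[of "- \<eta>" j] by (simp add: \<eta>_def[symmetric])
  then show "y $ j = 0 \<Longrightarrow> v $ j = 0" "y $ j = 1 \<Longrightarrow> v $ j = 1" using u by auto
qed

section \<open>Directions and dual prices from perturbed programs\<close>

lemma near_shift_rhs: "near \<mu> C (b + \<delta> *\<^sub>R axis i 1)" if "\<bar>\<delta>\<bar> \<le> L"
  using that L_pos by (auto simp: near_def axis_def)

text \<open>The direction that uses one more unit of resource \<open>i\<close> earns at least
  \<open>L\<close>; this gain will be the dual price of \<open>i\<close>. Two perturbations are
  combined: lowering \<open>b\<close> at \<open>i\<close> by \<open>L\<close>, and charging every
  type \<open>L\<close> times its use of \<open>i\<close>, which moves rewards by at most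
  \<open>L\<close> because entries of \<open>C\<close> are at most 1.\<close>

lemma primal_decrease:
  assumes "\<And>i j. \<bar>C $ i $ j\<bar> \<le> 1"
  obtains d where "C *v d = axis i 1" "interior_dir d" "L \<le> \<mu> \<bullet> d"
proof -
  define b' where "b' = b + (- L) *\<^sub>R axis i 1"
  have "near \<mu> C b'" unfolding b'_def using L_pos by (intro near_shift_rhs) auto
  then obtain y' s' z' where y': "std_optimal \<mu> C b' y' s' z'" "C *v y' = b'"
    "\<And>j. y $ j = 0 \<Longrightarrow> y' $ j = 0" "\<And>j. y $ j = 1 \<Longrightarrow> y' $ j = 1"
    by (elim near_solution) metis
  define \<mu>2 where "\<mu>2 = \<mu> - L *\<^sub>R (C $ i)"
  have "near \<mu>2 C b"
    using L_pos assms by (auto simp: near_def \<mu>2_def abs_mult mult_le_cancel_left1)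
  then obtain w s2 z2 where w: "std_optimal \<mu>2 C b w s2 z2" "C *v w = b"
    "\<And>j. y $ j = 0 \<Longrightarrow> w $ j = 0" "\<And>j. y $ j = 1 \<Longrightarrow> w $ j = 1"
    by (elim near_solution) metis
  have "w = y" by (rule near_solution_unique[OF \<open>near \<mu>2 C b\<close>]) (use w C_y in auto)
  \<comment> \<open>Under the charged rewards \<open>y\<close> is still optimal, and
    \<open>y'\<close> is feasible. As \<open>y\<close> uses \<open>L\<close> more of resource
    \<open>i\<close>, its advantage before the charge is at least \<open>L * L\<close>.\<close>
  have "\<mu>2 \<bullet> y' \<le> \<mu>2 \<bullet> y"
    using std_optimal_le[OF w(1), of y'] std_optimal_dest[OF y'(1)] y'(2) L_pos \<open>w = y\<close>
    by (auto simp: b'_def less_eq_vec_def axis_def)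
  moreover have "C $ i \<bullet> y' = b $ i - L" "C $ i \<bullet> y = b $ i"
    using arg_cong[OF y'(2), of "\<lambda>v. v $ i"] arg_cong[OF C_y, of "\<lambda>v. v $ i"]
    by (auto simp: b'_def axis_def matrix_vector_mul_component)
  ultimately have *: "L * L \<le> \<mu> \<bullet> (y - y')"
    by (simp add: \<mu>2_def inner_diff_left inner_diff_right algebra_simps)
  define d where "d = (1 / L) *\<^sub>R (y - y')"
  show thesis
  proof
    show "C *v d = axis i 1"
      using L_pos by (simp add: d_def matrix_vector_mult_scaleR matrix_vector_mult_diff_distrib C_y y'(2) b'_def)
    show "interior_dir d" using y' by (auto simp: interior_dir_def d_def)
    show "L \<le> \<mu> \<bullet> d" using * L_pos by (simp add: d_def inner_scaleR_right pos_le_divide_eq)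
  qed
qed

text \<open>Pricing each resource at the gain of its direction gives a dual solution whose value
  equals the primal optimum. The given dual optimum therefore has no duality gap, which yields
  complementary slackness for it and then its prices.\<close>

lemma dual_optimal_facts:
  assumes C1: "\<And>i j. \<bar>C $ i $ j\<bar> \<le> 1" and dual: "dual_optimal \<mu> C b lam \<gamma>"
  shows "\<And>i. L \<le> lam $ i"
    and "\<And>j. y $ j = 1 \<Longrightarrow> (transpose C *v lam) $ j \<le> \<mu> $ j"
    and "\<And>j. y $ j = 0 \<Longrightarrow> \<mu> $ j \<le> (transpose C *v lam) $ j"
    and "\<And>j. 0 < y $ j \<Longrightarrow> y $ j < 1 \<Longrightarrow> \<mu> $ j = (transpose C *v lam) $ j"
proof -
  have "\<forall>i. \<exists>d. C *v d = axis i 1 \<and> interior_dir d \<and> L \<le> \<mu> \<bullet> d"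
    using primal_decrease[OF C1] by metis
  then obtain D where D: "\<And>i. C *v D i = axis i 1" "\<And>i. interior_dir (D i)" "\<And>i. L \<le> \<mu> \<bullet> D i"
    by metis
  define l0 :: "real^'m" where "l0 = (\<chi> i. \<mu> \<bullet> D i)"
  \<comment> \<open>\<open>v j\<close> consumes exactly what type \<open>j\<close> does, but along
    interior types only. So \<open>axis j 1 - v j\<close> is a kernel direction, and its objective
    is the reduced reward of \<open>j\<close> under \<open>l0\<close>.\<close>
  define v where "v j = (\<Sum>i\<in>UNIV. C $ i $ j *\<^sub>R D i)" for j
  have Cv: "C *v v j = column j C" for j
    by (simp add: v_def linear_sum[OF matrix_vector_mul_linear] matrix_vector_mult_scaleR D(1) sum_axis column_def)
  have Ca: "C *v axis j 1 = column j C" for j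
    by (simp add: matrix_vector_mult_basis)
  have l0_pos: "0 \<le> l0 $ i" for i using D(3)[of i] L_pos by (simp add: l0_def)
  have mu_v: "\<mu> \<bullet> v j = (transpose C *v l0) $ j" for j
    by (simp add: v_def l0_def inner_sum_right matrix_vector_mult_def transpose_def)
  have v_int: "interior_dir (v j)" for j using D(2) by (simp add: v_def interior_dir_def)
  have kern: "C *v (axis j 1 - v j) = 0" "C *v (v j - axis j 1) = 0" for j
    by (auto simp: matrix_vector_mult_diff_distrib Cv Ca)
  have l0_int: "\<mu> $ j = (transpose C *v l0) $ j" if "0 < y $ j" "y $ j < 1" for j
  proof -
    have "interior_dir (axis j 1 - v j)"
      using v_int[of j] that by (auto simp: interior_dir_def axis_def)
    then have "axis j 1 = v j" using interior_kernel kern(1)[of j] by force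
    then show ?thesis using mu_v[of j] by (metis inner_axis' inner_commute mult_1 real_inner_1_right inner_real_def)
  qed
  have l0_0: "\<mu> $ j \<le> (transpose C *v l0) $ j" if "y $ j = 0" for j
  proof -
    have "\<mu> \<bullet> (axis j 1 - v j) \<le> 0"
      using v_int[of j] that by (intro feasible_dir_nonpos kern) (auto simp: interior_dir_def axis_def)
    then show ?thesis by (simp add: inner_diff_right mu_v inner_axis)
  qed
  have l0_1: "(transpose C *v l0) $ j \<le> \<mu> $ j" if "y $ j = 1" for j
  proof -
    have "\<mu> \<bullet> (v j - axis j 1) \<le> 0"
      using v_int[of j] that by (intro feasible_dir_nonpos kern) (auto simp: interior_dir_def axis_def)
    then show ?thesis by (simp add: inner_diff_right mu_v inner_axis)
  qed
  have adj: "b \<bullet> l = (\<Sum>j\<in>UNIV. y $ j * (transpose C *v l) $ j)" for l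
  proof -
    have "b \<bullet> l = y \<bullet> (transpose C *v l)"
      unfolding C_y[symmetric] by (metis dot_lmul_matrix inner_commute transpose_matrix_vector)
    then show ?thesis by (simp add: inner_vec_def)
  qed
  define g0 :: "real^'n" where "g0 = (\<chi> j. max 0 (\<mu> $ j - (transpose C *v l0) $ j))"
  have "dual_feasible \<mu> C l0 g0"
    using l0_pos by (auto simp: dual_feasible_def less_eq_vec_def g0_def max_def)
  then have "b \<bullet> lam + (\<Sum>j\<in>UNIV. \<gamma> $ j) \<le> b \<bullet> l0 + (\<Sum>j\<in>UNIV. g0 $ j)"
    using dual by (simp add: dual_optimal_def)
  also have "\<dots> = (\<Sum>j\<in>UNIV. y $ j * (transpose C *v l0) $ j + g0 $ j)"
    by (simp add: adj sum.distrib)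
  also have "\<dots> = (\<Sum>j\<in>UNIV. y $ j * \<mu> $ j)"
  proof (rule sum.cong[OF refl])
    fix j
    consider "y $ j = 0" | "y $ j = 1" | "0 < y $ j" "y $ j < 1"
      using y_bounds[of j] by linarith
    then show "y $ j * (transpose C *v l0) $ j + g0 $ j = y $ j * \<mu> $ j"
    proof cases
      case 1 then show ?thesis using l0_0[OF 1] by (simp add: g0_def)
    next
      case 2 then show ?thesis using l0_1[OF 2] by (simp add: g0_def)
    next
      case 3 then show ?thesis using l0_int[OF 3] by (simp add: g0_def)
    qed
  qed
  finally have le: "b \<bullet> lam + (\<Sum>j\<in>UNIV. \<gamma> $ j) \<le> (\<Sum>j\<in>UNIV. y $ j * \<mu> $ j)" .
  have df: "\<mu> $ j \<le> (transpose C *v lam) $ j + \<gamma> $ j" "0 \<le> \<gamma> $ j" for j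
    using dual by (auto simp: dual_optimal_def dual_feasible_def less_eq_vec_def)
  \<comment> \<open>The two summands are the complementary slackness products; summed over the types
    they give the duality gap.\<close>
  define h where "h j = (1 - y $ j) * \<gamma> $ j + y $ j * ((transpose C *v lam) $ j + \<gamma> $ j - \<mu> $ j)" for j
  have h_pos: "0 \<le> (1 - y $ j) * \<gamma> $ j" "0 \<le> y $ j * ((transpose C *v lam) $ j + \<gamma> $ j - \<mu> $ j)" for j
    using df[of j] y_bounds[of j] by (auto intro!: mult_nonneg_nonneg)
  have "(\<Sum>j\<in>UNIV. h j) = b \<bullet> lam + (\<Sum>j\<in>UNIV. \<gamma> $ j) - (\<Sum>j\<in>UNIV. y $ j * \<mu> $ j)"
    unfolding adj sum.distrib[symmetric] sum_subtractf[symmetric]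
    by (intro sum.cong) (auto simp: h_def algebra_simps)
  then have "(\<Sum>j\<in>UNIV. h j) \<le> 0" using le by simp
  moreover have "0 \<le> h j" for j using h_pos[of j] by (simp add: h_def)
  ultimately have "h j = 0" for j
    by (metis finite sum_nonneg_0 sum_nonneg UNIV_I antisym)
  then have slack: "(1 - y $ j) * \<gamma> $ j = 0" "y $ j * ((transpose C *v lam) $ j + \<gamma> $ j - \<mu> $ j) = 0" for j
    using h_pos[of j] unfolding h_def by (smt (verit))+
  show "(transpose C *v lam) $ j \<le> \<mu> $ j" if "y $ j = 1" for j
    using slack(2)[of j] df(2)[of j] that by simp
  show "\<mu> $ j \<le> (transpose C *v lam) $ j" if "y $ j = 0" for j
    using slack(1)[of j] df(1)[of j] that by simp
  show mui: "\<mu> $ j = (transpose C *v lam) $ j" if "0 < y $ j" "y $ j < 1" for j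
    using slack[of j] that by simp
  show "L \<le> lam $ i" for i
  proof -
    \<comment> \<open>\<open>D i\<close> lives on types with fractional \<open>y\<close>, whose
      reduced rewards vanish under \<open>lam\<close>, so its gain is the price of
      \<open>i\<close>.\<close>
    have "\<mu> \<bullet> D i = (\<Sum>j\<in>UNIV. D i $ j * (transpose C *v lam) $ j)"
      unfolding inner_vec_def
    proof (rule sum.cong[OF refl])
      fix j show "\<mu> $ j \<bullet> D i $ j = D i $ j * (transpose C *v lam) $ j"
      proof (cases "y $ j = 0 \<or> y $ j = 1")
        case True then show ?thesis using D(2)[of i] by (auto simp: interior_dir_def)
      next
        case False then show ?thesis using mui[of j] y_bounds[of j] by simp
      qed
    qed
    also have "\<dots> = D i \<bullet> (transpose C *v lam)" by (simp add: inner_vec_def)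
    also have "\<dots> = (C *v D i) \<bullet> lam" by (metis dot_lmul_matrix inner_commute transpose_matrix_vector)
    also have "\<dots> = lam $ i" by (simp add: D(1) inner_axis')
    finally show ?thesis using D(3)[of i] by simp
  qed
qed

end

section \<open>Transfer to the order model\<close>

definition excess :: "('n \<Rightarrow> real) \<Rightarrow> ('n \<Rightarrow> real^'m) \<Rightarrow> real^'m \<Rightarrow> 'n \<Rightarrow> real" where
  "excess \<mu> c lam j = \<mu> j - c j \<bullet> lam"

text \<open>
  In \<open>slack\<close> the benchmark accepts the types of positive excess in full, so raising the consumption
  of one of them by \<open>L\<close> and lowering the capacity by \<open>L\<close> must leave the basic solution feasible.
\<close>

locale stable_orders =
  fixes \<mu> :: "'n::finite \<Rightarrow> real" and c :: "'n \<Rightarrow> real^'m::finite" and P :: "'n pmf"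
    and b lam :: "real^'m" and L :: real
  assumes model: "order_model \<mu> c P b"
    and L_pos: "0 < L"
    and lam_ge: "\<And>i. L \<le> lam $ i"
    and b_ge: "\<And>i. L \<le> b $ i"
    and b_le: "\<And>i. b $ i + L \<le> 1"
    and OPT_D_eq: "OPT_D \<mu> c P b = b \<bullet> lam + (\<Sum>j\<in>UNIV. pmf P j * max 0 (excess \<mu> c lam j))"
    and stable: "\<And>w b' y. (\<And>j. \<bar>w j - pmf P j\<bar> < L) \<Longrightarrow> (\<And>i. \<bar>b' $ i - b $ i\<bar> \<le> L) \<Longrightarrow>
      alloc_optimal w \<mu> c b' y \<Longrightarrow>
      (\<Sum>j\<in>UNIV. (w j * y $ j) *\<^sub>R c j) = b' \<and>
      (\<forall>j. (0 < excess \<mu> c lam j \<longrightarrow> y $ j = 1) \<and> (excess \<mu> c lam j < 0 \<longrightarrow> y $ j = 0))"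
    and slack: "\<And>i j. 0 < excess \<mu> c lam j \<Longrightarrow>
      (\<Sum>k | 0 < excess \<mu> c lam k. pmf P k * c k $ i) + 2 * L \<le> b $ i"

lemma order_model_bounds:
  assumes "order_model \<mu> c P b"
  shows "0 \<le> \<mu> j" "\<mu> j \<le> 1" "0 \<le> c j $ i" "c j $ i \<le> 1"
proof -
  have "0 \<le> c j" "infnorm (c j) \<le> 1" using assms by (auto simp: order_model_def)
  then show "0 \<le> c j $ i" "c j $ i \<le> 1"
    using component_le_infnorm_cart[of "c j" i] by (auto simp: less_eq_vec_def)
qed (use assms in \<open>auto simp: order_model_def\<close>)

lemma alloc_optimal_imp_std_optimal:
  fixes c :: "'n::finite \<Rightarrow> real^'m::finite"
  assumes "alloc_optimal w \<mu> c b y"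
  shows "std_optimal (\<chi> j. w j * \<mu> j) (\<chi> i j. w j * c j $ i) b y
    (b - (\<chi> i j. w j * c j $ i) *v y) (1 - y)"
proof -
  have mv: "(\<chi> i j. w j * c j $ i) *v y = (\<Sum>j\<in>UNIV. (w j * y $ j) *\<^sub>R c j)" for y :: "real^'n"
    by (simp add: vec_eq_iff matrix_vector_mult_def algebra_simps)
  have iv: "(\<chi> j. w j * \<mu> j) \<bullet> y = alloc_value w \<mu> y" for y :: "real^'n"
    by (simp add: inner_vec_def alloc_value_def)
  show ?thesis
    using assms
    by (intro std_optimalI)
       (auto simp: mv iv alloc_optimal_def alloc_feasible_def less_eq_vec_def)
qed

lemma stable_orders_intro:
  fixes \<mu> :: "'n::finite \<Rightarrow> real" and c :: "'n \<Rightarrow> real^'m::finite"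
  assumes model: "order_model \<mu> c P b"
    and nondeg: "nondegenerate (scaled_reward P \<mu>) (scaled_consumption P c) b y 0 z"
    and dual: "dual_optimal (scaled_reward P \<mu>) (scaled_consumption P c) b lam gam"
    and stab: "stability_constant (scaled_reward P \<mu>) (scaled_consumption P c) b y L"
  shows "stable_orders \<mu> c P b lam L"
proof -
  define m where "m = scaled_reward P \<mu>"
  define C where "C = scaled_consumption P c"
  interpret stable_lp m C b y z L
    using nondeg stab by unfold_locales (auto simp: m_def C_def)
  note [simp] = order_model_bounds[OF model]
  have p_pos: "0 < pmf P j" for j using model by (simp add: order_model_def)
  have sum_p: "(\<Sum>j\<in>UNIV. pmf P j) = 1" by (simp add: sum_pmf_eq_1)
  have C_nth: "C $ i $ j = pmf P j * c j $ i" for i j by (simp add: C_def scaled_consumption_def)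
  have m_nth: "m $ j = pmf P j * \<mu> j" for j by (simp add: m_def scaled_reward_def)
  have C_pos: "0 \<le> C $ i $ j" for i j by (simp add: C_nth)
  have C_le: "C $ i $ j \<le> pmf P j" for i j by (simp add: C_nth mult_left_le)
  have C1: "\<bar>C $ i $ j\<bar> \<le> 1" for i j using C_pos[of i j] C_le[of i j] pmf_le_1[of P j] by linarith
  have dual': "dual_optimal m C b lam gam" using dual by (simp add: m_def C_def)
  note d = dual_optimal_facts[OF C1 dual']
  let ?g = "excess \<mu> c lam"
  have g: "m $ j - (transpose C *v lam) $ j = pmf P j * ?g j" for j
    by (simp add: m_nth matrix_vector_mult_def transpose_def C_nth excess_def inner_vec_def sum_distrib_left algebra_simps)
  have g1: "0 \<le> ?g j" if "y $ j = 1" for j using d(2)[OF that] g[of j] p_pos[of j]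
    by (smt (verit) mult_pos_neg)
  have g0: "?g j \<le> 0" if "y $ j = 0" for j using d(3)[OF that] g[of j] p_pos[of j]
    by (smt (verit) mult_pos_pos)
  have gi: "?g j = 0" if "0 < y $ j" "y $ j < 1" for j using d(4)[OF that] g[of j] p_pos[of j] by simp
  have y1: "y $ j = 1" if "0 < ?g j" for j using that g0[of j] gi[of j] y_bounds[of j] by fastforce
  have y0: "y $ j = 0" if "?g j < 0" for j using that g1[of j] gi[of j] y_bounds[of j] by fastforce
  \<comment> \<open>The use of resource \<open>i\<close> can be made equal to
    \<open>b $ i - L\<close> and to \<open>b $ i + L\<close>; as it always lies between 0 and 1,
    this bounds \<open>b\<close> on both sides.\<close>
  have shift: "\<exists>y'. C *v y' = b + \<delta> *\<^sub>R axis i 1 \<and> (\<forall>j. 0 \<le> y' $ j \<and> y' $ j \<le> 1)"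
    if "\<bar>\<delta>\<bar> \<le> L" for \<delta> i
    using near_solution[OF near_shift_rhs[OF that]] std_optimal_dest by metis
  show ?thesis
  proof
    show "order_model \<mu> c P b" by fact
    show "0 < L" by (rule L_pos)
    show "L \<le> lam $ i" for i by (rule d(1))
    show "L \<le> b $ i" for i
    proof -
      obtain y' where y': "C *v y' = b + (- L) *\<^sub>R axis i 1" "\<forall>j. 0 \<le> y' $ j \<and> y' $ j \<le> 1"
        using shift[of "- L" i] L_pos by auto
      have "0 \<le> (C *v y') $ i"
        unfolding matrix_vector_mult_def using y'(2) C_pos by (auto intro!: sum_nonneg)
      then show ?thesis by (simp add: y'(1) axis_def)
    qed
    show "b $ i + L \<le> 1" for i
    proof -
      obtain y' where y': "C *v y' = b + L *\<^sub>R axis i 1" "\<forall>j. 0 \<le> y' $ j \<and> y' $ j \<le> 1"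
        using shift[of L i] L_pos by auto
      have "C $ i $ j * y' $ j \<le> pmf P j" for j
        using y'(2) C_pos[of i j] by (intro order_trans[OF mult_left_le C_le]) auto
      then have "(C *v y') $ i \<le> (\<Sum>j\<in>UNIV. pmf P j)"
        unfolding matrix_vector_mult_def by (auto intro!: sum_mono)
      then show ?thesis by (simp add: y'(1) axis_def sum_p)
    qed
    show "OPT_D \<mu> c P b = b \<bullet> lam + (\<Sum>j\<in>UNIV. pmf P j * max 0 (?g j))"
    proof -
      have mv: "C *v u = (\<Sum>j\<in>UNIV. (pmf P j * u $ j) *\<^sub>R c j)" for u :: "real^'n"
        by (simp add: vec_eq_iff matrix_vector_mult_def C_nth algebra_simps)
      have iv: "m \<bullet> u = alloc_value (pmf P) \<mu> u" for u
        by (simp add: inner_vec_def alloc_value_def m_nth)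
      have feas: "alloc_feasible (pmf P) c b y"
        using C_y y_bounds by (auto simp: alloc_feasible_def mv[symmetric] less_eq_vec_def)
      have max: "alloc_value (pmf P) \<mu> u \<le> alloc_value (pmf P) \<mu> y" if "alloc_feasible (pmf P) c b u" for u
        unfolding iv[symmetric] using that
        by (intro std_optimal_le[OF opt]) (auto simp: alloc_feasible_def mv[symmetric] less_eq_vec_def)
      have "OPT_D \<mu> c P b = m \<bullet> y"
        unfolding OPT_D_def iv using feas max by (intro cSup_eq_maximum) auto
      also have "\<dots> = (\<Sum>j\<in>UNIV. y $ j * (transpose C *v lam) $ j + y $ j * (pmf P j * ?g j))"
        unfolding inner_vec_def by (intro sum.cong) (auto simp: g[symmetric] algebra_simps)
      also have "\<dots> = y \<bullet> (transpose C *v lam) + (\<Sum>j\<in>UNIV. y $ j * (pmf P j * ?g j))"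
        by (simp add: inner_vec_def sum.distrib)
      also have "y \<bullet> (transpose C *v lam) = (C *v y) \<bullet> lam"
        by (metis dot_lmul_matrix inner_commute transpose_matrix_vector)
      also have "(\<Sum>j\<in>UNIV. y $ j * (pmf P j * ?g j)) = (\<Sum>j\<in>UNIV. pmf P j * max 0 (?g j))"
      proof (rule sum.cong[OF refl])
        fix j
        consider "0 < ?g j" | "?g j < 0" | "?g j = 0" by linarith
        then show "y $ j * (pmf P j * ?g j) = pmf P j * max 0 (?g j)"
          by cases (auto simp: y1 y0)
      qed
      finally show ?thesis by (simp add: C_y)
    qed
    fix w b' v
    assume w: "\<And>j. \<bar>w j - pmf P j\<bar> < L" and b': "\<And>i. \<bar>b' $ i - b $ i\<bar> \<le> L"
      and o: "alloc_optimal w \<mu> c b' v"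
    define m' where "m' = (\<chi> j. w j * \<mu> j)"
    define C' :: "real^'n^'m" where "C' = (\<chi> i j. w j * c j $ i)"
    have o': "std_optimal m' C' b' v (b' - C' *v v) (1 - v)"
      unfolding m'_def C'_def by (rule alloc_optimal_imp_std_optimal[OF o])
    have mult_lt: "\<bar>w j - pmf P j\<bar> * x < L" if "0 \<le> x" "x \<le> 1" for j x
      using w[of j] that mult_left_le[of x "\<bar>w j - pmf P j\<bar>"] by linarith
    \<comment> \<open>Strictness is kept for \<open>near_optimal_at_bounds\<close>: the policy may
      pick any of several optimal solutions.\<close>
    have m'_lt: "\<bar>m' $ j - m $ j\<bar> < L" for j
      using mult_lt[of "\<mu> j" j] by (simp add: m'_def m_nth abs_mult left_diff_distrib[symmetric])
    have C'_lt: "\<bar>C' $ i $ j - C $ i $ j\<bar> < L" for i j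
      using mult_lt[of "c j $ i" j] by (simp add: C'_def C_nth abs_mult left_diff_distrib[symmetric])
    have near: "near m' C' b'"
      using m'_lt C'_lt b' by (auto simp: near_def less_imp_le)
    have "C' *v v = b'" by (rule near_stable(2)[OF near o'])
    moreover have "C' *v v = (\<Sum>j\<in>UNIV. (w j * v $ j) *\<^sub>R c j)"
      by (simp add: C'_def vec_eq_iff matrix_vector_mult_def algebra_simps)
    ultimately show "(\<Sum>j\<in>UNIV. (w j * v $ j) *\<^sub>R c j) = b' \<and>
      (\<forall>j. (0 < ?g j \<longrightarrow> v $ j = 1) \<and> (?g j < 0 \<longrightarrow> v $ j = 0))"
      using near_optimal_at_bounds[OF near m'_lt o'] y0 y1 by auto
  next
    fix i j assume j: "0 < ?g j"
    define C' where "C' = (\<chi> i' j'. C $ i' $ j' + (if i' = i \<and> j' = j then L else 0))"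
    define b' where "b' = b + (- L) *\<^sub>R axis i 1"
    have "near m C' b'"
      using L_pos by (auto simp: near_def C'_def b'_def axis_def)
    then obtain y' s' z' where y': "std_optimal m C' b' y' s' z'" "C' *v y' = b'"
      "\<And>j. y $ j = 1 \<Longrightarrow> y' $ j = 1"
      by (elim near_solution) metis
    have pos: "0 \<le> y' $ k" for k by (rule std_optimal_dest(2)[OF y'(1)])
    have "(\<Sum>k | 0 < ?g k. pmf P k * c k $ i) + L = (\<Sum>k | 0 < ?g k. C' $ i $ k)"
      using j by (simp add: C'_def C_nth sum.distrib)
    also have "\<dots> = (\<Sum>k | 0 < ?g k. C' $ i $ k * y' $ k)"
      using y'(3) y1 by (intro sum.cong) auto
    also have "\<dots> \<le> (\<Sum>k\<in>UNIV. C' $ i $ k * y' $ k)"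
      using L_pos C_pos pos by (intro sum_mono2) (auto simp: C'_def)
    also have "\<dots> = (C' *v y') $ i" by (simp add: matrix_vector_mult_def)
    also have "\<dots> = b $ i - L" by (simp add: y'(2) b'_def axis_def)
    finally show "(\<Sum>k | 0 < ?g k. pmf P k * c k $ i) + 2 * L \<le> b $ i" by simp
  qed
qed

section \<open>Expectations along a run\<close>

definition always :: "('a list \<Rightarrow> bool) \<Rightarrow> nat \<Rightarrow> 'a list \<Rightarrow> bool" where
  "always Q s h \<longleftrightarrow> (\<forall>r. s \<le> r \<and> r \<le> length h \<longrightarrow> Q (take r h))"

text \<open>\<open>Q\<close> is left free at the crossing time \<open>r\<close>: the crossings of
  interest happen exactly where \<open>Q\<close> first fails.\<close>

definition crosses :: "('a list \<Rightarrow> bool) \<Rightarrow> ('a list \<Rightarrow> real) \<Rightarrow> nat \<Rightarrow> 'a list \<Rightarrow> bool" where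
  "crosses Q \<Psi> s h \<longleftrightarrow>
     (\<exists>r. s \<le> r \<and> r \<le> length h \<and> 1 \<le> \<Psi> (take r h) \<and> (\<forall>q. s \<le> q \<and> q < r \<longrightarrow> Q (take q h)))"

lemma always_snoc:
  assumes "s \<le> Suc (length h)"
  shows "always Q s (h @ [x]) \<longleftrightarrow> always Q s h \<and> Q (h @ [x])"
proof
  assume a: "always Q s (h @ [x])"
  have "Q (take r h)" if "s \<le> r" "r \<le> length h" for r
    using a that unfolding always_def by (auto dest!: spec[of _ r])
  moreover have "Q (h @ [x])"
    using a assms unfolding always_def by (auto dest!: spec[of _ "Suc (length h)"])
  ultimately show "always Q s h \<and> Q (h @ [x])" by (simp add: always_def)
next
  assume "always Q s h \<and> Q (h @ [x])"
  then show "always Q s (h @ [x])" by (auto simp: always_def le_Suc_eq)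
qed

lemma crosses_snoc:
  assumes "s \<le> length h"
  shows "crosses Q \<Psi> s (h @ [x]) \<longleftrightarrow> crosses Q \<Psi> s h \<or> (always Q s h \<and> 1 \<le> \<Psi> (h @ [x]))"
proof
  assume "crosses Q \<Psi> s (h @ [x])"
  then obtain r where r: "s \<le> r" "r \<le> Suc (length h)" "1 \<le> \<Psi> (take r (h @ [x]))"
    "\<And>q. s \<le> q \<Longrightarrow> q < r \<Longrightarrow> Q (take q (h @ [x]))"
    by (auto simp: crosses_def)
  have q: "Q (take q h)" if "s \<le> q" "q < r" "q \<le> length h" for q
    using r(4)[OF that(1,2)] that(3) by simp
  show "crosses Q \<Psi> s h \<or> (always Q s h \<and> 1 \<le> \<Psi> (h @ [x]))"
  proof (cases "r \<le> length h")
    case True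
    then show ?thesis using r q by (auto simp: crosses_def intro!: exI[of _ r])
  next
    case False
    then have "r = Suc (length h)" using r(2) by simp
    then show ?thesis using r(3) q by (auto simp: always_def)
  qed
next
  assume "crosses Q \<Psi> s h \<or> (always Q s h \<and> 1 \<le> \<Psi> (h @ [x]))"
  then show "crosses Q \<Psi> s (h @ [x])"
  proof
    assume "crosses Q \<Psi> s h"
    then obtain r where "s \<le> r" "r \<le> length h" "1 \<le> \<Psi> (take r h)" "\<And>q. s \<le> q \<Longrightarrow> q < r \<Longrightarrow> Q (take q h)"
      by (auto simp: crosses_def)
    then show ?thesis unfolding crosses_def by (intro exI[of _ r]) auto
  next
    assume "always Q s h \<and> 1 \<le> \<Psi> (h @ [x])"
    then show ?thesis using assms unfolding crosses_def always_def by (intro exI[of _ "Suc (length h)"]) auto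
  qed
qed

lemma crosses_length_eq: "length h = s \<Longrightarrow> crosses Q \<Psi> s h \<longleftrightarrow> 1 \<le> \<Psi> h"
  unfolding crosses_def by (auto intro!: exI[of _ s])

section \<open>Means and maximal inequalities under the law of a run\<close>

locale order_process =
  fixes P :: "'n::finite pmf" and \<pi> :: "'n policy"
begin

definition ex :: "nat \<Rightarrow> ('n history \<Rightarrow> real) \<Rightarrow> real" where
  "ex t F = measure_pmf.expectation (run P \<pi> t) F"

abbreviation pr :: "nat \<Rightarrow> ('n history \<Rightarrow> bool) \<Rightarrow> real" where
  "pr t Q \<equiv> ex t (\<lambda>h. of_bool (Q h))"

definition next_mean :: "'n history \<Rightarrow> ('n history \<Rightarrow> real) \<Rightarrow> real" where
  "next_mean h F = (\<Sum>j\<in>UNIV. pmf P j * (\<Sum>x\<in>UNIV. pmf (\<pi> h j) x * F (h @ [(j, x)])))"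

lemma finite_run: "finite (set_pmf (run P \<pi> t))"
  by (induction t) auto

lemma length_run: "h \<in> set_pmf (run P \<pi> t) \<Longrightarrow> length h = t"
  by (induction t arbitrary: h) auto

lemma integrable_run [simp]: "integrable (measure_pmf (run P \<pi> t)) (F :: _ \<Rightarrow> real)"
  by (rule integrable_measure_pmf_finite[OF finite_run])

lemma ex_mono: "(\<And>h. h \<in> set_pmf (run P \<pi> t) \<Longrightarrow> F h \<le> G h) \<Longrightarrow> ex t F \<le> ex t G"
  unfolding ex_def by (intro integral_mono_AE) (auto simp: AE_measure_pmf_iff)

lemma ex_cong: "(\<And>h. h \<in> set_pmf (run P \<pi> t) \<Longrightarrow> F h = G h) \<Longrightarrow> ex t F = ex t G"
  by (intro antisym ex_mono) auto

lemma ex_add: "ex t (\<lambda>h. F h + G h) = ex t F + ex t G"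
  and ex_diff: "ex t (\<lambda>h. F h - G h) = ex t F - ex t G"
  and ex_cmult: "ex t (\<lambda>h. a * F h) = a * ex t F"
  and ex_sum: "ex t (\<lambda>h. \<Sum>i\<in>I. H i h) = (\<Sum>i\<in>I. ex t (H i))"
  and ex_const: "ex t (\<lambda>h. a) = a"
  by (auto simp: ex_def)

lemma ex_nonneg: "(\<And>h. h \<in> set_pmf (run P \<pi> t) \<Longrightarrow> 0 \<le> F h) \<Longrightarrow> 0 \<le> ex t F"
  using ex_mono[of t "\<lambda>_. 0" F] by (simp add: ex_const)

lemma ex_le_const: "(\<And>h. h \<in> set_pmf (run P \<pi> t) \<Longrightarrow> F h \<le> a) \<Longrightarrow> ex t F \<le> a"
  using ex_mono[of t F "\<lambda>_. a"] by (simp add: ex_const)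

lemma ex_0: "ex 0 F = F []"
  by (simp add: ex_def)

lemma ex_Suc: "ex (Suc t) F = ex t (\<lambda>h. next_mean h F)"
proof -
  have inner: "measure_pmf.expectation (P \<bind> (\<lambda>j. \<pi> h j \<bind> (\<lambda>x. return_pmf (h @ [(j, x)])))) F = next_mean h F" for h
    by (simp add: next_mean_def pmf_expectation_bind[where A = UNIV])
  have "ex (Suc t) F = (\<Sum>h\<in>set_pmf (run P \<pi> t). pmf (run P \<pi> t) h *\<^sub>R next_mean h F)"
    unfolding ex_def run.simps
    by (subst pmf_expectation_bind[OF finite_run]) (auto simp: inner)
  also have "\<dots> = ex t (\<lambda>h. next_mean h F)"
    unfolding ex_def by (rule integral_measure_pmf[OF finite_run, symmetric]) auto
  finally show ?thesis .
qed

lemma sum_pmf_bool: "(\<Sum>x\<in>UNIV. pmf q x) = 1" for q :: "bool pmf"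
  by (simp add: sum_pmf_eq_1)

lemma sum_P: "(\<Sum>j\<in>UNIV. pmf P j) = 1"
  by (simp add: sum_pmf_eq_1)

lemma next_mean_const: "(\<And>j x. F (h @ [(j, x)]) = a) \<Longrightarrow> next_mean h F = a"
  by (simp add: next_mean_def sum_distrib_right[symmetric] sum_pmf_bool sum_P)

lemma next_mean_mono:
  assumes "\<And>j x. x \<in> set_pmf (\<pi> h j) \<Longrightarrow> F (h @ [(j, x)]) \<le> G (h @ [(j, x)])"
  shows "next_mean h F \<le> next_mean h G"
proof -
  have "pmf (\<pi> h j) x * F (h @ [(j, x)]) \<le> pmf (\<pi> h j) x * G (h @ [(j, x)])" for j x
    using assms[of x j] by (cases "x \<in> set_pmf (\<pi> h j)") (auto simp: set_pmf_iff intro: mult_left_mono)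
  then show ?thesis
    unfolding next_mean_def by (intro sum_mono mult_left_mono[OF sum_mono pmf_nonneg])
qed

lemma ex_take:
  assumes "s \<le> t"
  shows "ex t (\<lambda>h. F (take s h)) = ex s F"
  using assms
proof (induction t rule: dec_induct)
  case base
  show ?case by (intro ex_cong) (simp add: length_run)
next
  case (step t)
  have "ex (Suc t) (\<lambda>h. F (take s h)) = ex t (\<lambda>h. F (take s h))"
    unfolding ex_Suc using step.hyps by (intro ex_cong next_mean_const) (simp add: length_run)
  with step show ?case by simp
qed

text \<open>Weighting by \<open>always Q s\<close> kills the process at the first failure of
  \<open>Q\<close>, which can only lower a nonnegative \<open>\<Psi>\<close>; so the drift has to be
  controlled only while \<open>Q\<close> holds.\<close>

lemma ex_supermartingale:
  assumes su: "s \<le> u" and nonneg: "\<And>h. 0 \<le> \<Psi> h"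
    and drift: "\<And>t h. s \<le> t \<Longrightarrow> t < u \<Longrightarrow> h \<in> set_pmf (run P \<pi> t) \<Longrightarrow> always Q s h \<Longrightarrow> next_mean h \<Psi> \<le> \<Psi> h"
  shows "ex u (\<lambda>h. of_bool (always Q s h) * \<Psi> h) \<le> ex s \<Psi>"
proof -
  have "ex t (\<lambda>h. of_bool (always Q s h) * \<Psi> h) \<le> ex s \<Psi>" if "s \<le> t" "t \<le> u" for t
    using that
  proof (induction t rule: dec_induct)
    case base
    show ?case by (intro ex_mono) (use nonneg in auto)
  next
    case (step t)
    have "next_mean h (\<lambda>h. of_bool (always Q s h) * \<Psi> h) \<le> of_bool (always Q s h) * \<Psi> h"
      if h: "h \<in> set_pmf (run P \<pi> t)" for h
    proof (cases "always Q s h")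
      case True
      have "next_mean h (\<lambda>h. of_bool (always Q s h) * \<Psi> h) \<le> next_mean h \<Psi>"
        using nonneg by (intro next_mean_mono) auto
      then show ?thesis using drift[OF _ _ h True] step True by simp
    next
      case False
      have "next_mean h (\<lambda>h. of_bool (always Q s h) * \<Psi> h) = 0"
        using False step.hyps length_run[OF h] by (intro next_mean_const) (simp add: always_snoc)
      then show ?thesis using False by simp
    qed
    then have "ex (Suc t) (\<lambda>h. of_bool (always Q s h) * \<Psi> h) \<le> ex t (\<lambda>h. of_bool (always Q s h) * \<Psi> h)"
      unfolding ex_Suc by (rule ex_mono)
    then show ?case using step by simp
  qed
  then show ?thesis using su by blast
qed

text \<open>Ville's maximal inequality with the process killed when \<open>Q\<close> fails; it
  covers all periods up to \<open>u\<close> without a union bound.\<close>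

lemma ex_crosses_le:
  assumes su: "s \<le> u" and nonneg: "\<And>h. 0 \<le> \<Psi> h"
    and drift: "\<And>t h. s \<le> t \<Longrightarrow> t < u \<Longrightarrow> h \<in> set_pmf (run P \<pi> t) \<Longrightarrow> always Q s h \<Longrightarrow> next_mean h \<Psi> \<le> \<Psi> h"
  shows "ex u (\<lambda>h. of_bool (crosses Q \<Psi> s h)) \<le> ex s \<Psi>"
proof -
  \<comment> \<open>\<open>V\<close> freezes at 1 once the level is crossed, drops to 0 once
    \<open>Q\<close> has failed without a crossing, and follows \<open>\<Psi>\<close>
    otherwise.\<close>
  define V where "V h = of_bool (crosses Q \<Psi> s h) + of_bool (\<not> crosses Q \<Psi> s h \<and> always Q s h) * \<Psi> h" for h
  have "ex t V \<le> ex s \<Psi>" if "s \<le> t" "t \<le> u" for t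
    using that
  proof (induction t rule: dec_induct)
    case base
    show ?case
      by (intro ex_mono) (use nonneg in \<open>auto simp: V_def crosses_length_eq length_run\<close>)
  next
    case (step t)
    have "next_mean h V \<le> V h" if h: "h \<in> set_pmf (run P \<pi> t)" for h
    proof -
      have len: "s \<le> length h" using step.hyps length_run[OF h] by simp
      consider "crosses Q \<Psi> s h" | "\<not> crosses Q \<Psi> s h" "always Q s h" | "\<not> crosses Q \<Psi> s h" "\<not> always Q s h"
        by blast
      then show ?thesis
      proof cases
        case 1
        then have "next_mean h V = 1"
          using len by (intro next_mean_const) (simp add: V_def crosses_snoc)
        then show ?thesis using 1 by (simp add: V_def)
      next
        case 2
        have "next_mean h V \<le> next_mean h \<Psi>"
          using nonneg 2 len by (intro next_mean_mono) (auto simp: V_def crosses_snoc)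
        also have "\<dots> \<le> \<Psi> h" using drift[OF _ _ h 2(2)] step by simp
        finally show ?thesis using 2 by (simp add: V_def)
      next
        case 3
        then have "next_mean h V = 0"
          using len by (intro next_mean_const) (simp add: V_def crosses_snoc always_snoc)
        then show ?thesis using 3 by (simp add: V_def)
      qed
    qed
    then have "ex (Suc t) V \<le> ex t V" unfolding ex_Suc by (rule ex_mono)
    then show ?case using step by simp
  qed
  then have "ex u V \<le> ex s \<Psi>" using su by blast
  moreover have "ex u (\<lambda>h. of_bool (crosses Q \<Psi> s h)) \<le> ex u V"
    by (intro ex_mono) (use nonneg in \<open>auto simp: V_def\<close>)
  ultimately show ?thesis by simp
qed

section \<open>Empirical frequencies\<close>

lemma ex_prod_types:
  "ex t (\<lambda>h. \<Prod>(j, x)\<leftarrow>h. \<phi> j) = (\<Sum>j\<in>UNIV. pmf P j * \<phi> j) ^ t"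
proof (induction t)
  case (Suc t)
  have "next_mean h (\<lambda>h. \<Prod>(j, x)\<leftarrow>h. \<phi> j) = (\<Sum>j\<in>UNIV. pmf P j * \<phi> j) * (\<Prod>(j, x)\<leftarrow>h. \<phi> j)" for h
    unfolding next_mean_def
    by (simp add: sum_distrib_right[symmetric] sum_pmf_bool) (simp add: sum_distrib_left sum_distrib_right mult_ac)
  then show ?case by (simp add: ex_Suc ex_cmult Suc)
qed (simp add: ex_0)

lemma ex_sum_types_squared:
  assumes "(\<Sum>j\<in>UNIV. pmf P j * \<phi> j) = 0"
  shows "ex t (\<lambda>h. (\<Sum>(j, x)\<leftarrow>h. \<phi> j)\<^sup>2) = t * (\<Sum>j\<in>UNIV. pmf P j * (\<phi> j)\<^sup>2)"
proof (induction t)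
  case (Suc t)
  have "next_mean h (\<lambda>h. (\<Sum>(j, x)\<leftarrow>h. \<phi> j)\<^sup>2) =
      (\<Sum>(j, x)\<leftarrow>h. \<phi> j)\<^sup>2 + (\<Sum>j\<in>UNIV. pmf P j * (\<phi> j)\<^sup>2)" for h
  proof -
    define S where "S = (\<Sum>(j, x)\<leftarrow>h. \<phi> j)"
    have "next_mean h (\<lambda>h. (\<Sum>(j, x)\<leftarrow>h. \<phi> j)\<^sup>2) = (\<Sum>j\<in>UNIV. pmf P j * (S + \<phi> j)\<^sup>2)"
      unfolding next_mean_def by (simp add: sum_distrib_right[symmetric] sum_pmf_bool S_def)
    also have "\<dots> = (\<Sum>j\<in>UNIV. S\<^sup>2 * pmf P j + 2 * S * (pmf P j * \<phi> j) + pmf P j * (\<phi> j)\<^sup>2)"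
      by (intro sum.cong) (auto simp: power2_sum algebra_simps)
    also have "\<dots> = S\<^sup>2 + (\<Sum>j\<in>UNIV. pmf P j * (\<phi> j)\<^sup>2)"
      by (simp add: sum.distrib sum_distrib_left[symmetric] sum_P assms)
    finally show ?thesis by (simp add: S_def)
  qed
  then show ?case by (simp add: ex_Suc ex_add ex_const Suc algebra_simps)
qed (simp add: ex_0)

lemma sum_list_types:
  fixes p :: real
  shows "(\<Sum>(j, x)\<leftarrow>h. of_bool (j = k) - p :: real) = real (count_list (map fst h) k) - length h * p"
  by (induction h) (auto simp: algebra_simps)

lemma sum_list_empirical:
  fixes p :: real
  assumes "h \<noteq> []"
  shows "(\<Sum>(j, x)\<leftarrow>h. of_bool (j = k) - p :: real) = length h * (empirical h k - p)"
  using assms sum_list_types[of k p h] by (simp add: empirical_def right_diff_distrib)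

lemma exp_sum_list: "exp ((s :: real) * (\<Sum>(j, x)\<leftarrow>h. \<phi> j)) = (\<Prod>(j, x)\<leftarrow>h. exp (s * \<phi> j))"
  by (induction h) (auto simp: exp_add distrib_left simp del: mult_exp_exp)

text \<open>Hoeffding's bound for both sides at once. The parameter \<open>h = 4 * L\<close> of the
  exponential moment minimises \<open>h\<^sup>2 / 8 - h * L\<close>.\<close>

lemma ex_empirical_abs_ge:
  assumes L: "0 < L" and t: "0 < t"
  shows "pr t (\<lambda>h. L \<le> \<bar>empirical h k - pmf P k\<bar>) \<le> 2 * exp (- 2 * L\<^sup>2 * t)"
proof -
  define p where "p = pmf P k"
  have p: "0 \<le> p" "p \<le> 1" by (auto simp: p_def pmf_le_1)
  have split: "(\<Sum>j\<in>UNIV. pmf P j * f (of_bool (j = k))) = p * f 1 + (1 - p) * f 0" for f :: "real \<Rightarrow> real"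
  proof -
    have "(\<Sum>j\<in>UNIV. pmf P j * f (of_bool (j = k))) = (\<Sum>j\<in>UNIV. (if j = k then pmf P j * (f 1 - f 0) else 0) + pmf P j * f 0)"
      by (intro sum.cong) (auto simp: algebra_simps)
    also have "\<dots> = p * (f 1 - f 0) + f 0" by (simp add: sum.distrib sum_distrib_right[symmetric] sum_P p_def)
    finally show ?thesis by (simp add: algebra_simps)
  qed
  have mgf: "a * exp (h * (1 - a)) + (1 - a) * exp (- h * a) \<le> exp (h\<^sup>2 / 8)" if "0 \<le> a" "a \<le> 1" "0 \<le> h" for a h :: real
  proof -
    have pos: "0 < 1 + a * (exp h - 1)"
      using that by (intro add_pos_nonneg mult_nonneg_nonneg) auto
    have "a * exp (h * (1 - a)) + (1 - a) * exp (- h * a) = exp (- h * a) * (1 + a * (exp h - 1))"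
      by (simp add: algebra_simps exp_diff exp_minus field_simps)
    also have "\<dots> = exp (- h * a + ln (1 + a * (exp h - 1)))"
      using pos by (subst exp_add) simp
    also have "\<dots> \<le> exp (h\<^sup>2 / 8)" using Hoeffdings_lemma_aux[OF that(3,1)] by simp
    finally show ?thesis .
  qed
  have "of_bool (L \<le> \<bar>empirical h k - p\<bar>) \<le>
      exp (- 4 * L\<^sup>2 * t) * ((\<Prod>(j, x)\<leftarrow>h. exp (4 * L * (of_bool (j = k) - p))) + (\<Prod>(j, x)\<leftarrow>h. exp (- 4 * L * (of_bool (j = k) - p))))"
    if h: "h \<in> set_pmf (run P \<pi> t)" for h
  proof -
    define S where "S = real t * (empirical h k - p)"
    have "h \<noteq> []" using length_run[OF h] t by auto
    have eq: "(\<Prod>(j, x)\<leftarrow>h. exp (r * (of_bool (j = k) - p))) = exp (r * S)" for r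
      unfolding exp_sum_list[symmetric] sum_list_empirical[OF \<open>h \<noteq> []\<close>] by (simp add: S_def length_run[OF h])
    show ?thesis
    proof (cases "L \<le> \<bar>empirical h k - p\<bar>")
      case True
      have "L * t \<le> \<bar>S\<bar>" using mult_left_mono[OF True, of "real t"] by (simp add: S_def abs_mult mult.commute)
      then have "4 * L * (L * t) \<le> 4 * L * \<bar>S\<bar>" using L by (intro mult_left_mono) auto
      then have "1 \<le> exp (- 4 * L\<^sup>2 * t) * exp (4 * L * \<bar>S\<bar>)"
        by (simp add: exp_add[symmetric] power2_eq_square algebra_simps)
      also have "\<dots> \<le> exp (- 4 * L\<^sup>2 * t) * (exp (4 * L * S) + exp (- 4 * L * S))"
        by (intro mult_left_mono) (auto simp: abs_if)
      finally show ?thesis using True unfolding eq by simp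
    next
      case False
      then show ?thesis unfolding eq by simp
    qed
  qed
  then have "pr t (\<lambda>h. L \<le> \<bar>empirical h k - p\<bar>) \<le>
    ex t (\<lambda>h. exp (- 4 * L\<^sup>2 * t) * ((\<Prod>(j, x)\<leftarrow>h. exp (4 * L * (of_bool (j = k) - p))) + (\<Prod>(j, x)\<leftarrow>h. exp (- 4 * L * (of_bool (j = k) - p)))))"
    by (rule ex_mono)
  also have "\<dots> = exp (- 4 * L\<^sup>2 * t) * ((p * exp (4 * L * (1 - p)) + (1 - p) * exp (4 * L * (0 - p))) ^ t +
     (p * exp (- 4 * L * (1 - p)) + (1 - p) * exp (- 4 * L * (0 - p))) ^ t)"
    unfolding ex_cmult ex_add ex_prod_types
      split[of "\<lambda>y. exp (4 * L * (y - p))"] split[of "\<lambda>y. exp (- 4 * L * (y - p))"] ..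
  also have "\<dots> \<le> exp (- 4 * L\<^sup>2 * t) * (exp ((4 * L)\<^sup>2 / 8) ^ t + exp ((4 * L)\<^sup>2 / 8) ^ t)"
  proof (intro mult_left_mono add_mono power_mono)
    show "p * exp (4 * L * (1 - p)) + (1 - p) * exp (4 * L * (0 - p)) \<le> exp ((4 * L)\<^sup>2 / 8)"
      using mgf[of p "4 * L"] p L by simp
    show "p * exp (- 4 * L * (1 - p)) + (1 - p) * exp (- 4 * L * (0 - p)) \<le> exp ((4 * L)\<^sup>2 / 8)"
      using mgf[of "1 - p" "4 * L"] p L by (simp add: algebra_simps)
  qed (use p in auto)
  also have "\<dots> = 2 * exp (- 2 * L\<^sup>2 * t)"
    by (simp add: exp_of_nat_mult[symmetric] exp_add[symmetric] power2_eq_square algebra_simps)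
  finally show ?thesis by (simp add: p_def)
qed

lemma ex_empirical_variance:
  assumes t: "0 < t"
  shows "ex t (\<lambda>h. (empirical h k - pmf P k)\<^sup>2) \<le> pmf P k / t"
proof -
  define \<phi> where "\<phi> j = of_bool (j = k) - pmf P k" for j
  have "(\<Sum>j\<in>UNIV. pmf P j * of_bool (j = k)) = pmf P k" by (simp add: of_bool_def if_distrib cong: if_cong)
  then have c: "(\<Sum>j\<in>UNIV. pmf P j * \<phi> j) = 0"
    by (simp add: \<phi>_def right_diff_distrib sum_subtractf sum_distrib_right[symmetric] sum_P)
  have "(\<Sum>j\<in>UNIV. pmf P j * (\<phi> j)\<^sup>2) = (\<Sum>j\<in>UNIV. pmf P j * of_bool (j = k)) - (2 * pmf P k) * (\<Sum>j\<in>UNIV. pmf P j * of_bool (j = k)) + (pmf P k)\<^sup>2"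
    unfolding sum_distrib_left
    by (subst mult_1_right[of "(pmf P k)\<^sup>2", symmetric], subst sum_P[symmetric], unfold sum_distrib_left sum_subtractf[symmetric] sum.distrib[symmetric])
       (intro sum.cong, auto simp: \<phi>_def power2_eq_square algebra_simps)
  then have v: "(\<Sum>j\<in>UNIV. pmf P j * (\<phi> j)\<^sup>2) \<le> pmf P k"
    using \<open>(\<Sum>j\<in>UNIV. pmf P j * of_bool (j = k)) = pmf P k\<close> by (simp add: power2_eq_square)
  have "ex t (\<lambda>h. (empirical h k - pmf P k)\<^sup>2) = ex t (\<lambda>h. (1 / t\<^sup>2) * (\<Sum>(j, x)\<leftarrow>h. \<phi> j)\<^sup>2)"
  proof (rule ex_cong)
    fix h assume h: "h \<in> set_pmf (run P \<pi> t)"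
    then have "h \<noteq> []" "length h = t" using length_run[OF h] t by auto
    then show "(empirical h k - pmf P k)\<^sup>2 = (1 / t\<^sup>2) * (\<Sum>(j, x)\<leftarrow>h. \<phi> j)\<^sup>2"
      using t by (simp add: \<phi>_def sum_list_empirical power_mult_distrib)
  qed
  also have "\<dots> = (1 / t\<^sup>2) * (t * (\<Sum>j\<in>UNIV. pmf P j * (\<phi> j)\<^sup>2))"
    unfolding ex_cmult ex_sum_types_squared[OF c] ..
  also have "\<dots> \<le> (1 / t\<^sup>2) * (t * pmf P k)"
    using v by (intro mult_left_mono) auto
  also have "\<dots> = pmf P k / t" using t by (simp add: power2_eq_square)
  finally show ?thesis .
qed

end

section \<open>The regret in terms of per-period losses\<close>

lemma remaining_snoc:
  "remaining T c b (h @ [(j, x)]) = remaining T c b h - of_bool x *\<^sub>R c j"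
  by (simp add: remaining_def)

lemma remaining_take_antimono:
  assumes c: "\<And>j. 0 \<le> c j $ i" and "s \<le> t"
  shows "remaining T c b (take t h) $ i \<le> remaining T c b (take s h) $ i"
  using assms(2)
proof (induction t rule: dec_induct)
  case (step t)
  have "remaining T c b (take (Suc t) h) $ i \<le> remaining T c b (take t h) $ i"
  proof (cases "t < length h")
    case True
    then show ?thesis
      using c by (cases "h ! t") (simp add: take_Suc_conv_app_nth remaining_snoc)
  qed simp
  with step show ?case by linarith
qed simp

lemma empirical_nonneg: "0 \<le> empirical h j"
  by (simp add: empirical_def)

lemma sum_empirical:
  fixes h :: "'n::finite history"
  assumes "h \<noteq> []"
  shows "(\<Sum>j\<in>UNIV. empirical h j) = 1"
proof -
  have "(\<Sum>j\<in>UNIV. count_list xs j) = length xs" for xs :: "'n list"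
    by (rule sum_count_set) auto
  from this[of "map fst h"] have "(\<Sum>j\<in>UNIV. real (count_list (map fst h) j)) = real (length h)"
    by (metis length_map of_nat_sum)
  then show ?thesis using assms by (simp add: empirical_def sum_divide_distrib[symmetric])
qed

context stable_orders
begin

abbreviation g :: "'n \<Rightarrow> real" where "g \<equiv> excess \<mu> c lam"

definition full_use :: "('n \<Rightarrow> real) \<Rightarrow> 'm \<Rightarrow> real" where
  "full_use w i = (\<Sum>j | 0 < g j. w j * c j $ i)"

lemma full_use_altdef: "full_use w i = (\<Sum>j\<in>UNIV. of_bool (0 < g j) * (w j * c j $ i))"
  unfolding full_use_def by (rule sum.mono_neutral_cong_left) auto

text \<open>By \<open>lam_pos\<close> this is the 1-norm of the dual solution.\<close>

definition \<Lambda> :: real where "\<Lambda> = (\<Sum>i\<in>UNIV. lam $ i)"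

definition \<Gamma> :: real where "\<Gamma> = (\<Sum>j\<in>UNIV. pmf P j * max 0 (g j))"

lemmas bounds = order_model_bounds[OF model]

lemma lam_pos: "0 < lam $ i"
  using lam_ge[of i] L_pos by linarith

lemma b_pos: "0 < b $ i"
  using b_ge[of i] L_pos by linarith

lemma L_le_half: "L \<le> 1 / 2"
  using b_ge[of undefined] b_le[of undefined] by linarith

lemma card_L_le_\<Lambda>: "real CARD('m) * L \<le> \<Lambda>"
  unfolding \<Lambda>_def using sum_mono[of UNIV "\<lambda>_. L" "\<lambda>i. lam $ i"] lam_ge by simp

lemma L_le_\<Lambda>: "L \<le> \<Lambda>"
proof -
  have "1 * L \<le> real CARD('m) * L" using L_pos by (intro mult_right_mono) (simp_all add: Suc_le_eq)
  then show ?thesis using card_L_le_\<Lambda> by simp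
qed

lemma \<Lambda>_pos: "0 < \<Lambda>"
  using L_le_\<Lambda> L_pos by linarith

lemma price_bounds: "0 \<le> c j \<bullet> lam" "c j \<bullet> lam \<le> \<Lambda>"
proof -
  show "0 \<le> c j \<bullet> lam"
    unfolding inner_vec_def using bounds(3) lam_pos by (auto intro!: sum_nonneg mult_nonneg_nonneg simp: less_imp_le)
  show "c j \<bullet> lam \<le> \<Lambda>"
    unfolding inner_vec_def \<Lambda>_def using bounds(3,4) lam_pos
    by (auto intro!: sum_mono mult_left_le_one_le simp: less_imp_le)
qed

lemma excess_bounds: "max 0 (g j) \<le> 1" "max 0 (- g j) \<le> c j \<bullet> lam" "max 0 (- g j) \<le> \<Lambda>" "g j \<le> \<mu> j"
  using price_bounds[of j] bounds(1,2)[of j] by (auto simp: excess_def)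

lemma sum_P1: "(\<Sum>j\<in>UNIV. pmf P j) = 1"
  by (simp add: sum_pmf_eq_1)

lemma \<Gamma>_bounds: "0 \<le> \<Gamma>" "\<Gamma> \<le> 1"
proof -
  show "0 \<le> \<Gamma>" unfolding \<Gamma>_def by (intro sum_nonneg) auto
  have "\<Gamma> \<le> (\<Sum>j\<in>UNIV. pmf P j)"
    unfolding \<Gamma>_def using excess_bounds(1) by (intro sum_mono mult_left_le) auto
  then show "\<Gamma> \<le> 1" by (simp add: sum_P1)
qed

lemma full_use_nonneg: "(\<And>j. 0 \<le> w j) \<Longrightarrow> 0 \<le> full_use w i"
  unfolding full_use_def using bounds(3) by (intro sum_nonneg) auto

definition loss :: "real^'n \<Rightarrow> real" where
  "loss y = (\<Sum>j\<in>UNIV. pmf P j * (max 0 (g j) * (1 - y $ j) + max 0 (- g j) * y $ j))"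

lemma loss_stable:
  assumes "\<And>j. \<bar>w j - pmf P j\<bar> < L" "\<And>i. \<bar>b' $ i - b $ i\<bar> \<le> L" "alloc_optimal w \<mu> c b' y"
  shows "loss y = 0" "(\<Sum>j\<in>UNIV. w j * y $ j * c j $ i) = b' $ i"
proof -
  have s: "(\<Sum>j\<in>UNIV. (w j * y $ j) *\<^sub>R c j) = b'"
    "\<And>j. 0 < g j \<Longrightarrow> y $ j = 1" "\<And>j. g j < 0 \<Longrightarrow> y $ j = 0"
    using stable[OF assms] by auto
  show "(\<Sum>j\<in>UNIV. w j * y $ j * c j $ i) = b' $ i"
    using arg_cong[OF s(1), of "\<lambda>v. v $ i"] by simp
  have "max 0 (g j) * (1 - y $ j) + max 0 (- g j) * y $ j = 0" for j
    using s(2,3)[of j] by (cases "g j" "0 :: real" rule: linorder_cases) auto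
  then show "loss y = 0" by (simp add: loss_def)
qed

lemma loss_le:
  assumes "\<And>j. 0 \<le> y $ j" "\<And>j. y $ j \<le> 1"
  shows "loss y \<le> \<Lambda> + \<Gamma>"
proof -
  have "loss y \<le> (\<Sum>j\<in>UNIV. pmf P j * (max 0 (g j) + \<Lambda>))"
    unfolding loss_def
  proof (intro sum_mono mult_left_mono add_mono)
    fix j
    show "max 0 (g j) * (1 - y $ j) \<le> max 0 (g j)" using assms[of j] by (intro mult_left_le) auto
    show "max 0 (- g j) * y $ j \<le> \<Lambda>"
      using assms[of j] excess_bounds(3)[of j] mult_left_le[of "y $ j" "max 0 (- g j)"] by linarith
  qed auto
  then show ?thesis by (simp add: distrib_left sum.distrib sum_distrib_right[symmetric] sum_P1 \<Gamma>_def)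
qed

abbreviation profitable :: real where
  "profitable \<equiv> of_bool (\<exists>j. 0 < g j)"

text \<open>
  The optimal solution is compared with accepting a fraction \<open>1 - (\<Sum>i. u i)\<close> of every type of
  positive excess and nothing else.  Only the shortages \<open>u i\<close>, and not the events causing them,
  enter the bound without a factor \<open>\<Lambda>\<close>.
\<close>

lemma loss_shortage:
  assumes w: "\<And>j. 0 \<le> w j" "(\<Sum>j\<in>UNIV. w j) = 1"
    and opt: "alloc_optimal w \<mu> c b' y" and b': "\<And>i. 0 \<le> b' $ i"
    and u: "\<And>i. 0 \<le> u i" "\<And>i. (1 - u i) * full_use w i \<le> b' $ i"
  shows "loss y \<le> 2 * \<Lambda> + profitable * (\<Sum>i\<in>UNIV. u i) + (\<Sum>j\<in>UNIV. \<bar>pmf P j - w j\<bar>)"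
proof -
  have y: "0 \<le> y $ j" "y $ j \<le> 1" for j
    using opt by (auto simp: alloc_optimal_def alloc_feasible_def less_eq_vec_def)
  define G where "G = (\<Sum>j\<in>UNIV. w j * max 0 (g j))"
  have G: "0 \<le> G" "G \<le> 1"
  proof -
    show "0 \<le> G" unfolding G_def using w by (intro sum_nonneg) auto
    have "G \<le> (\<Sum>j\<in>UNIV. w j)" unfolding G_def using w excess_bounds(1) by (intro sum_mono mult_left_le) auto
    then show "G \<le> 1" using w by simp
  qed
  \<comment> \<open>Scaling down by the total of the shortages respects every resource at once; the
    total may exceed 1, whence the maximum with 0.\<close>
  define \<theta> where "\<theta> = max 0 (1 - (\<Sum>i\<in>UNIV. u i))"
  have su: "u i \<le> (\<Sum>i\<in>UNIV. u i)" "0 \<le> (\<Sum>i\<in>UNIV. u i)" for i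
    using u by (auto intro!: member_le_sum sum_nonneg)
  have \<theta>: "0 \<le> \<theta>" "\<theta> \<le> 1" "1 - \<theta> \<le> (\<Sum>i\<in>UNIV. u i)" using su by (auto simp: \<theta>_def)
  have \<theta>D: "\<theta> * full_use w i \<le> b' $ i" for i
  proof (cases "\<theta> = 0")
    case False
    then have "\<theta> \<le> 1 - u i" using su(1)[of i] by (auto simp: \<theta>_def)
    then have "\<theta> * full_use w i \<le> (1 - u i) * full_use w i"
      using full_use_nonneg[of w i] w by (intro mult_right_mono) auto
    then show ?thesis using u(2)[of i] by linarith
  qed (use b' in simp)
  define v :: "real^'n" where "v = (\<chi> j. \<theta> * of_bool (0 < g j))"
  have "(\<Sum>j\<in>UNIV. w j * v $ j * c j $ i) = \<theta> * full_use w i" for i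
    unfolding full_use_altdef v_def sum_distrib_left by (intro sum.cong) auto
  then have "alloc_feasible w c b' v"
    using \<theta>D \<theta> by (auto simp: alloc_feasible_def less_eq_vec_def v_def)
  then have "alloc_value w \<mu> v \<le> alloc_value w \<mu> y" using opt by (simp add: alloc_optimal_def)
  moreover have "\<theta> * G \<le> alloc_value w \<mu> v"
    unfolding G_def alloc_value_def sum_distrib_left
  proof (rule sum_mono)
    fix j
    have "\<theta> * (w j * g j) \<le> \<theta> * (w j * \<mu> j)"
      using \<theta> w excess_bounds(4)[of j] by (intro mult_left_mono) auto
    then show "\<theta> * (w j * max 0 (g j)) \<le> w j * \<mu> j * v $ j" by (auto simp: v_def algebra_simps)
  qed
  \<comment> \<open>Whatever \<open>y\<close> consumes costs at most \<open>\<Lambda>\<close>. This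
    is the first \<open>\<Lambda>\<close> of the claim; the second pays for accepted unprofitable
    types.\<close>
  moreover have "alloc_value w \<mu> y \<le> \<Lambda> + (\<Sum>j\<in>UNIV. w j * (max 0 (g j) * y $ j))"
  proof -
    have "alloc_value w \<mu> y \<le> (\<Sum>j\<in>UNIV. w j * \<Lambda> + w j * (max 0 (g j) * y $ j))"
      unfolding alloc_value_def
    proof (rule sum_mono)
      fix j
      have "\<mu> j * y $ j = c j \<bullet> lam * y $ j + g j * y $ j" by (simp add: excess_def algebra_simps)
      also have "\<dots> \<le> \<Lambda> + max 0 (g j) * y $ j"
        using price_bounds[of j] y[of j] mult_left_le[of "y $ j" "c j \<bullet> lam"]
        by (intro add_mono mult_right_mono) auto
      finally have "w j * (\<mu> j * y $ j) \<le> w j * (\<Lambda> + max 0 (g j) * y $ j)"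
        using w(1) by (rule mult_left_mono)
      then show "w j * \<mu> j * y $ j \<le> w j * \<Lambda> + w j * (max 0 (g j) * y $ j)" by (simp add: algebra_simps)
    qed
    then show ?thesis using w by (simp add: sum.distrib sum_distrib_right[symmetric])
  qed
  ultimately have 1: "(\<Sum>j\<in>UNIV. w j * (max 0 (g j) * (1 - y $ j))) \<le> (1 - \<theta>) * G + \<Lambda>"
    by (simp add: G_def right_diff_distrib sum_subtractf left_diff_distrib)
  have 2: "(1 - \<theta>) * G \<le> profitable * (\<Sum>i\<in>UNIV. u i)"
  proof (cases "\<exists>j. 0 < g j")
    case True
    have "(1 - \<theta>) * G \<le> (1 - \<theta>) * 1" using G \<theta> by (intro mult_left_mono) auto
    then show ?thesis using True \<theta> by simp
  next
    case False
    then have "max 0 (g j) = 0" for j by (simp add: not_less max_absorb1)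
    then have "G = 0" by (simp add: G_def)
    then show ?thesis using False by simp
  qed
  have "loss y \<le> (\<Sum>j\<in>UNIV. w j * (max 0 (g j) * (1 - y $ j)) + \<bar>pmf P j - w j\<bar> + pmf P j * \<Lambda>)"
    unfolding loss_def
  proof (rule sum_mono)
    fix j
    define q where "q = max 0 (g j) * (1 - y $ j)"
    have q: "0 \<le> q" "q \<le> 1"
      using y[of j] excess_bounds(1)[of j] mult_left_le[of "1 - y $ j" "max 0 (g j)"] by (auto simp: q_def)
    have "(pmf P j - w j) * q \<le> \<bar>pmf P j - w j\<bar> * q" using q by (intro mult_right_mono) auto
    also have "\<dots> \<le> \<bar>pmf P j - w j\<bar>" using q by (intro mult_left_le) auto
    finally have "pmf P j * q \<le> w j * q + \<bar>pmf P j - w j\<bar>" by (simp add: algebra_simps)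
    moreover have "max 0 (- g j) * y $ j \<le> \<Lambda>"
      using y[of j] excess_bounds(3)[of j] mult_left_le[of "y $ j" "max 0 (- g j)"] by linarith
    then have "pmf P j * (max 0 (- g j) * y $ j) \<le> pmf P j * \<Lambda>" by (intro mult_left_mono) auto
    ultimately show "pmf P j * (max 0 (g j) * (1 - y $ j) + max 0 (- g j) * y $ j) \<le>
        w j * (max 0 (g j) * (1 - y $ j)) + \<bar>pmf P j - w j\<bar> + pmf P j * \<Lambda>"
      by (simp add: q_def distrib_left)
  qed
  also have "\<dots> = (\<Sum>j\<in>UNIV. w j * (max 0 (g j) * (1 - y $ j))) + (\<Sum>j\<in>UNIV. \<bar>pmf P j - w j\<bar>) + \<Lambda>"
    by (simp add: sum.distrib sum_distrib_right[symmetric] sum_P1)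
  finally show ?thesis using 1 2 by linarith
qed

end

locale allocation_run =
  stable_orders \<mu> c P b lam L + order_process P "adaptive_allocation c b Y T"
  for \<mu> :: "'n::finite \<Rightarrow> real" and c :: "'n \<Rightarrow> real^'m::finite" and P b lam L Y T +
  assumes selection: "optimal_selection \<mu> c b Y"
begin

section \<open>Decisions, prices and stopping along a run\<close>

abbreviation rem :: "'n history \<Rightarrow> real^'m" where "rem \<equiv> remaining T c b"
abbreviation avg :: "'n history \<Rightarrow> real^'m" where "avg \<equiv> average_remaining T c b"
abbreviation law :: "nat \<Rightarrow> 'n history pmf" where "law \<equiv> run P (adaptive_allocation c b Y T)"
abbreviation policy :: "'n policy" where "policy \<equiv> adaptive_allocation c b Y T"

definition alive :: "'n history \<Rightarrow> bool" where
  "alive h \<longleftrightarrow> (\<forall>i. 1 < rem h $ i)"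

definition dec :: "'n history \<Rightarrow> real^'n" where
  "dec h = (if h = [] then 1 else Y T h)"

lemma alive_take: "alive h \<Longrightarrow> alive (take s h)"
proof -
  have "rem h $ i \<le> rem (take s h) $ i" for i
    using remaining_take_antimono[of c i s "max s (length h)" T b h] bounds(3) by simp
  then show "alive h \<Longrightarrow> alive (take s h)" unfolding alive_def by (meson less_le_trans)
qed

lemma optimal_dec:
  assumes "alive h" "h \<noteq> []" "length h < T"
  shows "alloc_optimal (empirical h) \<mu> c (avg h) (dec h)"
proof -
  have "0 \<le> rem h" using assms(1) by (auto simp: alive_def less_eq_vec_def intro: less_imp_le order_trans[OF zero_le_one])
  then show ?thesis
    using selection assms by (auto simp: optimal_selection_def dec_def Suc_le_eq)
qed

lemma dec_bounds:
  assumes "alive h" "length h < T"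
  shows "0 \<le> dec h $ j" "dec h $ j \<le> 1"
proof -
  have "0 \<le> dec h $ j \<and> dec h $ j \<le> 1"
  proof (cases "h = []")
    case False
    then show ?thesis using optimal_dec[OF assms(1) False assms(2)]
      by (auto simp: alloc_optimal_def alloc_feasible_def less_eq_vec_def)
  qed (simp add: dec_def)
  then show "0 \<le> dec h $ j" "dec h $ j \<le> 1" by auto
qed

text \<open>More than one unit of every resource remains and no order takes more than one, so the
  capacity check always passes here.\<close>

lemma accept_prob:
  assumes "alive h" "length h < T"
  shows "pmf (policy h j) True = dec h $ j"
    and "pmf (policy h j) False = 1 - dec h $ j"
proof -
  have "c j \<le> rem h"
    using assms(1) bounds(4)[of j] unfolding alive_def less_eq_vec_def by (meson less_imp_le order_trans)
  then have "policy h j = (if h = [] then return_pmf True else bernoulli_pmf (dec h $ j))"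
    by (simp add: adaptive_allocation_def dec_def)
  then show "pmf (policy h j) True = dec h $ j"
    "pmf (policy h j) False = 1 - dec h $ j"
    using dec_bounds[OF assms, of j] by (auto simp: dec_def)
qed

lemma next_mean_alive:
  assumes "alive h" "length h < T"
  shows "next_mean h F = (\<Sum>j\<in>UNIV. pmf P j * (dec h $ j * F (h @ [(j, True)]) + (1 - dec h $ j) * F (h @ [(j, False)])))"
  unfolding next_mean_def by (simp add: UNIV_bool accept_prob[OF assms] add.commute)

text \<open>Formed with the acceptance probability of the policy rather than with
  \<open>dec\<close>, so that the telescoping in \<open>ex_price\<close> also covers the periods
  after depletion.\<close>

definition priced_use :: "'n history \<Rightarrow> real" where
  "priced_use h = (\<Sum>j\<in>UNIV. pmf P j * (pmf (policy h j) True * (c j \<bullet> lam)))"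

lemma priced_use_bounds: "0 \<le> priced_use h" "priced_use h \<le> \<Lambda>"
proof -
  show "0 \<le> priced_use h"
    unfolding priced_use_def using price_bounds by (intro sum_nonneg mult_nonneg_nonneg) auto
  have "priced_use h \<le> (\<Sum>j\<in>UNIV. pmf P j * \<Lambda>)"
    unfolding priced_use_def
    using price_bounds \<Lambda>_pos pmf_le_1
    by (intro sum_mono mult_left_mono order_trans[OF mult_left_le_one_le]) auto
  then show "priced_use h \<le> \<Lambda>" by (simp add: sum_distrib_right[symmetric] sum_P1)
qed

lemma next_mean_price: "next_mean h (\<lambda>h. rem h \<bullet> lam) = rem h \<bullet> lam - priced_use h"
proof -
  have "next_mean h (\<lambda>h. rem h \<bullet> lam) = (\<Sum>j\<in>UNIV. pmf P j * (rem h \<bullet> lam - pmf (policy h j) True * (c j \<bullet> lam)))"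
    unfolding next_mean_def
  proof (intro sum.cong refl arg_cong2[where f = "(*)"])
    fix j
    have F: "pmf (policy h j) False = 1 - pmf (policy h j) True"
      using sum_pmf_bool[of "policy h j"] by (simp add: UNIV_bool)
    show "(\<Sum>x\<in>UNIV. pmf (policy h j) x * (rem (h @ [(j, x)]) \<bullet> lam)) =
      rem h \<bullet> lam - pmf (policy h j) True * (c j \<bullet> lam)"
      by (simp add: UNIV_bool remaining_snoc inner_diff_left F) (simp add: algebra_simps)
  qed
  then show ?thesis
    by (simp add: right_diff_distrib sum_subtractf sum_distrib_right[symmetric] sum_P1 priced_use_def)
qed

lemma ex_price: "(\<Sum>t<N. ex t priced_use) = T * (b \<bullet> lam) - ex N (\<lambda>h. rem h \<bullet> lam)"
proof (induction N)
  case (Suc N)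
  have "ex (Suc N) (\<lambda>h. rem h \<bullet> lam) = ex N (\<lambda>h. rem h \<bullet> lam) - ex N priced_use"
    by (simp add: ex_Suc next_mean_price ex_diff)
  then show ?case using Suc by simp
qed (simp add: ex_0 remaining_def)

text \<open>A history of length \<open>t\<close> is the state at the start of period
  \<open>t + 1\<close>. Remaining capacity never grows, so that state is alive exactly if no period
  up to \<open>t + 1\<close> is depleted.\<close>

lemma stopping_time_iff:
  assumes "t < T"
  shows "t < stopping_time T c b h \<longleftrightarrow> alive (take t h)"
proof -
  let ?D = "{r\<in>{1..T + 1}. depleted T c b h r}"
  have dep: "depleted T c b h r \<longleftrightarrow> \<not> alive (take (r - 1) h)" for r
    by (auto simp: depleted_def alive_def not_less)
  have mono: "alive (take r h)" if "alive (take s h)" "r \<le> s" for r s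
    using alive_take[OF that(1), of r] that(2) by (simp add: min_def)
  show ?thesis
  proof (cases "?D = {}")
    case True
    then have "\<not> depleted T c b h (Suc t)" using assms by auto
    then show ?thesis using True assms by (auto simp: stopping_time_def dep)
  next
    case False
    define M where "M = Min ?D"
    have fin: "finite ?D" by simp
    have M: "M \<in> ?D" "\<And>r. r \<in> ?D \<Longrightarrow> M \<le> r"
      unfolding M_def using Min_in[OF fin False] Min_le[OF fin] by blast+
    have st: "stopping_time T c b h = M - 1" using False by (auto simp: stopping_time_def M_def)
    show ?thesis
    proof
      assume "t < stopping_time T c b h"
      then have "Suc t \<notin> ?D" using M(2)[of "Suc t"] st by auto
      then show "alive (take t h)" using assms by (auto simp: dep)
    next
      assume a: "alive (take t h)"
      have "\<not> alive (take (M - 1) h)" using M(1) dep by auto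
      then have "t < M - 1" using mono[OF a] by (meson not_le)
      then show "t < stopping_time T c b h" using st by simp
    qed
  qed
qed

lemma collected_eq:
  assumes "length h = T"
  shows "collected T \<mu> c b h = (\<Sum>t<T. of_bool (alive (take t h)) * (\<mu> (fst (h ! t)) * of_bool (snd (h ! t))))"
proof -
  have le: "stopping_time T c b h \<le> T"
  proof (cases "\<exists>t\<in>{1..T+1}. depleted T c b h t")
    case True
    then have "Min {t\<in>{1..T+1}. depleted T c b h t} \<in> {t\<in>{1..T+1}. depleted T c b h t}"
      by (intro Min_in) auto
    then show ?thesis using True by (auto simp: stopping_time_def)
  next
    case False
    then show ?thesis by (simp add: stopping_time_def)
  qed
  have "collected T \<mu> c b h = (\<Sum>t<stopping_time T c b h. \<mu> (fst (h ! t)) * of_bool (snd (h ! t)))"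
    unfolding collected_def by (rule sum.reindex_bij_witness[of _ Suc "\<lambda>t. t - 1"]) auto
  also have "\<dots> = (\<Sum>t\<in>{..<T} \<inter> {t. alive (take t h)}. \<mu> (fst (h ! t)) * of_bool (snd (h ! t)))"
  proof -
    have "t < stopping_time T c b h \<longleftrightarrow> t < T \<and> alive (take t h)" for t
      using stopping_time_iff[of t h] le by (cases "t < T") auto
    then show ?thesis by (intro sum.cong) auto
  qed
  also have "\<dots> = (\<Sum>t<T. of_bool (alive (take t h)) * (\<mu> (fst (h ! t)) * of_bool (snd (h ! t))))"
    by (subst sum.inter_restrict, simp, rule sum.cong[OF refl], simp)
  finally show ?thesis .
qed

abbreviation mean_reward :: "'n history \<Rightarrow> real" where
  "mean_reward h \<equiv> of_bool (alive h) * (priced_use h + \<Gamma> - loss (dec h))"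

text \<open>A reward is the price of the consumption plus the excess, and the mean excess is
  \<open>\<Gamma>\<close>, the mean under accepting exactly the positive excesses, minus the loss.
  Whether period \<open>t + 1\<close> counts depends on the first \<open>t\<close> entries only, so
  its decision can be averaged given them.\<close>

lemma ex_collected:
  "ex T (collected T \<mu> c b) = (\<Sum>t<T. ex t mean_reward)"
proof -
  have "ex T (collected T \<mu> c b) = (\<Sum>t<T. ex T (\<lambda>h. of_bool (alive (take t h)) * (\<mu> (fst (h ! t)) * of_bool (snd (h ! t)))))"
    unfolding ex_sum[symmetric] by (intro ex_cong collected_eq length_run)
  also have "\<dots> = (\<Sum>t<T. ex t mean_reward)"
  proof (rule sum.cong[OF refl])
    fix t assume "t \<in> {..<T}"
    then have t: "t < T" by simp
    define F where "F h = of_bool (alive (butlast h)) * (\<mu> (fst (last h)) * of_bool (snd (last h)))" for h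
    have "ex T (\<lambda>h. of_bool (alive (take t h)) * (\<mu> (fst (h ! t)) * of_bool (snd (h ! t)))) = ex T (\<lambda>h. F (take (Suc t) h))"
      using t by (intro ex_cong) (simp add: F_def length_run take_Suc_conv_app_nth)
    also have "\<dots> = ex (Suc t) F" using t by (intro ex_take) auto
    also have "\<dots> = ex t (\<lambda>h. next_mean h F)" by (rule ex_Suc)
    also have "\<dots> = ex t mean_reward"
    proof (rule ex_cong)
      fix h assume h: "h \<in> set_pmf (law t)"
      show "next_mean h F = mean_reward h"
      proof (cases "alive h")
        case True
        have len: "length h < T" using t length_run[OF h] by simp
        have "next_mean h F = (\<Sum>j\<in>UNIV. pmf P j * (dec h $ j * \<mu> j))"
          unfolding next_mean_alive[OF True len] using True by (simp add: F_def)
        also have "\<dots> = priced_use h + \<Gamma> - loss (dec h)"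
          unfolding priced_use_def \<Gamma>_def loss_def sum.distrib[symmetric] sum_subtractf[symmetric]
        proof (rule sum.cong[OF refl])
          fix j
          have "\<mu> j = c j \<bullet> lam + max 0 (g j) - max 0 (- g j)" by (auto simp: excess_def)
          then have "dec h $ j * \<mu> j = dec h $ j * (c j \<bullet> lam + max 0 (g j) - max 0 (- g j))" by simp
          then show "pmf P j * (dec h $ j * \<mu> j) = pmf P j * (pmf (policy h j) True * (c j \<bullet> lam)) + pmf P j * max 0 (g j) -
            pmf P j * (max 0 (g j) * (1 - dec h $ j) + max 0 (- g j) * dec h $ j)"
            unfolding accept_prob[OF True len] by (simp only:) (simp add: algebra_simps)
        qed
        finally show ?thesis using True by simp
      next
        case False
        then have "next_mean h F = 0" by (intro next_mean_const) (simp add: F_def)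
        then show ?thesis using False by simp
      qed
    qed
    finally show "ex T (\<lambda>h. of_bool (alive (take t h)) * (\<mu> (fst (h ! t)) * of_bool (snd (h ! t)))) =
      ex t mean_reward" .
  qed
  finally show ?thesis .
qed

abbreviation mean_loss :: "nat \<Rightarrow> real" where
  "mean_loss t \<equiv> ex t (\<lambda>h. of_bool (alive h) * loss (dec h))"

text \<open>Summed over all periods, the priced consumption is the price of the initial minus that
  of the final capacity. Live periods then cost their loss, and dead ones at most
  \<open>\<Lambda> + \<Gamma>\<close>.\<close>

lemma regret_le:
  "Regret \<mu> c P b (policy) T \<le> ex T (\<lambda>h. rem h \<bullet> lam) +
    (\<Sum>t<T. (\<Lambda> + \<Gamma>) * pr t (\<lambda>h. \<not> alive h)) + (\<Sum>t<T. mean_loss t)"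
proof -
  have "Regret \<mu> c P b (policy) T = T * OPT_D \<mu> c P b - ex T (collected T \<mu> c b)"
    unfolding Regret_def ex_def[symmetric] by (simp add: ex_diff ex_const)
  also have "\<dots> = T * (b \<bullet> lam) + (\<Sum>t<T. \<Gamma>) - (\<Sum>t<T. ex t mean_reward)"
    by (simp add: OPT_D_eq \<Gamma>_def ex_collected algebra_simps)
  also have "\<dots> = ex T (\<lambda>h. rem h \<bullet> lam) + (\<Sum>t<T. ex t priced_use + \<Gamma> - ex t mean_reward)"
    using ex_price[of T] by (simp add: sum.distrib sum_subtractf)
  finally have eq: "Regret \<mu> c P b (policy) T = ex T (\<lambda>h. rem h \<bullet> lam) + (\<Sum>t<T. ex t priced_use + \<Gamma> - ex t mean_reward)" .
  have "(\<Sum>t<T. ex t priced_use + \<Gamma> - ex t mean_reward) \<le>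
    (\<Sum>t<T. (\<Lambda> + \<Gamma>) * pr t (\<lambda>h. \<not> alive h) + mean_loss t)"
  proof (rule sum_mono)
    fix t
    have "ex t priced_use + \<Gamma> - ex t mean_reward
      = ex t (\<lambda>h. priced_use h + \<Gamma> - mean_reward h)"
      by (simp add: ex_diff ex_add ex_const)
    also have "\<dots> \<le> ex t (\<lambda>h. (\<Lambda> + \<Gamma>) * of_bool (\<not> alive h) + of_bool (alive h) * loss (dec h))"
      by (intro ex_mono) (use priced_use_bounds(2) in auto)
    finally show "ex t priced_use + \<Gamma> - ex t mean_reward \<le>
      (\<Lambda> + \<Gamma>) * pr t (\<lambda>h. \<not> alive h) + mean_loss t"
      by (simp add: ex_add ex_cmult)
  qed
  then show ?thesis unfolding eq by (simp add: sum.distrib)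
qed

end

section \<open>The early periods\<close>

lemma remaining_bounds:
  assumes c: "\<And>j. 0 \<le> c j $ i" "\<And>j. c j $ i \<le> 1"
  shows "real T * b $ i - length h \<le> remaining T c b h $ i" "remaining T c b h $ i \<le> real T * b $ i"
proof -
  have "real T * b $ i - length h \<le> remaining T c b h $ i \<and> remaining T c b h $ i \<le> real T * b $ i"
  proof (induction h rule: rev_induct)
    case (snoc x h)
    obtain j a where x: "x = (j, a)" by (cases x)
    have "0 \<le> of_bool a * c j $ i" "of_bool a * c j $ i \<le> 1" using c[of j] by auto
    then show ?case using snoc unfolding x by (simp add: remaining_snoc)
  qed (simp add: remaining_def)
  then show "real T * b $ i - length h \<le> remaining T c b h $ i" "remaining T c b h $ i \<le> real T * b $ i" by auto
qed

lemma sum_of_bool_less_le: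
  fixes a x :: real
  assumes "0 < a" "0 \<le> x"
  shows "(\<Sum>t = 1..N. of_bool (a * real t < x)) \<le> x / a"
proof -
  have "(\<Sum>t = 1..N. of_bool (a * real t < x) :: real) = card {t \<in> {1..N}. a * real t < x}"
    by (simp add: of_bool_def sum.If_cases Int_def)
  also have "\<dots> \<le> card {1..nat \<lfloor>x / a\<rfloor>}"
  proof (intro of_nat_mono card_mono subsetI)
    fix t assume t: "t \<in> {t \<in> {1..N}. a * real t < x}"
    then have "real t \<le> x / a" using assms by (simp add: field_simps)
    then have "t \<le> nat \<lfloor>x / a\<rfloor>" by (simp add: le_nat_floor)
    then show "t \<in> {1..nat \<lfloor>x / a\<rfloor>}" using t by simp
  qed simp
  also have "\<dots> \<le> x / a" using assms by simp
  finally show ?thesis .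
qed

context stable_orders
begin

lemma loss_one: "loss 1 \<le> \<Lambda>"
proof -
  have "loss 1 \<le> (\<Sum>j\<in>UNIV. pmf P j * \<Lambda>)"
    unfolding loss_def using excess_bounds(3) by (intro sum_mono mult_left_mono) auto
  then show ?thesis by (simp add: sum_distrib_right[symmetric] sum_P1)
qed

end

context allocation_run
begin

section \<open>Atypical frequencies\<close>

definition atypical :: "real \<Rightarrow> 'n history \<Rightarrow> bool" where
  "atypical r h \<longleftrightarrow> (\<exists>k. r \<le> \<bar>empirical h k - pmf P k\<bar>)"

lemma ex_atypical_le:
  assumes "0 < r" "0 < t"
  shows "pr t (atypical r) \<le> 2 * real CARD('n) * exp (- 2 * r\<^sup>2 * t)"
proof -
  have "pr t (atypical r) \<le> ex t (\<lambda>h. \<Sum>k\<in>UNIV. of_bool (r \<le> \<bar>empirical h k - pmf P k\<bar>))"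
  proof (rule ex_mono)
    fix h
    show "of_bool (atypical r h) \<le> (\<Sum>k\<in>UNIV. of_bool (r \<le> \<bar>empirical h k - pmf P k\<bar>) :: real)"
    proof (cases "atypical r h")
      case True
      then obtain k where k: "r \<le> \<bar>empirical h k - pmf P k\<bar>" by (auto simp: atypical_def)
      have "of_bool (r \<le> \<bar>empirical h k - pmf P k\<bar>) \<le> (\<Sum>k\<in>UNIV. of_bool (r \<le> \<bar>empirical h k - pmf P k\<bar>) :: real)"
        by (intro member_le_sum) auto
      then show ?thesis using True k by simp
    qed (simp add: sum_nonneg)
  qed
  also have "\<dots> \<le> (\<Sum>k\<in>(UNIV :: 'n set). 2 * exp (- 2 * r\<^sup>2 * t))"
    unfolding ex_sum by (intro sum_mono ex_empirical_abs_ge assms)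
  finally show ?thesis by simp
qed

definition deviation :: "'n history \<Rightarrow> real" where
  "deviation h = (\<Sum>j\<in>UNIV. \<bar>pmf P j - empirical h j\<bar>)"

lemma ex_deviation_squared:
  assumes "0 < t"
  shows "ex t (\<lambda>h. (deviation h)\<^sup>2) \<le> CARD('n) / t"
proof -
  have "ex t (\<lambda>h. (deviation h)\<^sup>2) \<le> ex t (\<lambda>h. real CARD('n) * (\<Sum>j\<in>UNIV. (empirical h j - pmf P j)\<^sup>2))"
  proof (rule ex_mono)
    fix h
    have "(deviation h)\<^sup>2 \<le> (\<Sum>j\<in>UNIV. (\<bar>pmf P j - empirical h j\<bar>)\<^sup>2) * CARD('n)"
      unfolding deviation_def by (rule sum_squared_le_sum_of_squares)
    then show "(deviation h)\<^sup>2 \<le> real CARD('n) * (\<Sum>j\<in>UNIV. (empirical h j - pmf P j)\<^sup>2)"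
      by (simp add: power2_commute mult.commute)
  qed
  also have "\<dots> = real CARD('n) * (\<Sum>j\<in>UNIV. ex t (\<lambda>h. (empirical h j - pmf P j)\<^sup>2))"
    by (simp add: ex_cmult ex_sum)
  also have "\<dots> \<le> real CARD('n) * (\<Sum>j\<in>UNIV. pmf P j / t)"
    by (intro mult_left_mono sum_mono ex_empirical_variance assms) auto
  also have "\<dots> = CARD('n) / t" by (simp add: sum_divide_distrib[symmetric] sum_P1)
  finally show ?thesis .
qed

abbreviation rare_deviation :: "nat \<Rightarrow> real" where
  "rare_deviation t \<equiv> ex t (\<lambda>h. of_bool (atypical L h) * deviation h)"

text \<open>Cauchy-Schwarz alone would cost too much while \<open>t \<le> 1 / L\<^sup>2\<close>, where the event is not yet rare.\<close>

lemma sum_ex_atypical_deviation: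
  "(\<Sum>t = 1..N. rare_deviation t) \<le> (171 / 100 * CARD('n) + 1) / L"
proof -
  define n where "n = real CARD('n)"
  have n: "1 \<le> n" by (simp add: n_def Suc_le_eq)
  \<comment> \<open>Young's inequality with a free weight \<open>\<sigma>\<close>, set below so that
    its two terms balance: against the trivial bound 1 on the probability for early
    \<open>t\<close>, against the Hoeffding tail for later \<open>t\<close>.\<close>
  have amgm: "rare_deviation t \<le> \<sigma> / 2 * (n / t) + q / (2 * \<sigma>)"
    if "0 < \<sigma>" "0 < t" "pr t (atypical L) \<le> q" for \<sigma> q t
  proof -
    have "of_bool (atypical L h) * deviation h \<le> \<sigma> / 2 * (deviation h)\<^sup>2 + 1 / (2 * \<sigma>) * of_bool (atypical L h)" for h
    proof (cases "atypical L h")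
      case True
      have "0 \<le> (\<sigma> * deviation h - 1)\<^sup>2" by simp
      then have "2 * \<sigma> * deviation h \<le> \<sigma>\<^sup>2 * (deviation h)\<^sup>2 + 1"
        by (simp add: power2_eq_square algebra_simps)
      then show ?thesis using True that(1) by (simp add: field_simps power2_eq_square)
    qed (use that in simp)
    then have "rare_deviation t \<le>
      ex t (\<lambda>h. \<sigma> / 2 * (deviation h)\<^sup>2 + 1 / (2 * \<sigma>) * of_bool (atypical L h))"
      by (intro ex_mono)
    also have "\<dots> = \<sigma> / 2 * ex t (\<lambda>h. (deviation h)\<^sup>2) + 1 / (2 * \<sigma>) * pr t (atypical L)"
      unfolding ex_add ex_cmult ..
    also have "\<dots> \<le> \<sigma> / 2 * (n / t) + 1 / (2 * \<sigma>) * q"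
      using that ex_deviation_squared[of t] by (intro add_mono mult_left_mono) (auto simp: n_def)
    finally show ?thesis by simp
  qed
  have "(\<Sum>t = 1..N. rare_deviation t) \<le> (2 * sqrt n + (sqrt 2 * n) / 2) / sqrt (L\<^sup>2)"
  proof (rule sum_split_le)
    show "0 < L\<^sup>2" using L_pos by simp
    show "L\<^sup>2 \<le> 1 / 4" using power_mono[OF L_le_half, of 2] L_pos by (simp add: power_divide)
    show "0 \<le> sqrt n" "0 \<le> sqrt 2 * n" using n by auto
  next
    fix t :: nat assume t: "1 \<le> t"
    define \<sigma> where "\<sigma> = sqrt t / sqrt n"
    have \<sigma>: "0 < \<sigma>" using t n by (simp add: \<sigma>_def)
    have "rare_deviation t \<le> \<sigma> / 2 * (n / t) + 1 / (2 * \<sigma>)"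
      using t \<sigma> by (intro amgm ex_le_const) auto
    also have "\<sigma> / 2 * (n / t) = sqrt n / sqrt t / 2"
      using n t by (simp add: \<sigma>_def field_simps)
    also have "1 / (2 * \<sigma>) = sqrt n / sqrt t / 2" by (simp add: \<sigma>_def)
    finally show "rare_deviation t \<le> sqrt n / sqrt t" by simp
  next
    fix t :: nat assume t: "1 < L\<^sup>2 * real t"
    then have t1: "1 \<le> t" by (cases t) auto
    define \<sigma> where "\<sigma> = sqrt 2 * sqrt t * exp (- L\<^sup>2 * t)"
    have \<sigma>: "0 < \<sigma>" using t1 by (simp add: \<sigma>_def)
    have "rare_deviation t \<le> \<sigma> / 2 * (n / t) + (2 * n * exp (- 2 * L\<^sup>2 * t)) / (2 * \<sigma>)"
      using t1 \<sigma> ex_atypical_le[OF L_pos, of t] by (intro amgm) (auto simp: n_def)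
    also have "\<sigma> / 2 * (n / t) = n * exp (- L\<^sup>2 * t) / (sqrt 2 * sqrt t)"
    proof -
      have "\<sigma> / 2 * (n / t) = n * exp (- L\<^sup>2 * t) * (sqrt 2 / 2) * (sqrt t / t)" by (simp add: \<sigma>_def)
      also have "sqrt t / t = 1 / sqrt t" using t1 by (simp add: sqrt_divide_self_eq inverse_eq_divide)
      also have "sqrt 2 / 2 = 1 / sqrt 2" by (simp add: sqrt_divide_self_eq inverse_eq_divide)
      finally show ?thesis by simp
    qed
    also have "(2 * n * exp (- 2 * L\<^sup>2 * t)) / (2 * \<sigma>) = n * exp (- L\<^sup>2 * t) / (sqrt 2 * sqrt t)"
    proof -
      have "exp (- 2 * L\<^sup>2 * t) = exp (- L\<^sup>2 * t) * exp (- L\<^sup>2 * t)" by (simp flip: exp_add)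
      then show ?thesis by (simp add: \<sigma>_def)
    qed
    also have "n * exp (- L\<^sup>2 * t) / (sqrt 2 * sqrt t) + n * exp (- L\<^sup>2 * t) / (sqrt 2 * sqrt t)
      = (2 / sqrt 2) * n * exp (- L\<^sup>2 * t) * (1 / sqrt t)" by (simp add: field_simps)
    also have "2 / sqrt 2 = sqrt (2 :: real)" by (simp add: real_div_sqrt)
    also have "sqrt 2 * n * exp (- L\<^sup>2 * t) * (1 / sqrt t) \<le> sqrt 2 * n * exp (- L\<^sup>2 * t) * L"
    proof (intro mult_left_mono)
      have "1 \<le> sqrt (L\<^sup>2 * t)" using t by simp
      then have "1 \<le> L * sqrt t" using L_pos by (simp add: real_sqrt_mult)
      then show "1 / sqrt t \<le> L" using t1 by (simp add: divide_le_eq)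
    qed (use n in auto)
    finally show "rare_deviation t \<le> sqrt 2 * n * sqrt (L\<^sup>2) * exp (- L\<^sup>2 * t)"
      using L_pos by (simp add: mult_ac)
  qed
  also have "\<dots> \<le> (171 / 100 * n + 1) / L"
  proof -
    have "sqrt 2 \<le> (142 / 100 :: real)" by (rule real_le_lsqrt) (auto simp: power2_eq_square)
    then have "sqrt 2 * n \<le> 142 / 100 * n" using n by (intro mult_right_mono) auto
    moreover have "2 * sqrt n \<le> n + 1"
      using n sum_squares_bound[of "sqrt n" 1] by simp
    ultimately have "2 * sqrt n + (sqrt 2 * n) / 2 \<le> 171 / 100 * n + 1" by linarith
    then show ?thesis using L_pos by (simp add: divide_right_mono)
  qed
  finally show ?thesis by (simp add: n_def)
qed

text \<open>The least shortage that \<open>loss_shortage\<close> accepts at capacity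
  \<open>\<beta>\<close>. Frequencies are random here, while the capacity is bounded below by the
  constant \<open>\<beta>\<close>.\<close>

definition early_shortage :: "real \<Rightarrow> 'm \<Rightarrow> 'n history \<Rightarrow> real" where
  "early_shortage \<beta> i h = (let d = full_use (empirical h) i in if \<beta> < d then 1 - \<beta> / d else 0)"

lemma early_shortage_bounds:
  assumes "0 < \<beta>"
  shows "0 \<le> early_shortage \<beta> i h" "early_shortage \<beta> i h \<le> 1"
    "(1 - early_shortage \<beta> i h) * full_use (empirical h) i \<le> \<beta>"
    "early_shortage \<beta> i h \<le> max 0 (full_use (empirical h) i - \<beta>) / \<beta>"
proof -
  let ?d = "full_use (empirical h) i"
  show "0 \<le> early_shortage \<beta> i h" "early_shortage \<beta> i h \<le> 1" "(1 - early_shortage \<beta> i h) * ?d \<le> \<beta>"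
    using assms by (auto simp: early_shortage_def Let_def)
  have "1 - \<beta> / ?d \<le> (?d - \<beta>) / \<beta>" if "\<beta> < ?d"
  proof -
    have "(?d - \<beta>) / ?d \<le> (?d - \<beta>) / \<beta>" using that assms by (intro divide_left_mono) auto
    then show ?thesis using that assms by (simp add: diff_divide_distrib)
  qed
  then show "early_shortage \<beta> i h \<le> max 0 (?d - \<beta>) / \<beta>"
    using assms by (auto simp: early_shortage_def Let_def)
qed

lemma full_use_empirical:
  assumes "h \<noteq> []"
  shows "length h * full_use (empirical h) i = (\<Sum>(j, x)\<leftarrow>h. of_bool (0 < g j) * c j $ i)"
proof -
  have "(\<Sum>(j, x)\<leftarrow>h. f j) = (\<Sum>j\<in>UNIV. real (count_list (map fst h) j) * f j)" for f :: "'n \<Rightarrow> real" and h :: "'n history"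
  proof (induction h)
    case (Cons x h)
    have "real (count_list (map fst (x # h)) j) * f j = (if j = fst x then f j else 0) + real (count_list (map fst h) j) * f j" for j
      by (auto simp: algebra_simps)
    then have "(\<Sum>j\<in>UNIV. real (count_list (map fst (x # h)) j) * f j) = f (fst x) + (\<Sum>j\<in>UNIV. real (count_list (map fst h) j) * f j)"
      by (simp add: sum.distrib)
    then show ?case using Cons by (simp add: case_prod_unfold)
  qed simp
  from this[of "\<lambda>j. of_bool (0 < g j) * c j $ i" h] show ?thesis
    using assms by (simp add: full_use_altdef empirical_def sum_distrib_left mult_ac)
qed

text \<open>The quadratic term carries the mean consumption where Hoeffding's lemma would have a
  constant; therefore \<open>\<beta>\<close> cancels from the main term in
  \<open>sum_ex_early_shortage\<close>.\<close>

lemma ex_full_use_mgf: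
  assumes h: "0 \<le> r" "r \<le> 1"
  shows "ex t (\<lambda>h. exp (r * (\<Sum>(j, x)\<leftarrow>h. of_bool (0 < g j) * c j $ i))) \<le> exp (t * full_use (pmf P) i * (r + r\<^sup>2))"
proof -
  define \<phi> where "\<phi> j = of_bool (0 < g j) * c j $ i" for j
  have \<phi>: "0 \<le> \<phi> j" "\<phi> j \<le> 1" for j using bounds(3,4) by (auto simp: \<phi>_def)
  have D0: "0 \<le> full_use (pmf P) i" by (rule full_use_nonneg) simp
  have "exp (r * \<phi> j) \<le> 1 + \<phi> j * (exp r - 1)" for j
    using powr_le_affine[of "exp r" "\<phi> j"] \<phi> by (simp add: powr_def mult.commute)
  then have "(\<Sum>j\<in>UNIV. pmf P j * exp (r * \<phi> j)) \<le> (\<Sum>j\<in>UNIV. pmf P j * (1 + \<phi> j * (exp r - 1)))"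
    by (intro sum_mono mult_left_mono) auto
  also have "\<dots> = 1 + full_use (pmf P) i * (exp r - 1)"
  proof -
    have eq: "pmf P j * (1 + \<phi> j * (exp r - 1)) = pmf P j + of_bool (0 < g j) * (pmf P j * c j $ i) * (exp r - 1)" for j
      by (simp add: \<phi>_def algebra_simps)
    show ?thesis
      unfolding eq sum.distrib sum_distrib_right[symmetric] full_use_altdef[symmetric] sum_P1 ..
  qed
  also have "\<dots> \<le> 1 + full_use (pmf P) i * (r + r\<^sup>2)"
    using exp_bound[OF h] D0 by (intro add_left_mono mult_left_mono) auto
  also have "\<dots> \<le> exp (full_use (pmf P) i * (r + r\<^sup>2))" by (rule exp_ge_add_one_self)
  finally have "(\<Sum>j\<in>UNIV. pmf P j * exp (r * \<phi> j)) ^ t \<le> exp (full_use (pmf P) i * (r + r\<^sup>2)) ^ t"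
    by (intro power_mono sum_nonneg) auto
  then show ?thesis
    unfolding exp_sum_list ex_prod_types \<phi>_def by (simp add: exp_of_nat_mult[symmetric] mult.assoc)
qed

text \<open>\<open>full\<close> separates the expected profitable consumption from
  \<open>\<beta>\<close> by almost \<open>2 * L\<close>, so its sample mean rarely exceeds
  \<open>\<beta>\<close>. Summing the relative overshoot and not its probability gives
  \<open>1 / L\<close> instead of \<open>1 / L\<^sup>2\<close>.\<close>

lemma sum_ex_early_shortage:
  assumes \<eta>: "0 \<le> \<eta>" "\<eta> \<le> L / 20" and full: "full_use (pmf P) i + 2 * L \<le> b $ i"
  shows "(\<Sum>t = 1..N. ex t (early_shortage (b $ i - \<eta>) i)) \<le> 5 / L"
proof -
  define \<beta> where "\<beta> = b $ i - \<eta>"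
  define D where "D = full_use (pmf P) i"
  define \<delta> where "\<delta> = \<beta> - D"
  define a where "a = \<delta>\<^sup>2 / (4 * \<beta>)"
  have D0: "0 \<le> D" unfolding D_def by (rule full_use_nonneg) simp
  have \<delta>: "39 / 20 * L \<le> \<delta>" using \<eta> full by (simp add: \<delta>_def \<beta>_def D_def)
  then have \<delta>0: "0 < \<delta>" using L_pos by linarith
  have \<beta>: "\<delta> \<le> \<beta>" "0 < \<beta>" "\<beta> \<le> 1" using D0 \<delta>0 b_le[of i] L_pos \<eta> by (auto simp: \<delta>_def \<beta>_def)
  have main: "ex t (early_shortage \<beta> i) \<le> (1 / sqrt \<beta>) / sqrt t * exp (- a * t)" if t: "1 \<le> t" "4 \<le> \<beta> * t" for t
  proof -
    \<comment> \<open>\<open>\<delta> / (2 * \<beta>)\<close> minimises the quadratic bound on the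
      exponent. The extra \<open>r / \<beta>\<close> keeps the denominator
      \<open>h * t * \<beta>\<close> away from 0 and raises that bound by exactly 1, which the
      \<open>- 1\<close> of \<open>le_exp_div\<close> pays for.\<close>
    define r where "r = sqrt (\<beta> / t)"
    define h where "h = (\<delta> / 2 + r) / \<beta>"
    have t0: "0 < real t" using t by simp
    have r: "0 < r" "r\<^sup>2 = \<beta> / t" using \<beta> t0 by (auto simp: r_def)
    have h0: "0 < h" using \<delta>0 r \<beta> by (simp add: h_def)
    have h1: "h \<le> 1"
    proof -
      have "r\<^sup>2 \<le> (\<beta> / 2)\<^sup>2" unfolding r(2) using t \<beta> t0 by (simp add: field_simps power2_eq_square)
      then have "r \<le> \<beta> / 2" using \<beta> by (rule_tac power2_le_imp_le) auto
      then show ?thesis using \<beta> by (simp add: h_def)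
    qed
    have "ex t (early_shortage \<beta> i) \<le> ex t (\<lambda>x. exp (- h * t * \<beta> - 1) / (h * t * \<beta>) * exp (h * (\<Sum>(j, x)\<leftarrow>x. of_bool (0 < g j) * c j $ i)))"
    proof (rule ex_mono)
      fix x assume x: "x \<in> set_pmf (law t)"
      then have x0: "x \<noteq> []" using length_run[OF x] t by auto
      have s: "real t * full_use (empirical x) i = (\<Sum>(j, x)\<leftarrow>x. of_bool (0 < g j) * c j $ i)"
        using full_use_empirical[OF x0] length_run[OF x] by simp
      have "max 0 (full_use (empirical x) i - \<beta>) \<le> exp (h * t * (full_use (empirical x) i - \<beta>) - 1) / (h * t)"
        using h0 t0 le_exp_div[of "h * t" "full_use (empirical x) i - \<beta>"] by auto
      then have "early_shortage \<beta> i x \<le> exp (h * t * (full_use (empirical x) i - \<beta>) - 1) / (h * t) / \<beta>"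
        using early_shortage_bounds(4)[OF \<beta>(2), of i x] \<beta>(2)
        by (meson divide_right_mono less_imp_le order_trans)
      also have "\<dots> = exp (- h * t * \<beta> - 1) / (h * t * \<beta>) * exp (h * (real t * full_use (empirical x) i))"
        by (simp add: exp_add[symmetric] algebra_simps)
      finally show "early_shortage \<beta> i x \<le> exp (- h * t * \<beta> - 1) / (h * t * \<beta>) * exp (h * (\<Sum>(j, x)\<leftarrow>x. of_bool (0 < g j) * c j $ i))"
        unfolding s .
    qed
    also have "\<dots> \<le> exp (- h * t * \<beta> - 1) / (h * t * \<beta>) * exp (t * D * (h + h\<^sup>2))"
      unfolding ex_cmult D_def using h0 h1 t0 \<beta> by (intro mult_left_mono ex_full_use_mgf) auto
    also have "\<dots> = exp (t * (- h * \<delta> + D * h\<^sup>2) - 1) / (h * t * \<beta>)"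
      by (simp add: exp_add[symmetric] \<delta>_def algebra_simps)
    also have "\<dots> \<le> exp (- a * t) / (h * t * \<beta>)"
    proof (intro divide_right_mono)
      have "- h * \<delta> + D * h\<^sup>2 \<le> - h * \<delta> + \<beta> * h\<^sup>2" using D0 \<delta>0 by (simp add: \<delta>_def mult_right_mono)
      also have "\<dots> = (r\<^sup>2 - \<delta>\<^sup>2 / 4) / \<beta>"
        using \<beta> by (simp add: h_def field_simps power2_eq_square)
      also have "\<dots> = 1 / t - a"
        using \<beta> t0 unfolding r(2) by (simp add: a_def diff_divide_distrib)
      finally have "t * (- h * \<delta> + D * h\<^sup>2) \<le> t * (1 / t - a)" using t0 by (intro mult_left_mono) auto
      then show "exp (t * (- h * \<delta> + D * h\<^sup>2) - 1) \<le> exp (- a * t)" using t0 by (simp add: algebra_simps)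
    qed (use h0 t0 \<beta> in auto)
    also have "\<dots> \<le> exp (- a * t) / (r * t)"
    proof -
      have "h * t * \<beta> = (\<delta> / 2 + r) * t" using \<beta> by (simp add: h_def)
      moreover have "r * t \<le> (\<delta> / 2 + r) * t" using \<delta>0 t0 by (intro mult_right_mono) auto
      ultimately show ?thesis using r t0 \<delta>0 h0 \<beta> by (intro divide_left_mono mult_pos_pos) auto
    qed
    also have "r * t = sqrt \<beta> * sqrt t"
    proof -
      have "r * t = sqrt \<beta> * (t / sqrt t)" by (simp add: r_def real_sqrt_divide)
      then show ?thesis by (simp add: real_div_sqrt)
    qed
    finally show ?thesis by (simp add: field_simps)
  qed
  \<comment> \<open>For \<open>\<beta> * t < 4\<close> the parameter \<open>h\<close> could exceed 1
    and leave the range of \<open>ex_full_use_mgf\<close>; these at most \<open>4 / \<beta>\<close>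
    periods are charged a full shortage each.\<close>
  have "(\<Sum>t = 1..N. ex t (early_shortage \<beta> i)) \<le>
    (\<Sum>t = 1..N. of_bool (\<beta> * real t < 4) + (1 / sqrt \<beta>) / sqrt t * exp (- a * t))"
  proof (rule sum_mono)
    fix t assume t: "t \<in> {1..N}"
    show "ex t (early_shortage \<beta> i) \<le> of_bool (\<beta> * real t < 4) + (1 / sqrt \<beta>) / sqrt t * exp (- a * t)"
    proof (cases "\<beta> * real t < 4")
      case True
      have "ex t (early_shortage \<beta> i) \<le> 1" using early_shortage_bounds(2)[OF \<beta>(2)] by (intro ex_le_const)
      then show ?thesis using True \<beta> by (simp add: add_increasing2)
    next
      case False
      then show ?thesis using main[of t] t by simp
    qed
  qed
  also have "\<dots> \<le> 4 / \<beta> + 5 / 2 * (1 / sqrt \<beta>) / sqrt a"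
    unfolding sum.distrib
  proof (intro add_mono sum_of_bool_less_le sum_exp_div_sqrt_le)
    show "0 < a" using \<delta>0 \<beta> by (simp add: a_def)
    have "\<delta>\<^sup>2 \<le> \<beta> * 1" unfolding power2_eq_square using \<delta>0 \<beta> by (intro mult_mono) auto
    then show "a \<le> 1 / 4" using \<beta> by (simp add: a_def field_simps)
  qed (use \<beta> in auto)
  also have "sqrt a = \<delta> / (2 * sqrt \<beta>)" using \<delta>0 by (simp add: a_def real_sqrt_divide real_sqrt_mult)
  also have "5 / 2 * (1 / sqrt \<beta>) / (\<delta> / (2 * sqrt \<beta>)) = 5 / \<delta>" using \<beta> by simp
  \<comment> \<open>Both \<open>\<beta>\<close> and \<open>\<delta>\<close> are at least
    \<open>39 / 20 * L\<close>, which is \<open>2 * L\<close> less the tolerance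
    \<open>L / 20\<close>; and \<open>9 * 20 / 39\<close> is below 5.\<close>
  also have "4 / \<beta> + 5 / \<delta> \<le> 4 / (39 / 20 * L) + 5 / (39 / 20 * L)"
    using \<delta> \<beta> L_pos by (intro add_mono divide_left_mono) auto
  also have "\<dots> \<le> 5 / L" using L_pos by (simp add: field_simps)
  finally show ?thesis by (simp add: \<beta>_def)
qed

text \<open>Each period takes between 0 and 1 of a resource, so after \<open>t\<close> periods the
  average is off by at most \<open>t / (T - t)\<close>, whatever the decisions were.\<close>

lemma early_state:
  assumes s: "s < T" "real s \<le> \<eta> * (real T - real s)" "2 \<le> (real T - real s) * L"
    and \<eta>: "\<eta> \<le> L / 20" and h: "length h \<le> s"
  shows "\<bar>avg h $ i - b $ i\<bar> \<le> \<eta>" "alive h"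
proof -
  have close: "\<bar>avg h $ i - b $ i\<bar> \<le> \<eta>" for i
  proof -
    define t where "t = real (length h)"
    have t: "0 \<le> t" "t \<le> s" using h by (auto simp: t_def)
    have k: "0 < real T - t" using s t by linarith
    have b1: "0 \<le> b $ i" "b $ i \<le> 1" using b_pos[of i] b_le[of i] L_pos by linarith+
    have "\<bar>rem h $ i - (real T - t) * b $ i\<bar> \<le> t"
    proof -
      have "real T * b $ i - t \<le> rem h $ i" "rem h $ i \<le> real T * b $ i"
        using remaining_bounds[of c i T b h] bounds(3,4) by (auto simp: t_def)
      moreover have "0 \<le> t * b $ i" "t * b $ i \<le> t" using b1 t mult_left_le[of "b $ i" t] by auto
      moreover have "(real T - t) * b $ i = real T * b $ i - t * b $ i" by (simp add: algebra_simps)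
      ultimately show ?thesis by linarith
    qed
    moreover have "avg h $ i - b $ i = (rem h $ i - (real T - t) * b $ i) / (real T - t)"
      using k by (simp add: average_remaining_def t_def field_simps)
    ultimately have "\<bar>avg h $ i - b $ i\<bar> \<le> t / (real T - t)"
      using k by (simp add: divide_right_mono)
    also have "\<dots> \<le> s / (real T - s)" using t s k by (intro frac_le) auto
    also have "\<dots> \<le> \<eta>" using s by (simp add: divide_le_eq)
    finally show ?thesis .
  qed
  then show "\<bar>avg h $ i - b $ i\<bar> \<le> \<eta>" .
  show "alive h"
    unfolding alive_def
  proof
    fix i
    have "L / 2 < avg h $ i" using close[of i] b_ge[of i] \<eta> L_pos by linarith
    moreover have "0 < real T - length h" using s h by simp
    ultimately have "(real T - length h) * (L / 2) < rem h $ i"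
      by (simp add: average_remaining_def field_simps)
    moreover have "(real T - s) * L \<le> (real T - length h) * L"
      using h L_pos by (intro mult_right_mono) auto
    ultimately show "1 < rem h $ i" using s(3) by simp
  qed
qed

text \<open>Capacities stay within tolerance, so after the first period a loss requires an atypical
  history, to which \<open>loss_shortage\<close> applies. Its shortage term is nonnegative and may
  be summed over all histories, since its total is only of order \<open>1 / L\<close> per
  resource.\<close>

lemma early_loss:
  assumes s: "s < T" "real s \<le> \<eta> * (real T - real s)" "2 \<le> (real T - real s) * L"
    and \<eta>: "0 \<le> \<eta>" "\<eta> \<le> L / 20"
  shows "(\<Sum>t<s. mean_loss t) \<le>
    \<Lambda> + 2 * CARD('n) * \<Lambda> / L\<^sup>2 + 5 * CARD('m) / L + (171 / 100 * CARD('n) + 1) / L"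
proof -
  define U where "U t = (\<Sum>i\<in>UNIV. ex t (early_shortage (b $ i - \<eta>) i))" for t
  define \<phi> where "\<phi> = profitable"
  have bound: "mean_loss t \<le>
      2 * \<Lambda> * (2 * CARD('n) * exp (- (2 * L\<^sup>2) * t)) + \<phi> * U t + rare_deviation t"
    if t: "t \<in> {1..<s}" for t
  proof -
    have "mean_loss t \<le> ex t (\<lambda>h. 2 * \<Lambda> * of_bool (atypical L h) +
      \<phi> * (\<Sum>i\<in>UNIV. early_shortage (b $ i - \<eta>) i h) + of_bool (atypical L h) * deviation h)"
    proof (rule ex_mono)
      fix h assume h: "h \<in> set_pmf (law t)"
      have len: "length h = t" by (rule length_run[OF h])
      have h0: "h \<noteq> []" "length h < T" "length h \<le> s" using len t s by auto
      have \<beta>: "0 < b $ i - \<eta>" for i using b_ge[of i] \<eta> L_pos by linarith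
      note st = early_state[OF s \<eta>(2) h0(3)]
      note opt = optimal_dec[OF st(2) h0(1,2)]
      have sh: "0 \<le> \<phi> * (\<Sum>i\<in>UNIV. early_shortage (b $ i - \<eta>) i h)"
        using early_shortage_bounds(1)[OF \<beta>] by (intro mult_nonneg_nonneg sum_nonneg) (auto simp: \<phi>_def)
      show "of_bool (alive h) * loss (dec h) \<le> 2 * \<Lambda> * of_bool (atypical L h) +
        \<phi> * (\<Sum>i\<in>UNIV. early_shortage (b $ i - \<eta>) i h) + of_bool (atypical L h) * deviation h"
      proof (cases "atypical L h")
        case False
        then have "\<bar>empirical h j - pmf P j\<bar> < L" for j by (auto simp: atypical_def not_le)
        moreover have "\<bar>avg h $ i - b $ i\<bar> \<le> L" for i using st(1)[of i] \<eta> L_pos by linarith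
        ultimately have "loss (dec h) = 0" by (rule loss_stable(1)[OF _ _ opt])
        then show ?thesis using False sh by simp
      next
        case True
        have avg: "b $ i - \<eta> \<le> avg h $ i" for i using st(1)[of i] by (simp add: abs_le_iff)
        have "loss (dec h) \<le> 2 * \<Lambda> + profitable * (\<Sum>i\<in>UNIV. early_shortage (b $ i - \<eta>) i h) + (\<Sum>j\<in>UNIV. \<bar>pmf P j - empirical h j\<bar>)"
          using early_shortage_bounds[OF \<beta>] avg \<beta>
          by (intro loss_shortage[OF _ _ opt] empirical_nonneg sum_empirical h0(1)) (meson less_imp_le order_trans)+
        then show ?thesis using True st(2) by (simp add: \<phi>_def deviation_def)
      qed
    qed
    also have "\<dots> = 2 * \<Lambda> * pr t (atypical L) + \<phi> * U t + rare_deviation t"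
      unfolding U_def ex_add ex_cmult ex_sum ..
    also have "\<dots> \<le> 2 * \<Lambda> * (2 * CARD('n) * exp (- (2 * L\<^sup>2) * t)) + \<phi> * U t + rare_deviation t"
      using ex_atypical_le[OF L_pos, of t] t \<Lambda>_pos
      by (intro add_mono[OF add_mono[OF mult_left_mono order_refl] order_refl]) auto
    finally show ?thesis .
  qed
  have first: "mean_loss 0 \<le> \<Lambda>"
    using loss_one \<Lambda>_pos by (simp add: ex_0 dec_def)
  have "(\<Sum>t<s. mean_loss t) \<le> \<Lambda> + (\<Sum>t\<in>{1..<s}. mean_loss t)"
  proof (cases "s = 0")
    case False
    then have "{..<s} = insert 0 {1..<s}" by auto
    then show ?thesis using first by simp
  qed (use \<Lambda>_pos in simp)
  also have "(\<Sum>t\<in>{1..<s}. mean_loss t) \<le> (\<Sum>t\<in>{1..<s}.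
      2 * \<Lambda> * (2 * CARD('n) * exp (- (2 * L\<^sup>2) * t)) + \<phi> * U t + rare_deviation t)"
    by (intro sum_mono bound)
  also have "\<dots> = 4 * CARD('n) * \<Lambda> * (\<Sum>t\<in>{1..<s}. exp (- (2 * L\<^sup>2) * t)) + \<phi> * (\<Sum>t\<in>{1..<s}. U t) +
      (\<Sum>t\<in>{1..<s}. rare_deviation t)"
    by (simp add: sum.distrib sum_distrib_left mult_ac)
  also have "\<dots> \<le> 4 * CARD('n) * \<Lambda> * (1 / (2 * L\<^sup>2)) + CARD('m) * (5 / L) + (171 / 100 * CARD('n) + 1) / L"
  proof (intro add_mono mult_left_mono)
    have eq: "{1..<s} = {1..s - 1}" by auto
    show "(\<Sum>t\<in>{1..<s}. exp (- (2 * L\<^sup>2) * t)) \<le> 1 / (2 * L\<^sup>2)"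
      unfolding eq using L_pos by (intro sum_exp_le) auto
    show "(\<Sum>t\<in>{1..<s}. rare_deviation t) \<le> (171 / 100 * CARD('n) + 1) / L"
      unfolding eq by (rule sum_ex_atypical_deviation)
    show "\<phi> * (\<Sum>t\<in>{1..<s}. U t) \<le> CARD('m) * (5 / L)"
    proof (cases "\<exists>j. 0 < g j")
      case True
      then obtain j where j: "0 < g j" by blast
      have "(\<Sum>t\<in>{1..<s}. U t) = (\<Sum>i\<in>UNIV. \<Sum>t = 1..s - 1. ex t (early_shortage (b $ i - \<eta>) i))"
        unfolding U_def eq by (rule sum.swap)
      also have "\<dots> \<le> (\<Sum>i\<in>(UNIV :: 'm set). 5 / L)"
        using slack[OF j] by (intro sum_mono sum_ex_early_shortage \<eta>) (simp add: full_use_def)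
      finally show ?thesis using True by (simp add: \<phi>_def)
    qed (use L_pos in \<open>simp add: \<phi>_def\<close>)
  qed (use \<Lambda>_pos in auto)
  finally show ?thesis by (simp add: mult_ac add_ac)
qed

end

section \<open>The late periods\<close>

lemma not_always_first:
  assumes "\<not> always Q s h"
  obtains r where "s \<le> r" "r \<le> length h" "\<not> Q (take r h)" "\<And>q. s \<le> q \<Longrightarrow> q < r \<Longrightarrow> Q (take q h)"
proof -
  define R where "R r \<longleftrightarrow> s \<le> r \<and> r \<le> length h \<and> \<not> Q (take r h)" for r
  have "\<exists>r. R r" using assms by (auto simp: always_def R_def)
  then obtain r where r: "R r" "\<And>q. q < r \<Longrightarrow> \<not> R q" by (metis exists_least_iff)
  show thesis by (rule that[of r]) (use r in \<open>auto simp: R_def\<close>)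
qed

text \<open>The tolerance \<open>e\<close> has to vanish with growing \<open>T\<close> while
  \<open>L\<close> is fixed: a frequency error of \<open>e\<close> biases the average capacity by
  order \<open>e / k\<close> with \<open>k\<close> periods left, which adds up to order
  \<open>e * harm T\<close>.\<close>

locale late_phase = allocation_run \<mu> c P b lam L Y T
  for \<mu> :: "'n::finite \<Rightarrow> real" and c :: "'n \<Rightarrow> real^'m::finite" and P b lam L Y T +
  fixes s :: nat and e \<eta> :: real
  assumes s: "1 \<le> s" "s < T" "real s \<le> \<eta> * (real T - real s)" "2 \<le> (real T - real s) * L"
    and \<eta>: "0 \<le> \<eta>" "\<eta> \<le> L / 20"
    and e: "0 < e" "e < L" "CARD('n) * e \<le> L"
    and drift_small: "8 * (CARD('n) * e) * harm T \<le> \<eta>"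
begin

section \<open>Tilted capacities as supermartingales\<close>

definition typical :: "'n history \<Rightarrow> bool" where
  "typical h \<longleftrightarrow> (\<forall>k. \<bar>empirical h k - pmf P k\<bar> \<le> e)"

definition tracking :: "'n history \<Rightarrow> bool" where
  "tracking h \<longleftrightarrow> typical h \<and> alive h"

text \<open>The condition on \<open>avg\<close> is the capacity range in which \<open>stable\<close>
  makes all constraints bind.\<close>

definition steady :: "'n history \<Rightarrow> bool" where
  "steady h \<longleftrightarrow> tracking h \<and> (\<forall>i. \<bar>avg h $ i - b $ i\<bar> \<le> L)"

text \<open>The second factor compensates the drift caused by the errors of the empirical frequencies.\<close>

definition tilt :: "real \<Rightarrow> 'm \<Rightarrow> 'n history \<Rightarrow> real" where
  "tilt d i h = (1 - d / (real T - real (length h))) powr (rem h $ i) *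
     exp (8 * (CARD('n) * e) * \<bar>d\<bar> * harm (T - length h - 1))"

lemma tilt_nonneg: "0 \<le> tilt d i h"
  by (simp add: tilt_def)

lemma tilt_ge: "(1 - d / (real T - real (length h))) powr (rem h $ i) \<le> tilt d i h"
proof -
  have "0 \<le> 8 * (CARD('n) * e) * \<bar>d\<bar> * harm (T - length h - 1)"
    using e harm_nonneg[where 'a = real] by (intro mult_nonneg_nonneg) auto
  then show ?thesis by (simp add: tilt_def mult_le_cancel_left1)
qed

lemma typical_deviation:
  assumes "typical h"
  shows "(\<Sum>j\<in>UNIV. \<bar>pmf P j - empirical h j\<bar>) \<le> CARD('n) * e"
proof -
  have "(\<Sum>j\<in>UNIV. \<bar>pmf P j - empirical h j\<bar>) \<le> (\<Sum>j\<in>(UNIV :: 'n set). e)"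
    using assms by (intro sum_mono) (auto simp: typical_def abs_minus_commute)
  then show ?thesis by simp
qed

lemma mean_use_close:
  assumes "typical h" "\<And>j. 0 \<le> v j" "\<And>j. v j \<le> 1"
  shows "\<bar>(\<Sum>j\<in>UNIV. pmf P j * v j) - (\<Sum>j\<in>UNIV. empirical h j * v j)\<bar> \<le> CARD('n) * e"
proof -
  have "\<bar>(\<Sum>j\<in>UNIV. pmf P j * v j) - (\<Sum>j\<in>UNIV. empirical h j * v j)\<bar> = \<bar>\<Sum>j\<in>UNIV. (pmf P j - empirical h j) * v j\<bar>"
    by (simp add: sum_subtractf[symmetric] left_diff_distrib)
  also have "\<dots> \<le> (\<Sum>j\<in>UNIV. \<bar>pmf P j - empirical h j\<bar>)"
    using assms by (intro order_trans[OF sum_abs sum_mono]) (auto simp: abs_mult intro: mult_left_le)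
  also have "\<dots> \<le> CARD('n) * e" by (rule typical_deviation[OF assms(1)])
  finally show ?thesis .
qed

text \<open>For positive \<open>d\<close> too large a mean consumption has to be excluded, which is
  feasibility of the computed solution. For negative \<open>d\<close> too small a one has to be
  excluded, which holds because all constraints bind in a \<open>steady\<close> state.\<close>

lemma tilt_drift:
  assumes h: "1 \<le> length h" "Suc (length h) < T" "tracking h"
    and d: "0 \<le> d \<and> d \<le> 7 / 8 * (real T - real (Suc (length h))) \<or> d \<le> 0 \<and> steady h"
  shows "next_mean h (tilt d i) \<le> tilt d i h"
proof -
  define k where "k = real T - real (length h)"
  define x where "x = 1 - d / (k - 1)"
  define B where "B = rem h $ i"
  define E where "E = 8 * (CARD('n) * e) * \<bar>d\<bar>"
  define q where "q = (\<Sum>j\<in>UNIV. pmf P j * (dec h $ j * c j $ i))"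
  define H where "H = exp (E * harm (T - length h - 1 - 1))"
  have al: "alive h" and len: "length h < T" and h0: "h \<noteq> []" and ty: "typical h"
    using h by (auto simp: tracking_def)
  have k: "1 < k" using h by (simp add: k_def)
  have B: "1 \<le> B" using al by (simp add: alive_def B_def less_imp_le)
  have E: "0 \<le> E" using e by (simp add: E_def)
  note y = dec_bounds[OF al len]
  note opt = optimal_dec[OF al h0 len]
  have avg: "avg h $ i = B / k" by (simp add: average_remaining_def B_def k_def)
  have v: "0 \<le> dec h $ j * c j $ i" "dec h $ j * c j $ i \<le> 1" for j
    using y[of j] bounds(3,4)[of j i] by (auto intro: mult_le_one)
  have close: "\<bar>q - (\<Sum>j\<in>UNIV. empirical h j * (dec h $ j * c j $ i))\<bar> \<le> CARD('n) * e"
    unfolding q_def using v by (rule mean_use_close[OF ty])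
  have x8: "1 / 8 \<le> x"
  proof (cases "0 \<le> d")
    case True
    then have "d \<le> 7 / 8 * (k - 1)" using d k by (auto simp: k_def)
    then show ?thesis using k by (simp add: x_def field_simps)
  next
    case False
    then show ?thesis using k by (simp add: x_def divide_le_eq)
  qed
  have q_le: "q \<le> B / k + CARD('n) * e"
  proof -
    have "(\<Sum>j\<in>UNIV. (empirical h j * dec h $ j) *\<^sub>R c j) \<le> avg h"
      using opt by (simp add: alloc_optimal_def alloc_feasible_def)
    then have "(\<Sum>j\<in>UNIV. empirical h j * (dec h $ j * c j $ i)) \<le> avg h $ i"
      by (simp add: less_eq_vec_def mult.assoc)
    then show ?thesis using close avg by linarith
  qed
  have st: "steady h" if "d < 0" using that d by linarith
  have q_ge: "B / k - CARD('n) * e \<le> q" if "d < 0"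
  proof -
    have "\<bar>empirical h j - pmf P j\<bar> < L" for j using ty e by (meson typical_def le_less_trans)
    moreover have "\<bar>avg h $ i - b $ i\<bar> \<le> L" for i using st[OF that] by (simp add: steady_def)
    ultimately have "(\<Sum>j\<in>UNIV. empirical h j * dec h $ j * c j $ i) = avg h $ i"
      by (rule loss_stable(2)[OF _ _ opt])
    then show ?thesis using close avg by (simp add: mult.assoc abs_le_iff)
  qed
  have Bk: "B \<le> k" if "d < 0"
  proof -
    have "avg h $ i \<le> b $ i + L" using st[OF that] unfolding steady_def by (metis abs_le_D1 diff_le_eq add.commute)
    then have "B / k \<le> 1" using b_le[of i] avg by linarith
    then show ?thesis using k by (simp add: divide_le_eq)
  qed
  have step: "tilt d i (h @ [(j, a)]) = x powr (B - of_bool a * c j $ i) * H" for j a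
    by (simp add: tilt_def x_def B_def H_def E_def k_def remaining_snoc diff_diff_eq add.commute)
  have eq: "next_mean h (tilt d i) = (\<Sum>j\<in>UNIV. pmf P j * (dec h $ j * (x powr (B - c j $ i)) + (1 - dec h $ j) * x powr B)) * H"
    unfolding next_mean_alive[OF al len] step sum_distrib_right by (intro sum.cong) (auto simp: algebra_simps)
  have "(\<Sum>j\<in>UNIV. pmf P j * (dec h $ j * (x powr (B - c j $ i)) + (1 - dec h $ j) * x powr B)) \<le>
    (\<Sum>j\<in>UNIV. x powr B * pmf P j + x powr B * (pmf P j * (dec h $ j * c j $ i)) * (1 / x - 1))"
  proof (rule sum_mono)
    fix j
    \<comment> \<open>Convexity replaces a partial consumption by a full unit taken with probability
      \<open>c j $ i\<close>, so that only the mean consumption \<open>q\<close> matters.\<close>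
    have "x powr (B - c j $ i) = x powr B * (1 / x) powr (c j $ i)"
      using x8 by (simp add: powr_diff powr_divide)
    also have "\<dots> \<le> x powr B * (1 + c j $ i * (1 / x - 1))"
      using x8 bounds(3,4)[of j i] by (intro mult_left_mono powr_le_affine) auto
    finally have "dec h $ j * x powr (B - c j $ i) \<le> dec h $ j * (x powr B * (1 + c j $ i * (1 / x - 1)))"
      using y[of j] by (intro mult_left_mono) auto
    then have "pmf P j * (dec h $ j * x powr (B - c j $ i) + (1 - dec h $ j) * x powr B) \<le>
      pmf P j * (dec h $ j * (x powr B * (1 + c j $ i * (1 / x - 1))) + (1 - dec h $ j) * x powr B)"
      by (rule mult_left_mono[OF add_right_mono pmf_nonneg])
    also have "\<dots> = x powr B * pmf P j + x powr B * (pmf P j * (dec h $ j * c j $ i)) * (1 / x - 1)"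
      by (simp only: ring_distribs) (simp add: algebra_simps)
    finally show "pmf P j * (dec h $ j * x powr (B - c j $ i) + (1 - dec h $ j) * x powr B) \<le>
      x powr B * pmf P j + x powr B * (pmf P j * (dec h $ j * c j $ i)) * (1 / x - 1)" .
  qed
  also have "\<dots> = x powr B * (1 + q * (1 / x - 1))"
    unfolding sum.distrib sum_distrib_left[symmetric] sum_distrib_right[symmetric] sum_P1 q_def[symmetric]
    by (simp add: algebra_simps)
  also have "\<dots> \<le> (1 - d / k) powr B * (1 + 8 * (CARD('n) * e) * \<bar>d\<bar> / (k - 1))"
    unfolding x_def
    by (rule powr_drift[OF k B]) (use Bk x8 e q_le q_ge in \<open>auto simp: x_def\<close>)
  finally have "next_mean h (tilt d i) \<le> (1 - d / k) powr B * (1 + 8 * (CARD('n) * e) * \<bar>d\<bar> / (k - 1)) * H"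
    unfolding eq by (rule mult_right_mono) (simp add: H_def)
  also have "\<dots> = (1 - d / k) powr B * ((1 + E / (k - 1)) * H)" by (simp add: E_def)
  also have "\<dots> \<le> (1 - d / k) powr B * (exp (E / (k - 1)) * H)"
    by (intro mult_left_mono mult_right_mono) (auto simp: H_def)
  \<comment> \<open>In this period the harmonic exponent loses the term \<open>1 / (k - 1)\<close>,
    which is exactly what the drift error consumes.\<close>
  also have "exp (E / (k - 1)) * H = exp (E * harm (T - length h - 1))"
  proof -
    have "T - length h - 1 = Suc (T - length h - 1 - 1)" using h by simp
    moreover have "k - 1 = real (T - length h - 1)" using h by (simp add: k_def of_nat_diff)
    ultimately have "harm (T - length h - 1) = harm (T - length h - 1 - 1) + 1 / (k - 1)"
      by (metis harm_Suc inverse_eq_divide)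
    then show ?thesis by (simp add: H_def exp_add[symmetric] distrib_left)
  qed
  also have "(1 - d / k) powr B * exp (E * harm (T - length h - 1)) = tilt d i h"
    by (simp add: tilt_def E_def k_def B_def)
  finally show ?thesis .
qed

text \<open>One \<open>\<eta>\<close> covers the distance of the average capacity from
  \<open>b\<close> at the cut, the other the compensating factor, by
  \<open>drift_small\<close>.\<close>

lemma tilt_start:
  assumes "h \<in> set_pmf (law s)" "d < real T - real s"
  shows "tilt d i h \<le> exp (- d * b $ i + 2 * \<bar>d\<bar> * \<eta>)"
proof -
  have len: "length h = s" by (rule length_run[OF assms(1)])
  define K where "K = real T - real s"
  have K: "0 < K" using s by (simp add: K_def)
  have "\<bar>avg h $ i - b $ i\<bar> \<le> \<eta>" "alive h"
    using early_state[OF s(2-4) \<eta>(2)] len by auto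
  then have rem: "rem h $ i = K * avg h $ i" "0 < rem h $ i"
    using K by (auto simp: average_remaining_def len K_def alive_def intro: less_trans[OF zero_less_one])
  have "(1 - d / K) powr (rem h $ i) \<le> exp (- d / K) powr (rem h $ i)"
    using exp_ge_add_one_self[of "- d / K"] assms(2) K rem by (intro powr_mono2) (auto simp: K_def)
  also have "\<dots> = exp (- d * avg h $ i)" using K by (simp add: powr_def rem)
  finally have 1: "(1 - d / K) powr (rem h $ i) \<le> exp (- d * avg h $ i)" .
  have "- d * (avg h $ i - b $ i) \<le> \<bar>d\<bar> * \<eta>"
  proof -
    have "- d * (avg h $ i - b $ i) \<le> \<bar>d\<bar> * \<bar>avg h $ i - b $ i\<bar>"
      by (metis abs_ge_self abs_minus_cancel abs_mult)
    also have "\<dots> \<le> \<bar>d\<bar> * \<eta>" using \<open>\<bar>avg h $ i - b $ i\<bar> \<le> \<eta>\<close> by (intro mult_left_mono) auto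
    finally show ?thesis .
  qed
  moreover have "8 * (CARD('n) * e) * \<bar>d\<bar> * harm (T - s - 1) \<le> \<bar>d\<bar> * \<eta>"
  proof -
    have "8 * (CARD('n) * e) * harm (T - s - 1) \<le> 8 * (CARD('n) * e) * harm T"
      using e by (intro mult_left_mono harm_mono) auto
    then have "8 * (CARD('n) * e) * harm (T - s - 1) \<le> \<eta>" using drift_small by linarith
    then have "\<bar>d\<bar> * (8 * (CARD('n) * e) * harm (T - s - 1)) \<le> \<bar>d\<bar> * \<eta>" by (intro mult_left_mono) auto
    then show ?thesis by (simp add: mult_ac)
  qed
  ultimately have 2: "- d * avg h $ i + 8 * (CARD('n) * e) * \<bar>d\<bar> * harm (T - s - 1) \<le> - d * b $ i + 2 * \<bar>d\<bar> * \<eta>"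
    by (simp add: algebra_simps)
  have "tilt d i h \<le> exp (- d * avg h $ i) * exp (8 * (CARD('n) * e) * \<bar>d\<bar> * harm (T - s - 1))"
    unfolding tilt_def len K_def[symmetric] using 1 by (intro mult_right_mono) auto
  also have "\<dots> \<le> exp (- d * b $ i + 2 * \<bar>d\<bar> * \<eta>)" unfolding exp_add[symmetric] using 2 by simp
  finally show ?thesis .
qed

text \<open>For nonnegative \<open>d\<close> the bound at the final period \<open>t\<close> implies
  that of \<open>tilt_drift\<close> in every earlier period, where more periods are left.\<close>

definition admissible :: "('n history \<Rightarrow> bool) \<Rightarrow> nat \<Rightarrow> real \<Rightarrow> bool" where
  "admissible Q t d \<longleftrightarrow> s \<le> t \<and> t < T \<and> (\<forall>h. Q h \<longrightarrow> tracking h) \<and>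
    (0 \<le> d \<and> d \<le> 7 / 8 * (real T - real t) \<or> d \<le> 0 \<and> (\<forall>h. Q h \<longrightarrow> steady h))"

lemma admissible_drift:
  assumes "admissible Q t d" "s \<le> r" "r < t" "h \<in> set_pmf (law r)" "always Q s h"
  shows "next_mean h (tilt d i) \<le> tilt d i h"
proof -
  have len: "length h = r" by (rule length_run[OF assms(4)])
  have "Q (take (length h) h)" using assms(2,5) len unfolding always_def by blast
  then have Q: "Q h" by simp
  have "real T - real t \<le> real T - real (Suc r)" using assms(3) by simp
  then show ?thesis
    using assms Q len s by (intro tilt_drift) (auto simp: admissible_def)
qed

lemma admissible_start:
  assumes "admissible Q t d"
  shows "ex s (tilt d i) \<le> exp (- d * b $ i + 2 * \<bar>d\<bar> * \<eta>)"
proof (rule ex_le_const, rule tilt_start)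
  show "d < real T - real s"
  proof (cases "0 < d")
    case True
    then have "d \<le> 7 / 8 * (real T - real t)" "s \<le> t" "t < T" using assms by (auto simp: admissible_def)
    then have "d < real T - real t" "real T - real t \<le> real T - real s" by auto
    then show ?thesis by linarith
  next
    case False
    then show ?thesis using s by simp
  qed
qed

lemma ex_crosses_tilt:
  assumes "admissible Q t d" "0 \<le> M"
  shows "pr t (\<lambda>h. crosses Q (\<lambda>h. M * tilt d i h) s h) \<le> M * exp (- d * b $ i + 2 * \<bar>d\<bar> * \<eta>)"
proof -
  have "pr t (\<lambda>h. crosses Q (\<lambda>h. M * tilt d i h) s h) \<le> ex s (\<lambda>h. M * tilt d i h)"
  proof (rule ex_crosses_le)
    show "s \<le> t" using assms by (simp add: admissible_def)
    show "0 \<le> M * tilt d i h" for h using assms tilt_nonneg by simp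
    fix r h assume "s \<le> r" "r < t" "h \<in> set_pmf (law r)" "always Q s h"
    then have "M * next_mean h (tilt d i) \<le> M * tilt d i h"
      using assms admissible_drift by (intro mult_left_mono) auto
    then show "next_mean h (\<lambda>h. M * tilt d i h) \<le> M * tilt d i h"
      by (simp add: next_mean_def sum_distrib_left mult_ac)
  qed
  also have "\<dots> \<le> M * exp (- d * b $ i + 2 * \<bar>d\<bar> * \<eta>)"
    unfolding ex_cmult using assms admissible_start by (intro mult_left_mono) auto
  finally show ?thesis .
qed

lemma ex_always_tilt:
  assumes "admissible Q t d"
  shows "ex t (\<lambda>h. of_bool (always Q s h) * tilt d i h) \<le> exp (- d * b $ i + 2 * \<bar>d\<bar> * \<eta>)"
proof -
  have "ex t (\<lambda>h. of_bool (always Q s h) * tilt d i h) \<le> ex s (tilt d i)"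
    using assms admissible_drift tilt_nonneg by (intro ex_supermartingale) (auto simp: admissible_def)
  also have "\<dots> \<le> exp (- d * b $ i + 2 * \<bar>d\<bar> * \<eta>)" by (rule admissible_start[OF assms])
  finally show ?thesis .
qed

section \<open>Depletion and departure from the benchmark capacities\<close>

definition strays :: "'n history \<Rightarrow> bool" where
  "strays h \<longleftrightarrow> (\<exists>r. s \<le> r \<and> r \<le> length h \<and> \<not> typical (take r h))"

text \<open>A union bound over types and at most \<open>T\<close> periods, with the Hoeffding tail
  taken at the shortest length \<open>s\<close>.\<close>

definition \<epsilon>0 :: real where "\<epsilon>0 = 2 * CARD('n) * T * exp (- 2 * e\<^sup>2 * s)"

lemma \<epsilon>0_nonneg: "0 \<le> \<epsilon>0"
  by (simp add: \<epsilon>0_def)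

lemma ex_strays:
  assumes "t < T"
  shows "pr t strays \<le> \<epsilon>0"
proof -
  have "pr t strays \<le> ex t (\<lambda>h. \<Sum>r = s..t. of_bool (\<not> typical (take r h)))"
  proof (rule ex_mono)
    fix h assume h: "h \<in> set_pmf (law t)"
    show "of_bool (strays h) \<le> (\<Sum>r = s..t. of_bool (\<not> typical (take r h)) :: real)"
    proof (cases "strays h")
      case True
      then obtain r where r: "r \<in> {s..t}" "\<not> typical (take r h)" using length_run[OF h] by (auto simp: strays_def)
      have "of_bool (\<not> typical (take r h)) \<le> (\<Sum>r = s..t. of_bool (\<not> typical (take r h)) :: real)"
        using r by (intro member_le_sum) auto
      then show ?thesis using True r by simp
    qed (simp add: sum_nonneg)
  qed
  also have "\<dots> = (\<Sum>r = s..t. pr r (\<lambda>h. \<not> typical h))"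
    unfolding ex_sum by (intro sum.cong refl ex_take[of _ t "\<lambda>h. of_bool (\<not> typical h)"]) auto
  also have "\<dots> \<le> (\<Sum>r = s..t. 2 * CARD('n) * exp (- 2 * e\<^sup>2 * s))"
  proof (rule sum_mono)
    fix r assume r: "r \<in> {s..t}"
    have "pr r (\<lambda>h. \<not> typical h) \<le> pr r (\<lambda>h. atypical e h)"
      by (intro ex_mono) (auto simp: typical_def atypical_def not_le intro: less_imp_le)
    also have "\<dots> \<le> 2 * CARD('n) * exp (- 2 * e\<^sup>2 * r)"
      using r s e ex_atypical_le[of e r] by simp
    also have "\<dots> \<le> 2 * CARD('n) * exp (- 2 * e\<^sup>2 * s)"
      using r by (intro mult_left_mono) (auto intro!: mult_left_mono)
    finally show "pr r (\<lambda>h. \<not> typical h) \<le> 2 * CARD('n) * exp (- 2 * e\<^sup>2 * s)" .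
  qed
  also have "\<dots> = real (card {s..t}) * (2 * CARD('n) * exp (- 2 * e\<^sup>2 * s))" by simp
  also have "\<dots> \<le> real T * (2 * CARD('n) * exp (- 2 * e\<^sup>2 * s))"
    using assms s by (intro mult_right_mono) auto
  finally show ?thesis by (simp add: \<epsilon>0_def mult_ac)
qed

lemma alive_start: "length h \<le> s \<Longrightarrow> alive h"
  using early_state(2)[OF s(2-4) \<eta>(2)] .

lemma rem_eq_avg: "length h < T \<Longrightarrow> rem h $ i = (real T - real (length h)) * avg h $ i"
  by (simp add: average_remaining_def)

text \<open>With \<open>d\<close> half the number of periods left at \<open>t\<close>, the base is
  at least \<open>1 / 2\<close> in all earlier periods too. An exponent of at most 1 then leaves the
  tilt at \<open>1 / 2\<close> or more, whence the factor 2.\<close>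

lemma death_crosses:
  assumes t: "t < T" and r: "s \<le> r" "r \<le> t" "r \<le> length h"
    and Q: "\<And>q. s \<le> q \<Longrightarrow> q < r \<Longrightarrow> Q (take q h)" and dead: "rem (take r h) $ i \<le> 1"
  shows "crosses Q (\<lambda>h. 2 * tilt ((real T - real t) / 2) i h) s h"
proof -
  define k where "k = real T - real t"
  define k' where "k' = real T - real r"
  have k: "0 < k" "k \<le> k'" using t r by (auto simp: k_def k'_def)
  have "1 / 2 \<le> 1 - (k / 2) / k'" "1 - (k / 2) / k' \<le> 1" using k by (auto simp: field_simps)
  then have "1 / 2 \<le> (1 - (k / 2) / k') powr 1" by simp
  also have "\<dots> \<le> (1 - (k / 2) / k') powr (rem (take r h) $ i)"
    using dead \<open>1 / 2 \<le> 1 - (k / 2) / k'\<close> \<open>1 - (k / 2) / k' \<le> 1\<close> by (intro powr_mono') auto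
  also have "\<dots> \<le> tilt (k / 2) i (take r h)" using tilt_ge[of "k / 2" "take r h" i] r by (simp add: k'_def)
  finally show ?thesis
    unfolding crosses_def k_def using r Q by (intro exI[of _ r]) auto
qed

text \<open>The rate is linear in \<open>L\<close> because depletion is a deviation by the whole of
  \<open>b\<close>, of which at least \<open>L - 2 * \<eta>\<close> counts, weighted by
  \<open>1 / 2\<close> through \<open>d\<close>.\<close>

lemma ex_death_crosses:
  assumes t: "s \<le> t" "t < T" and Q: "\<And>h. Q h \<Longrightarrow> tracking h"
  shows "pr t (\<lambda>h. crosses Q (\<lambda>h. 2 * tilt ((real T - real t) / 2) i h) s h)
    \<le> 2 * exp (- (9 / 20 * L) * (real T - real t))"
proof -
  have "pr t (\<lambda>h. crosses Q (\<lambda>h. 2 * tilt ((real T - real t) / 2) i h) s h) \<le>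
    2 * exp (- ((real T - real t) / 2) * b $ i + 2 * \<bar>(real T - real t) / 2\<bar> * \<eta>)"
    using t Q by (intro ex_crosses_tilt) (auto simp: admissible_def)
  also have "\<dots> \<le> 2 * exp (- (9 / 20 * L) * (real T - real t))"
  proof -
    have "9 / 10 * L \<le> b $ i - 2 * \<eta>" using b_ge[of i] \<eta> by linarith
    then have "(real T - real t) / 2 * (9 / 10 * L) \<le> (real T - real t) / 2 * (b $ i - 2 * \<eta>)"
      using t by (intro mult_left_mono) auto
    moreover have "- ((real T - real t) / 2) * b $ i + 2 * \<bar>(real T - real t) / 2\<bar> * \<eta> = - ((real T - real t) / 2 * (b $ i - 2 * \<eta>))"
      using t by (simp add: field_simps)
    ultimately show ?thesis by simp
  qed
  finally show ?thesis .
qed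

lemma of_bool_le_sum:
  assumes "X \<Longrightarrow> Z \<or> (\<exists>i. W i)"
  shows "of_bool X \<le> of_bool Z + (\<Sum>i\<in>(UNIV :: 'i::finite set). of_bool (W i) :: real)"
proof (cases "X \<and> \<not> Z")
  case True
  then obtain i where "W i" using assms by blast
  then have "1 \<le> (\<Sum>i\<in>UNIV. of_bool (W i) :: real)"
    using member_le_sum[of i UNIV "\<lambda>i. of_bool (W i) :: real"] by simp
  then show ?thesis by simp
qed (auto simp: sum_nonneg add_nonneg_nonneg)

text \<open>At the first dead prefix from the cut on, all earlier ones are alive, hence
  \<open>tracking\<close> unless frequencies stray; so the tilt with positive \<open>d\<close>
  controls it.\<close>

lemma ex_dead:
  assumes t: "s \<le> t" "t < T"
  shows "pr t (\<lambda>h. \<not> alive h) \<le> \<epsilon>0 + 2 * CARD('m) * exp (- (9 / 20 * L) * (real T - real t))"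
proof -
  let ?W = "\<lambda>i h. crosses tracking (\<lambda>h. 2 * tilt ((real T - real t) / 2) i h) s h"
  have "pr t (\<lambda>h. \<not> alive h) \<le> ex t (\<lambda>h. of_bool (strays h) + (\<Sum>i\<in>UNIV. of_bool (?W i h)))"
  proof (intro ex_mono of_bool_le_sum)
    fix h assume h: "h \<in> set_pmf (law t)" and dead: "\<not> alive h"
    have len: "length h = t" by (rule length_run[OF h])
    have "take (length h) h = h" by simp
    then have "\<not> always alive s h" using dead t len unfolding always_def by (metis order_refl)
    then obtain r where r: "s \<le> r" "r \<le> length h" "\<not> alive (take r h)" "\<And>q. s \<le> q \<Longrightarrow> q < r \<Longrightarrow> alive (take q h)"
      by (rule not_always_first) blast
    show "strays h \<or> (\<exists>i. ?W i h)"
    proof (cases "strays h")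
      case False
      then have "tracking (take q h)" if "s \<le> q" "q < r" for q
        using that r unfolding strays_def tracking_def by (meson less_imp_le order_trans)
      moreover obtain i where "rem (take r h) $ i \<le> 1" using r(3) by (auto simp: alive_def not_less)
      ultimately have "?W i h" using r t len by (intro death_crosses) auto
      then show ?thesis by blast
    qed simp
  qed
  also have "\<dots> \<le> \<epsilon>0 + (\<Sum>i\<in>(UNIV :: 'm set). 2 * exp (- (9 / 20 * L) * (real T - real t)))"
    unfolding ex_add ex_sum using t by (intro add_mono ex_strays sum_mono ex_death_crosses) auto
  finally show ?thesis by simp
qed

text \<open>The normaliser is the inverse of the tilt at average \<open>b $ i - L\<close> with
  \<open>T - t\<close> periods left. By \<open>powr_threshold_mono\<close>, an average below that
  level makes the product at least 1 in any earlier period as well.\<close>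

lemma low_crosses:
  assumes t: "t < T" and r: "s \<le> r" "r \<le> t" "r \<le> length h"
    and Q: "\<And>q. s \<le> q \<Longrightarrow> q < r \<Longrightarrow> Q (take q h)" and low: "avg (take r h) $ i < b $ i - L"
    and \<rho>: "0 \<le> \<rho>" "\<rho> < 1"
  shows "crosses Q (\<lambda>h. (1 - \<rho>) powr (- ((b $ i - L) * (real T - real t))) * tilt (\<rho> * (real T - real t)) i h) s h"
proof -
  define k where "k = real T - real t"
  define k' where "k' = real T - real r"
  define D where "D = b $ i - L"
  have k: "0 < k" "k \<le> k'" using t r by (auto simp: k_def k'_def)
  have D: "0 \<le> D" using b_ge[of i] by (simp add: D_def)
  have x: "0 < 1 - \<rho> * k / k'" "1 - \<rho> * k / k' \<le> 1"
  proof -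
    have "\<rho> * k < 1 * k'" using k \<rho> by (intro mult_less_le_imp_less) auto
    then show "0 < 1 - \<rho> * k / k'" using k by simp
    show "1 - \<rho> * k / k' \<le> 1" using k \<rho> by simp
  qed
  have "rem (take r h) $ i = k' * avg (take r h) $ i"
    using rem_eq_avg[of "take r h" i] r t by (simp add: k'_def)
  also have "\<dots> \<le> k' * D" using low k by (intro mult_left_mono) (auto simp: D_def)
  finally have rem: "rem (take r h) $ i \<le> D * k'" by (simp add: mult.commute)
  have "(1 - \<rho>) powr (D * k) \<le> (1 - \<rho> * k / k') powr (D * k')"
    using powr_threshold_mono[OF k, of "\<rho> * k" D] k \<rho> D by simp
  also have "\<dots> \<le> (1 - \<rho> * k / k') powr (rem (take r h) $ i)"
    using rem x by (intro powr_mono') auto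
  also have "\<dots> \<le> tilt (\<rho> * k) i (take r h)"
    using tilt_ge[of "\<rho> * k" "take r h" i] r by (simp add: k'_def)
  finally have "(1 - \<rho>) powr (- (D * k)) * (1 - \<rho>) powr (D * k) \<le> (1 - \<rho>) powr (- (D * k)) * tilt (\<rho> * k) i (take r h)"
    by (intro mult_left_mono) auto
  moreover have "(1 - \<rho>) powr (- (D * k)) * (1 - \<rho>) powr (D * k) = 1"
    using \<rho> by (simp add: powr_add[symmetric])
  ultimately show ?thesis
    unfolding crosses_def k_def[symmetric] D_def[symmetric] using r Q by (intro exI[of _ r]) auto
qed

lemma high_crosses:
  assumes t: "t < T" and r: "s \<le> r" "r \<le> t" "r \<le> length h"
    and Q: "\<And>q. s \<le> q \<Longrightarrow> q < r \<Longrightarrow> Q (take q h)" and high: "b $ i + L < avg (take r h) $ i"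
    and \<rho>: "0 \<le> \<rho>"
  shows "crosses Q (\<lambda>h. (1 + \<rho>) powr (- ((b $ i + L) * (real T - real t))) * tilt (- (\<rho> * (real T - real t))) i h) s h"
proof -
  define k where "k = real T - real t"
  define k' where "k' = real T - real r"
  define D where "D = b $ i + L"
  have k: "0 < k" "k \<le> k'" using t r by (auto simp: k_def k'_def)
  have D: "0 \<le> D" using b_pos[of i] L_pos by (simp add: D_def)
  have x: "1 \<le> 1 - - (\<rho> * k) / k'" using k \<rho> by simp
  have "k' * D \<le> k' * avg (take r h) $ i" using high k by (intro mult_left_mono) (auto simp: D_def)
  also have "\<dots> = rem (take r h) $ i"
    using rem_eq_avg[of "take r h" i] r t by (simp add: k'_def)
  finally have rem: "D * k' \<le> rem (take r h) $ i" by (simp add: mult.commute)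
  have nk: "- (\<rho> * k) < k" using k \<rho> by (smt (verit) mult_nonneg_nonneg)
  have "1 + \<rho> = 1 - - (\<rho> * k) / k" using k by simp
  then have "(1 + \<rho>) powr (D * k) = (1 - - (\<rho> * k) / k) powr (D * k)" by simp
  also have "\<dots> \<le> (1 - - (\<rho> * k) / k') powr (D * k')"
    by (rule powr_threshold_mono[OF k nk D])
  also have "\<dots> \<le> (1 - - (\<rho> * k) / k') powr (rem (take r h) $ i)"
    using rem x by (rule powr_mono)
  also have "\<dots> \<le> tilt (- (\<rho> * k)) i (take r h)"
    using tilt_ge[of "- (\<rho> * k)" "take r h" i] r by (simp add: k'_def)
  finally have "(1 + \<rho>) powr (- (D * k)) * (1 + \<rho>) powr (D * k) \<le> (1 + \<rho>) powr (- (D * k)) * tilt (- (\<rho> * k)) i (take r h)"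
    by (intro mult_left_mono) auto
  moreover have "(1 + \<rho>) powr (- (D * k)) * (1 + \<rho>) powr (D * k) = 1"
    using \<rho> by (simp add: powr_add[symmetric])
  ultimately show ?thesis
    unfolding crosses_def k_def[symmetric] D_def[symmetric] using r Q by (intro exI[of _ r]) auto
qed

text \<open>The margin against the threshold is \<open>L - 2 * \<eta>\<close>, at least
  \<open>\<gamma> = 9 / 10 * L\<close>. Choosing \<open>1 - \<rho> = exp (- \<gamma>)\<close> makes
  the exponent at most \<open>- \<gamma>\<^sup>2 / 2\<close>, that is
  \<open>- 81 / 200 * L\<^sup>2\<close>, per period left.\<close>

lemma ex_low_crosses:
  assumes t: "s \<le> t" "t < T" and Q: "\<And>h. Q h \<Longrightarrow> tracking h"
  defines "\<rho> \<equiv> 1 - exp (- (9 / 10 * L))"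
  shows "pr t (\<lambda>h. crosses Q (\<lambda>h. (1 - \<rho>) powr (- ((b $ i - L) * (real T - real t))) *
    tilt (\<rho> * (real T - real t)) i h) s h) \<le> exp (- (2 / 5 * L\<^sup>2) * (real T - real t))"
proof -
  define k where "k = real T - real t"
  define \<gamma> where "\<gamma> = 9 / 10 * L"
  have k: "0 < k" using t by (simp add: k_def)
  have \<gamma>: "0 \<le> \<gamma>" "\<gamma> \<le> 1 / 2" using L_pos L_le_half by (auto simp: \<gamma>_def)
  have \<rho>: "0 \<le> \<rho>" "\<rho> \<le> 7 / 8" "\<gamma> - \<gamma>\<^sup>2 / 2 \<le> \<rho>"
  proof -
    show "0 \<le> \<rho>" using \<gamma> by (simp add: \<rho>_def \<gamma>_def)
    show "\<rho> \<le> 7 / 8" using exp_ge_add_one_self[of "- \<gamma>"] \<gamma> by (simp add: \<rho>_def \<gamma>_def)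
    show "\<gamma> - \<gamma>\<^sup>2 / 2 \<le> \<rho>" using exp_minus_le_quadratic[OF \<gamma>(1)] by (simp add: \<rho>_def \<gamma>_def)
  qed
  have "\<rho> * k \<le> 7 / 8 * k" using \<rho> k by (intro mult_right_mono) auto
  then have "pr t (\<lambda>h. crosses Q (\<lambda>h. (1 - \<rho>) powr (- ((b $ i - L) * k)) * tilt (\<rho> * k) i h) s h)
    \<le> (1 - \<rho>) powr (- ((b $ i - L) * k)) * exp (- (\<rho> * k) * b $ i + 2 * \<bar>\<rho> * k\<bar> * \<eta>)"
    using t Q \<rho> k by (intro ex_crosses_tilt) (auto simp: admissible_def k_def)
  also have "\<dots> = exp (k * (\<gamma> * (b $ i - L) - \<rho> * (b $ i - 2 * \<eta>)))"
  proof -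
    have "(1 - \<rho>) powr (- ((b $ i - L) * k)) = exp (k * (\<gamma> * (b $ i - L)))"
      by (simp add: \<rho>_def \<gamma>_def powr_def)
    then show ?thesis using \<rho> k by (simp add: exp_add[symmetric] algebra_simps)
  qed
  also have "\<dots> \<le> exp (k * (- (2 / 5 * L\<^sup>2)))"
  proof -
    have b2: "0 \<le> b $ i - 2 * \<eta>" "b $ i - 2 * \<eta> \<le> 1" using b_ge[of i] b_le[of i] \<eta> L_pos by linarith+
    have "\<gamma> * (b $ i - L) - \<rho> * (b $ i - 2 * \<eta>) \<le> \<gamma> * (b $ i - L) - (\<gamma> - \<gamma>\<^sup>2 / 2) * (b $ i - 2 * \<eta>)"
      using \<rho>(3) b2 by (intro diff_left_mono mult_right_mono) auto
    also have "\<dots> = - (\<gamma> * (L - 2 * \<eta>)) + \<gamma>\<^sup>2 / 2 * (b $ i - 2 * \<eta>)" by (simp add: algebra_simps)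
    also have "\<dots> \<le> - (\<gamma> * \<gamma>) + \<gamma>\<^sup>2 / 2 * 1"
      using b2 \<gamma> \<eta> by (intro add_mono le_imp_neg_le mult_left_mono) (auto simp: \<gamma>_def)
    also have "\<dots> = - (81 / 200 * L\<^sup>2)" by (simp add: \<gamma>_def power2_eq_square)
    also have "\<dots> \<le> - (2 / 5 * L\<^sup>2)" by simp
    finally show ?thesis using k by (intro exp_le_cancel_iff[THEN iffD2] mult_left_mono) auto
  qed
  finally show ?thesis by (simp add: k_def mult.commute)
qed

text \<open>Only \<open>steady\<close> prefixes precede the crossing, so a negative \<open>d\<close>
  is admissible; the quadratic lower bound on \<open>ln (1 + \<rho>)\<close> gives the same rate as
  for low averages.\<close>

lemma ex_high_crosses:
  assumes t: "s \<le> t" "t < T"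
  shows "pr t (\<lambda>h. crosses steady (\<lambda>h. (1 + 9 / 10 * L) powr (- ((b $ i + L) * (real T - real t))) *
    tilt (- (9 / 10 * L * (real T - real t))) i h) s h) \<le> exp (- (2 / 5 * L\<^sup>2) * (real T - real t))"
proof -
  define k where "k = real T - real t"
  define \<rho> where "\<rho> = 9 / 10 * L"
  have k: "0 < k" using t by (simp add: k_def)
  have \<rho>: "0 \<le> \<rho>" using L_pos by (auto simp: \<rho>_def)
  have "pr t (\<lambda>h. crosses steady (\<lambda>h. (1 + \<rho>) powr (- ((b $ i + L) * k)) * tilt (- (\<rho> * k)) i h) s h)
    \<le> (1 + \<rho>) powr (- ((b $ i + L) * k)) * exp (- (- (\<rho> * k)) * b $ i + 2 * \<bar>- (\<rho> * k)\<bar> * \<eta>)"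
    using t \<rho> k by (intro ex_crosses_tilt) (auto simp: admissible_def steady_def)
  also have "\<dots> = exp (k * (\<rho> * (b $ i + 2 * \<eta>) - (b $ i + L) * ln (1 + \<rho>)))"
    using \<rho> k by (simp add: powr_def exp_add[symmetric] algebra_simps)
  also have "\<dots> \<le> exp (k * (- (2 / 5 * L\<^sup>2)))"
  proof -
    have b2: "0 \<le> b $ i + L" "b $ i + L \<le> 1" using b_ge[of i] b_le[of i] L_pos by linarith+
    have "\<rho> * (b $ i + 2 * \<eta>) - (b $ i + L) * ln (1 + \<rho>) \<le> \<rho> * (b $ i + 2 * \<eta>) - (b $ i + L) * (\<rho> - \<rho>\<^sup>2 / 2)"
      using ln_one_plus_ge_quadratic[OF \<rho>] b2 by (intro diff_left_mono mult_left_mono) auto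
    also have "\<dots> = - (\<rho> * (L - 2 * \<eta>)) + \<rho>\<^sup>2 / 2 * (b $ i + L)" by (simp add: algebra_simps)
    also have "\<dots> \<le> - (\<rho> * \<rho>) + \<rho>\<^sup>2 / 2 * 1"
      using b2 \<rho> \<eta> by (intro add_mono le_imp_neg_le mult_left_mono) (auto simp: \<rho>_def)
    also have "\<dots> = - (81 / 200 * L\<^sup>2)" by (simp add: \<rho>_def power2_eq_square)
    also have "\<dots> \<le> - (2 / 5 * L\<^sup>2)" by simp
    finally show ?thesis using k by (intro exp_le_cancel_iff[THEN iffD2] mult_left_mono) auto
  qed
  finally show ?thesis by (simp add: k_def \<rho>_def mult.commute)
qed

text \<open>The first prefix that is not \<open>steady\<close> has atypical frequencies, a depleted
  resource or an average off by more than \<open>L\<close>. All earlier ones are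
  \<open>steady\<close>, so the crossing bounds apply for both signs of \<open>d\<close>.\<close>

lemma ex_not_steady:
  assumes t: "s \<le> t" "t < T"
  shows "pr t (\<lambda>h. \<not> always steady s h) \<le> \<epsilon>0 + CARD('m) *
    (2 * exp (- (9 / 20 * L) * (real T - real t)) + 2 * exp (- (2 / 5 * L\<^sup>2) * (real T - real t)))"
proof -
  define \<rho> where "\<rho> = 1 - exp (- (9 / 10 * L))"
  let ?k = "real T - real t"
  let ?W1 = "\<lambda>i h. crosses steady (\<lambda>h. 2 * tilt (?k / 2) i h) s h"
  let ?W2 = "\<lambda>i h. crosses steady (\<lambda>h. (1 - \<rho>) powr (- ((b $ i - L) * ?k)) * tilt (\<rho> * ?k) i h) s h"
  let ?W3 = "\<lambda>i h. crosses steady (\<lambda>h. (1 + 9 / 10 * L) powr (- ((b $ i + L) * ?k)) * tilt (- (9 / 10 * L * ?k)) i h) s h"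
  have st: "tracking h" if "steady h" for h using that by (simp add: steady_def)
  have "pr t (\<lambda>h. \<not> always steady s h) \<le>
    ex t (\<lambda>h. of_bool (strays h) + (\<Sum>i\<in>UNIV. of_bool (?W1 i h) + of_bool (?W2 i h) + of_bool (?W3 i h)))"
  proof (rule ex_mono)
    fix h assume h: "h \<in> set_pmf (law t)"
    have len: "length h = t" by (rule length_run[OF h])
    have "of_bool (\<not> always steady s h) \<le> of_bool (strays h) + (\<Sum>i\<in>UNIV. of_bool (?W1 i h \<or> ?W2 i h \<or> ?W3 i h) :: real)"
    proof (rule of_bool_le_sum)
      assume "\<not> always steady s h"
      then obtain r where r: "s \<le> r" "r \<le> length h" "\<not> steady (take r h)" "\<And>q. s \<le> q \<Longrightarrow> q < r \<Longrightarrow> steady (take q h)"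
        by (rule not_always_first) blast
      have rt: "r \<le> t" using r len by simp
      show "strays h \<or> (\<exists>i. ?W1 i h \<or> ?W2 i h \<or> ?W3 i h)"
      proof (cases "typical (take r h)")
        case False
        then show ?thesis using r by (auto simp: strays_def)
      next
        case True
        show ?thesis
        proof (cases "alive (take r h)")
          case False
          then obtain i where "rem (take r h) $ i \<le> 1" by (auto simp: alive_def not_less)
          then have "?W1 i h" using r rt t by (intro death_crosses) auto
          then show ?thesis by blast
        next
          case alive: True
          then obtain i where "\<not> \<bar>avg (take r h) $ i - b $ i\<bar> \<le> L"
            using r(3) True by (auto simp: steady_def tracking_def)
          then consider "avg (take r h) $ i < b $ i - L" | "b $ i + L < avg (take r h) $ i" by linarith
          then show ?thesis
          proof cases
            case 1
            have "?W2 i h" using r rt t 1 L_pos by (intro low_crosses) (auto simp: \<rho>_def)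
            then show ?thesis by blast
          next
            case 2
            have "?W3 i h" using r rt t 2 L_pos by (intro high_crosses) auto
            then show ?thesis by blast
          qed
        qed
      qed
    qed
    also have "\<dots> \<le> of_bool (strays h) + (\<Sum>i\<in>UNIV. of_bool (?W1 i h) + of_bool (?W2 i h) + of_bool (?W3 i h))"
      by (intro add_left_mono sum_mono) auto
    finally show "of_bool (\<not> always steady s h) \<le> of_bool (strays h) + (\<Sum>i\<in>UNIV. of_bool (?W1 i h) + of_bool (?W2 i h) + of_bool (?W3 i h) :: real)" .
  qed
  also have "\<dots> \<le> \<epsilon>0 + (\<Sum>i\<in>(UNIV :: 'm set). 2 * exp (- (9 / 20 * L) * ?k) + exp (- (2 / 5 * L\<^sup>2) * ?k) + exp (- (2 / 5 * L\<^sup>2) * ?k))"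
    unfolding ex_add ex_sum \<rho>_def using t st
    by (intro add_mono ex_strays sum_mono ex_death_crosses ex_low_crosses ex_high_crosses) auto
  finally show ?thesis by (simp add: add.commute)
qed

end

section \<open>Sums over the periods left, and capacity shortages after the cut\<close>

lemma sum_remaining_periods:
  assumes "s \<le> T"
  shows "(\<Sum>t\<in>{s..<T}. f (real T - real t)) = (\<Sum>k = 1..T - s. f (real k))"
  by (rule sum.reindex_bij_witness[of _ "\<lambda>k. T - k" "\<lambda>t. T - t"])
     (use assms in \<open>auto simp: of_nat_diff\<close>)

context late_phase
begin

text \<open>By \<open>slack\<close> and the bound on \<open>CARD('n) * e\<close>, the profitable
  types together need at most \<open>b $ i - L\<close> per period in a typical state. Contrary to
  \<open>early_shortage\<close>, frequencies are reliable here and the capacity is random.\<close>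

definition late_shortage :: "'m \<Rightarrow> 'n history \<Rightarrow> real" where
  "late_shortage i h = max 0 (1 - avg h $ i / (b $ i - L))"

abbreviation mean_shortage :: "'m \<Rightarrow> nat \<Rightarrow> real" where
  "mean_shortage i t \<equiv> ex t (\<lambda>h. of_bool (always tracking s h) * late_shortage i h)"

text \<open>The counterpart of the estimate in \<open>sum_ex_early_shortage\<close>, with the tilt
  in the role of the moment generating function. The powers of \<open>b $ i - 2 * \<eta>\<close> in
  the prefactor and in the rate cancel upon summation.\<close>

lemma ex_late_shortage:
  assumes t: "s \<le> t" "t < T" and b2: "2 * L \<le> b $ i" and k1: "1 \<le> (b $ i - 2 * \<eta>) * (real T - real t)"
  shows "mean_shortage i t \<le>
    (sqrt 2 / sqrt (b $ i - 2 * \<eta>)) / sqrt (real T - real t) *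
    exp (- ((L - 2 * \<eta>)\<^sup>2 / (2 * (b $ i - 2 * \<eta>))) * (real T - real t))"
proof -
  define k where "k = real T - real t"
  define \<beta> where "\<beta> = b $ i - 2 * \<eta>"
  define \<delta> where "\<delta> = L - 2 * \<eta>"
  define D where "D = b $ i - L"
  \<comment> \<open>As before, \<open>\<delta> / \<beta>\<close> minimises the bound on the exponent
    and \<open>r\<close> raises it by exactly 1, the amount saved by \<open>le_exp_div\<close>; the
    quadratic term is now \<open>\<gamma>\<^sup>2 * \<beta> / 2\<close>, whence the 2 under the
    root.\<close>
  define r where "r = sqrt (2 * \<beta> / k)"
  define \<gamma> where "\<gamma> = (\<delta> + r) / \<beta>"
  define \<rho> where "\<rho> = 1 - exp (- \<gamma>)"
  have k: "0 < k" using t by (simp add: k_def)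
  have \<beta>: "19 / 10 * L \<le> \<beta>" "0 < \<beta>" "\<beta> \<le> 1" using b2 \<eta> L_pos b_le[of i] by (auto simp: \<beta>_def)
  have \<delta>: "0 < \<delta>" "\<delta> \<le> L" "\<delta> = \<beta> - D" using \<eta> L_pos by (auto simp: \<delta>_def \<beta>_def D_def)
  have D: "0 < D" "\<beta> / 2 \<le> D" using b2 \<eta> L_pos by (auto simp: \<beta>_def D_def)
  have r: "0 < r" "r\<^sup>2 = 2 * \<beta> / k" using \<beta> k by (auto simp: r_def)
  \<comment> \<open>This ensures \<open>\<rho> <= 7 / 8\<close>, as \<open>exp 2 < 8\<close>. The 2
    splits into \<open>142 / 100\<close>, above \<open>sqrt 2\<close>, for
    \<open>r / \<beta>\<close> and \<open>58 / 100\<close>, above \<open>10 / 19\<close>, for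
    \<open>\<delta> / \<beta>\<close>.\<close>
  have \<gamma>: "0 < \<gamma>" "\<gamma> \<le> 2"
  proof -
    show "0 < \<gamma>" using \<delta> r \<beta> by (simp add: \<gamma>_def)
    have "1 / k \<le> \<beta>" using k1 k by (simp add: \<beta>_def k_def divide_le_eq)
    then have "r\<^sup>2 \<le> 2 * \<beta> * \<beta>"
      unfolding r(2) using \<beta> mult_left_mono[of "1 / k" \<beta> "2 * \<beta>"] by simp
    also have "\<dots> \<le> (142 / 100 * \<beta>)\<^sup>2" by (simp add: power2_eq_square)
    finally have "r \<le> 142 / 100 * \<beta>" using \<beta> by (rule_tac power2_le_imp_le) auto
    moreover have "\<delta> \<le> 58 / 100 * \<beta>" using \<delta> \<beta> L_pos by linarith
    ultimately show "\<gamma> \<le> 2" using \<beta> by (simp add: \<gamma>_def divide_le_eq)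
  qed
  have \<rho>: "0 \<le> \<rho>" "\<rho> \<le> 7 / 8" "1 - \<rho> = exp (- \<gamma>)" "\<gamma> - \<gamma>\<^sup>2 / 2 \<le> \<rho>"
  proof -
    show "0 \<le> \<rho>" using \<gamma> by (simp add: \<rho>_def)
    have "exp \<gamma> \<le> exp 2" using \<gamma> by simp
    also have "exp (2 :: real) = exp 1 * exp 1" by (simp flip: exp_add)
    also have "\<dots> \<le> (28 / 10) * (28 / 10)" using exp_le e_less_272 by (intro mult_mono) auto
    also have "\<dots> \<le> 8" by simp
    finally have "1 / 8 \<le> exp (- \<gamma>)" by (simp add: exp_minus field_simps)
    then show "\<rho> \<le> 7 / 8" by (simp add: \<rho>_def)
    show "1 - \<rho> = exp (- \<gamma>)" by (simp add: \<rho>_def)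
    show "\<gamma> - \<gamma>\<^sup>2 / 2 \<le> \<rho>" using exp_minus_le_quadratic[of \<gamma>] \<gamma> by (simp add: \<rho>_def)
  qed
  have "mean_shortage i t \<le>
    ex t (\<lambda>h. exp (\<gamma> * D * k - 1) / (\<gamma> * D * k) * (of_bool (always tracking s h) * tilt (\<rho> * k) i h))"
  proof (rule ex_mono)
    fix h assume h: "h \<in> set_pmf (law t)"
    have len: "length h = t" by (rule length_run[OF h])
    have "rem h $ i = k * avg h $ i" using rem_eq_avg[of h i] len t by (simp add: k_def)
    then have "(1 - \<rho> * k / k) powr (rem h $ i) = exp (- \<gamma> * k * avg h $ i)"
      using k \<rho>(3) by (simp add: powr_def)
    then have ti: "exp (- \<gamma> * k * avg h $ i) \<le> tilt (\<rho> * k) i h"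
      using tilt_ge[of "\<rho> * k" h i] len by (simp add: k_def)
    have "late_shortage i h \<le> exp (\<gamma> * D * k * (1 - avg h $ i / D) - 1) / (\<gamma> * D * k)"
      using le_exp_div[of "\<gamma> * D * k" "1 - avg h $ i / D"] \<gamma> D k by (simp add: late_shortage_def D_def)
    also have "\<dots> = exp (\<gamma> * D * k - 1) / (\<gamma> * D * k) * exp (- \<gamma> * k * avg h $ i)"
    proof -
      have "\<gamma> * D * k * (1 - avg h $ i / D) = \<gamma> * D * k - \<gamma> * k * avg h $ i"
        using D by (simp add: field_simps)
      then show ?thesis by (simp add: exp_add[symmetric])
    qed
    also have "\<dots> \<le> exp (\<gamma> * D * k - 1) / (\<gamma> * D * k) * tilt (\<rho> * k) i h"
      using ti \<gamma> D k by (intro mult_left_mono) auto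
    finally show "of_bool (always tracking s h) * late_shortage i h \<le>
      exp (\<gamma> * D * k - 1) / (\<gamma> * D * k) * (of_bool (always tracking s h) * tilt (\<rho> * k) i h)"
      by auto
  qed
  also have "\<dots> \<le> exp (\<gamma> * D * k - 1) / (\<gamma> * D * k) * exp (- (\<rho> * k) * b $ i + 2 * \<bar>\<rho> * k\<bar> * \<eta>)"
    unfolding ex_cmult
  proof (intro mult_left_mono ex_always_tilt)
    have "\<rho> * k \<le> 7 / 8 * k" using \<rho> k by (intro mult_right_mono) auto
    then show "admissible tracking t (\<rho> * k)" using t \<rho> k by (simp add: admissible_def k_def)
  qed (use \<gamma> D k in auto)
  also have "\<dots> = exp (k * (\<gamma> * D - \<rho> * \<beta>) - 1) / (\<gamma> * D * k)"
    using \<rho> k by (simp add: exp_add[symmetric] \<beta>_def algebra_simps)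
  also have "\<dots> \<le> exp (- (\<delta>\<^sup>2 / (2 * \<beta>)) * k) / (\<gamma> * D * k)"
  proof (intro divide_right_mono)
    have "\<gamma> * D - \<rho> * \<beta> \<le> \<gamma> * D - (\<gamma> - \<gamma>\<^sup>2 / 2) * \<beta>"
      using \<rho>(4) \<beta> by (intro diff_left_mono mult_right_mono) auto
    also have "\<dots> = - \<gamma> * \<delta> + \<gamma>\<^sup>2 * \<beta> / 2" by (simp add: \<delta>(3) algebra_simps)
    also have "\<dots> = (r\<^sup>2 - \<delta>\<^sup>2) / (2 * \<beta>)"
      using \<beta> by (simp add: \<gamma>_def field_simps power2_eq_square)
    also have "\<dots> = 1 / k - \<delta>\<^sup>2 / (2 * \<beta>)" unfolding r(2) using \<beta> k by (simp add: diff_divide_distrib)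
    finally have "k * (\<gamma> * D - \<rho> * \<beta>) \<le> k * (1 / k - \<delta>\<^sup>2 / (2 * \<beta>))" using k by (intro mult_left_mono) auto
    then show "exp (k * (\<gamma> * D - \<rho> * \<beta>) - 1) \<le> exp (- (\<delta>\<^sup>2 / (2 * \<beta>)) * k)"
      using k by (simp add: right_diff_distrib mult.commute)
  qed (use \<gamma> D k in auto)
  also have "\<dots> \<le> exp (- (\<delta>\<^sup>2 / (2 * \<beta>)) * k) / (r / \<beta> * (\<beta> / 2) * k)"
  proof (intro divide_left_mono mult_right_mono mult_mono)
    show "r / \<beta> \<le> \<gamma>" using \<delta> \<beta> by (simp add: \<gamma>_def divide_right_mono)
  qed (use \<gamma> D k r \<beta> in auto)
  also have "r / \<beta> * (\<beta> / 2) * k = sqrt \<beta> * sqrt k / sqrt 2"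
  proof -
    have "r / \<beta> * (\<beta> / 2) * k = sqrt \<beta> * (sqrt 2 / 2) * (k / sqrt k)"
      using \<beta> by (simp add: r_def real_sqrt_divide real_sqrt_mult mult.commute)
    also have "k / sqrt k = sqrt k" using k by (simp add: real_div_sqrt)
    also have "sqrt 2 / 2 = 1 / sqrt 2" by (simp add: sqrt_divide_self_eq inverse_eq_divide)
    finally show ?thesis by simp
  qed
  finally show ?thesis by (simp add: k_def \<beta>_def \<delta>_def field_simps)
qed

lemma late_shortage_bounds:
  assumes "alive h" "length h < T" "0 < b $ i - L"
  shows "0 \<le> late_shortage i h" "late_shortage i h \<le> 1"
proof -
  have "0 < avg h $ i"
    using assms(1,2) unfolding alive_def average_remaining_def
    by (auto intro!: mult_pos_pos divide_pos_pos intro: less_trans[OF zero_less_one])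
  then show "0 \<le> late_shortage i h" "late_shortage i h \<le> 1" using assms(3) by (auto simp: late_shortage_def)
qed

lemma sum_ex_late_shortage:
  assumes b2: "2 * L \<le> b $ i"
  shows "(\<Sum>t\<in>{s..<T}. mean_shortage i t) \<le> 61 / 10 / L"
proof -
  define \<beta> where "\<beta> = b $ i - 2 * \<eta>"
  define \<delta> where "\<delta> = L - 2 * \<eta>"
  define a where "a = \<delta>\<^sup>2 / (2 * \<beta>)"
  have \<beta>: "19 / 10 * L \<le> \<beta>" "0 < \<beta>" "\<beta> \<le> 1" using b2 \<eta> L_pos b_le[of i] by (auto simp: \<beta>_def)
  have \<delta>: "9 / 10 * L \<le> \<delta>" "0 < \<delta>" "\<delta> \<le> \<beta> / 2" using \<eta> L_pos b2 by (auto simp: \<delta>_def \<beta>_def)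
  define f where "f k = of_bool (\<beta> * k < 1) + (sqrt 2 / sqrt \<beta>) / sqrt k * exp (- a * k)" for k :: real
  have "(\<Sum>t\<in>{s..<T}. mean_shortage i t) \<le> (\<Sum>t\<in>{s..<T}. f (real T - real t))"
  proof (rule sum_mono)
    fix t assume "t \<in> {s..<T}"
    then have t: "s \<le> t" "t < T" by auto
    show "mean_shortage i t \<le> f (real T - real t)"
    proof (cases "\<beta> * (real T - real t) < 1")
      case True
      have "mean_shortage i t \<le> 1"
      proof (rule ex_le_const)
        fix h assume h: "h \<in> set_pmf (law t)"
        have len: "length h = t" by (rule length_run[OF h])
        show "of_bool (always tracking s h) * late_shortage i h \<le> 1"
        proof (cases "always tracking s h")
          case True
          then have "tracking (take (length h) h)" using t len unfolding always_def by blast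
          then have "alive h" by (simp add: tracking_def)
          then show ?thesis using late_shortage_bounds(2)[of h i] len t b2 L_pos True by simp
        qed simp
      qed
      then show ?thesis using True \<beta> t by (simp add: f_def add_increasing2)
    next
      case False
      then show ?thesis
        using ex_late_shortage[OF t b2] by (simp add: f_def \<beta>_def \<delta>_def a_def)
    qed
  qed
  also have "\<dots> = (\<Sum>k = 1..T - s. f (real k))" using s by (intro sum_remaining_periods) auto
  also have "\<dots> \<le> 1 / \<beta> + 5 / 2 * (sqrt 2 / sqrt \<beta>) / sqrt a"
    unfolding f_def sum.distrib
  proof (intro add_mono sum_of_bool_less_le sum_exp_div_sqrt_le)
    show "0 < a" using \<delta> \<beta> by (simp add: a_def)
    have "\<delta>\<^sup>2 \<le> (\<beta> / 2) * (1 / 2)" unfolding power2_eq_square using \<delta> \<beta> by (intro mult_mono) auto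
    then show "a \<le> 1 / 4" using \<beta> by (simp add: a_def field_simps)
  qed (use \<beta> in auto)
  also have "sqrt a = \<delta> / (sqrt 2 * sqrt \<beta>)" using \<delta> by (simp add: a_def real_sqrt_divide real_sqrt_mult)
  also have "5 / 2 * (sqrt 2 / sqrt \<beta>) / (\<delta> / (sqrt 2 * sqrt \<beta>)) = 5 / \<delta>" using \<beta> by simp
  also have "1 / \<beta> + 5 / \<delta> \<le> 1 / (19 / 10 * L) + 5 / (9 / 10 * L)"
    using \<delta> \<beta> L_pos by (intro add_mono divide_left_mono) auto
  also have "\<dots> \<le> 61 / 10 / L" using L_pos by (simp add: field_simps)
  finally show ?thesis .
qed

text \<open>Steady histories lose nothing and straying ones at most \<open>\<Lambda> + 1\<close>.
  The others, while alive, are tracking, and \<open>loss_shortage\<close> gives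
  \<open>2 * \<Lambda>\<close> plus the shortages plus a deviation of at most
  \<open>CARD('n) * e <= L <= \<Lambda>\<close>, whence \<open>3 * \<Lambda>\<close>.\<close>

lemma late_loss_step:
  assumes t: "s \<le> t" "t < T"
  shows "mean_loss t \<le> 3 * \<Lambda> * pr t (\<lambda>h. \<not> always steady s h) +
    profitable * (\<Sum>i\<in>UNIV. mean_shortage i t) + (\<Lambda> + 1) * \<epsilon>0"
proof -
  have "mean_loss t \<le> ex t (\<lambda>h. 3 * \<Lambda> * of_bool (\<not> always steady s h) +
    profitable * (\<Sum>i\<in>UNIV. of_bool (always tracking s h) * late_shortage i h) + (\<Lambda> + 1) * of_bool (strays h))"
  proof (rule ex_mono)
    fix h assume h: "h \<in> set_pmf (law t)"
    have len: "length h = t" by (rule length_run[OF h])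
    have h0: "h \<noteq> []" "length h < T" using len t s by auto
    have sh: "0 \<le> profitable * (\<Sum>i\<in>UNIV. of_bool (always tracking s h) * late_shortage i h)"
      by (intro mult_nonneg_nonneg sum_nonneg) (auto simp: late_shortage_def)
    show "of_bool (alive h) * loss (dec h) \<le> 3 * \<Lambda> * of_bool (\<not> always steady s h) +
      profitable * (\<Sum>i\<in>UNIV. of_bool (always tracking s h) * late_shortage i h) + (\<Lambda> + 1) * of_bool (strays h)"
    proof (cases "alive h")
      case False
      then show ?thesis using sh \<Lambda>_pos by (simp add: add_nonneg_nonneg)
    next
      case al: True
      note opt = optimal_dec[OF al h0]
      consider "always steady s h" | "\<not> always steady s h" "strays h" | "\<not> always steady s h" "\<not> strays h" by blast
      then show ?thesis
      proof cases
        case 1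
        then have "steady (take (length h) h)" using t len unfolding always_def by blast
        then have st: "typical h" "\<And>i. \<bar>avg h $ i - b $ i\<bar> \<le> L" by (auto simp: steady_def tracking_def)
        then have "\<bar>empirical h j - pmf P j\<bar> < L" for j using e(2) by (meson typical_def le_less_trans)
        then have "loss (dec h) = 0" using st(2) by (intro loss_stable(1)[OF _ _ opt])
        then show ?thesis using sh \<Lambda>_pos 1 by (simp add: add_nonneg_nonneg)
      next
        case 2
        have "loss (dec h) \<le> \<Lambda> + 1"
          using loss_le[of "dec h"] dec_bounds[OF al h0(2)] \<Gamma>_bounds by simp
        then show ?thesis using 2 sh al \<Lambda>_pos by (simp add: add_increasing)
      next
        case 3
        then have ty: "typical (take q h)" if "s \<le> q" "q \<le> length h" for q using that by (auto simp: strays_def)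
        then have tyh: "typical h" using ty[of "length h"] t len by simp
        \<comment> \<open>Being alive at the end implies being alive throughout, as capacities never
          grow.\<close>
        have tr: "always tracking s h"
          using ty al alive_take unfolding always_def tracking_def by blast
        have avg0: "0 \<le> avg h $ i" for i
        proof -
          have "1 < rem h $ i" using al by (simp add: alive_def)
          then show ?thesis using h0(2) by (simp add: average_remaining_def)
        qed
        have short: "(1 - late_shortage i h) * full_use (empirical h) i \<le> avg h $ i" for i
        proof (cases "\<exists>j. 0 < g j")
          case False
          then show ?thesis using avg0 by (simp add: full_use_def)
        next
          case True
          then obtain j where "0 < g j" by blast
          from slack[OF this, of i] have full: "full_use (pmf P) i + 2 * L \<le> b $ i" by (simp add: full_use_def)
          have "\<bar>(\<Sum>j\<in>UNIV. pmf P j * (of_bool (0 < g j) * c j $ i)) - (\<Sum>j\<in>UNIV. empirical h j * (of_bool (0 < g j) * c j $ i))\<bar> \<le> CARD('n) * e"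
            using bounds(3,4) by (intro mean_use_close[OF tyh]) auto
          then have "full_use (empirical h) i \<le> full_use (pmf P) i + CARD('n) * e"
            by (simp add: full_use_altdef mult.left_commute abs_le_iff)
          then have De: "full_use (empirical h) i \<le> b $ i - L" using full e(3) by linarith
          have e0: "0 \<le> full_use (empirical h) i" by (intro full_use_nonneg empirical_nonneg)
          have e1: "0 \<le> full_use (pmf P) i" by (intro full_use_nonneg) simp
          have D: "0 < b $ i - L" using full e1 L_pos by linarith
          show ?thesis
          proof (cases "avg h $ i \<le> b $ i - L")
            case True
            then have "1 - late_shortage i h = avg h $ i / (b $ i - L)"
              using D avg0[of i] by (simp add: late_shortage_def)
            then show ?thesis
              using De D avg0[of i] mult_left_mono[OF De avg0[of i]] by (simp add: divide_le_eq)
          next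
            case False
            then have "late_shortage i h = 0" using D by (simp add: late_shortage_def)
            then show ?thesis using De False by simp
          qed
        qed
        have "loss (dec h) \<le> 2 * \<Lambda> + profitable * (\<Sum>i\<in>UNIV. late_shortage i h) + (\<Sum>j\<in>UNIV. \<bar>pmf P j - empirical h j\<bar>)"
          using short by (intro loss_shortage[OF _ _ opt] empirical_nonneg sum_empirical h0(1) avg0) (auto simp: late_shortage_def)
        also have "(\<Sum>j\<in>UNIV. \<bar>pmf P j - empirical h j\<bar>) \<le> \<Lambda>"
          using typical_deviation[OF tyh] e(3) L_le_\<Lambda> by linarith
        finally show ?thesis using 3 tr al by simp
      qed
    qed
  qed
  also have "\<dots> = 3 * \<Lambda> * pr t (\<lambda>h. \<not> always steady s h) +
    profitable * (\<Sum>i\<in>UNIV. mean_shortage i t) + (\<Lambda> + 1) * pr t strays"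
    unfolding ex_add ex_cmult ex_sum ..
  also have "\<dots> \<le> 3 * \<Lambda> * pr t (\<lambda>h. \<not> always steady s h) +
    profitable * (\<Sum>i\<in>UNIV. mean_shortage i t) + (\<Lambda> + 1) * \<epsilon>0"
    using ex_strays[OF t(2)] \<Lambda>_pos by (intro add_left_mono mult_left_mono) auto
  finally show ?thesis .
qed

text \<open>In a steady state the average is at most \<open>b $ i + L <= 1\<close>, so no more units
  than periods are left. Capacity never grows while the number of periods left falls by one each
  time, so every unsteady period adds at most one unit to the surplus; the \<open>1 +\<close>
  absorbs the period after the last steady state.\<close>

lemma final_capacity:
  "ex T (\<lambda>h. rem h \<bullet> lam) \<le> \<Lambda> * (1 + (\<Sum>t\<in>{s..<T}. pr t (\<lambda>h. \<not> always steady s h)))"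
proof -
  define N where "N h r = (\<Sum>t\<in>{s..<r}. of_bool (\<not> always steady s (take t h)) :: real)" for h r
  have pw: "rem h $ i \<le> 1 + N h T" if h: "h \<in> set_pmf (law T)" for h i
  proof -
    have len: "length h = T" by (rule length_run[OF h])
    have "rem (take r h) $ i \<le> real T - real r + 1 + N h r" if "s \<le> r" "r \<le> T" for r
      using that
    proof (induction r rule: dec_induct)
      case base
      have "\<bar>avg (take s h) $ i - b $ i\<bar> \<le> \<eta>"
        using early_state(1)[OF s(2-4) \<eta>(2), of "take s h" i] by simp
      then have "avg (take s h) $ i \<le> 1" using b_le[of i] \<eta> L_pos by linarith
      moreover have "rem (take s h) $ i = (real T - real s) * avg (take s h) $ i"
        using rem_eq_avg[of "take s h" i] len s by simp
      ultimately have "rem (take s h) $ i \<le> real T - real s"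
        using s mult_left_le[of "avg (take s h) $ i" "real T - real s"] by simp
      then show ?case by (simp add: N_def)
    next
      case (step r)
      have r: "r < T" using step by simp
      have le: "rem (take (Suc r) h) $ i \<le> rem (take r h) $ i"
        using bounds(3) by (intro remaining_take_antimono) auto
      have N: "N h (Suc r) = N h r + of_bool (\<not> always steady s (take r h))"
        using step by (simp add: N_def)
      have N0: "0 \<le> N h r" by (simp add: N_def sum_nonneg)
      show ?case
      proof (cases "always steady s (take r h)")
        case False
        then show ?thesis using step r le N by simp
      next
        case True
        then have "steady (take (length (take r h)) (take r h))"
          using step len unfolding always_def by (metis length_take min.absorb2 order_refl less_imp_le r)
        then have "steady (take r h)" using len r by simp
        then have "avg (take r h) $ i \<le> b $ i + L"
          unfolding steady_def by (metis abs_le_D1 diff_le_eq add.commute)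
        then have "avg (take r h) $ i \<le> 1" using b_le[of i] by linarith
        moreover have "rem (take r h) $ i = (real T - real r) * avg (take r h) $ i"
          using rem_eq_avg[of "take r h" i] len r by simp
        ultimately have "rem (take r h) $ i \<le> real T - real r"
          using r mult_left_le[of "avg (take r h) $ i" "real T - real r"] by simp
        then show ?thesis using le N N0 by simp
      qed
    qed
    from this[of T] show ?thesis using s len by simp
  qed
  have "ex T (\<lambda>h. rem h \<bullet> lam) \<le> ex T (\<lambda>h. \<Lambda> * (1 + N h T))"
  proof (rule ex_mono)
    fix h assume h: "h \<in> set_pmf (law T)"
    have "rem h \<bullet> lam \<le> (\<Sum>i\<in>UNIV. (1 + N h T) * lam $ i)"
      unfolding inner_vec_def inner_real_def using pw[OF h] lam_pos by (intro sum_mono mult_right_mono) (auto intro: less_imp_le)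
    also have "\<dots> = \<Lambda> * (1 + N h T)" unfolding sum_distrib_left[symmetric] \<Lambda>_def by (rule mult.commute)
    finally show "rem h \<bullet> lam \<le> \<Lambda> * (1 + N h T)" .
  qed
  also have "\<dots> = \<Lambda> * (1 + (\<Sum>t\<in>{s..<T}. pr T (\<lambda>h. \<not> always steady s (take t h))))"
    unfolding ex_cmult N_def ex_add ex_sum ex_const ..
  also have "(\<Sum>t\<in>{s..<T}. pr T (\<lambda>h. \<not> always steady s (take t h))) = (\<Sum>t\<in>{s..<T}. pr t (\<lambda>h. \<not> always steady s h))"
    by (intro sum.cong refl ex_take[of _ T "\<lambda>h. of_bool (\<not> always steady s h)"]) auto
  finally show ?thesis .
qed

section \<open>Summation over the periods and assembly of the constants\<close>

lemma sum_ex_dead: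
  "(\<Sum>t<T. pr t (\<lambda>h. \<not> alive h)) \<le> T * \<epsilon>0 + 40 / 9 * CARD('m) / L"
proof -
  have "(\<Sum>t<T. pr t (\<lambda>h. \<not> alive h)) = (\<Sum>t\<in>{s..<T}. pr t (\<lambda>h. \<not> alive h))"
  proof (rule sum.mono_neutral_right)
    show "\<forall>t\<in>{..<T} - {s..<T}. pr t (\<lambda>h. \<not> alive h) = 0"
    proof
      fix t assume "t \<in> {..<T} - {s..<T}"
      then have "pr t (\<lambda>h. \<not> alive h) = ex t (\<lambda>h. 0)"
        by (intro ex_cong) (auto intro!: alive_start simp: length_run)
      then show "pr t (\<lambda>h. \<not> alive h) = 0" by (simp add: ex_const)
    qed
  qed auto
  also have "\<dots> \<le> (\<Sum>t\<in>{s..<T}. \<epsilon>0 + 2 * CARD('m) * exp (- (9 / 20 * L) * (real T - real t)))"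
    by (intro sum_mono ex_dead) auto
  also have "\<dots> = (\<Sum>k = 1..T - s. \<epsilon>0 + 2 * CARD('m) * exp (- (9 / 20 * L) * real k))"
    using s by (intro sum_remaining_periods) auto
  also have "\<dots> = real (T - s) * \<epsilon>0 + 2 * CARD('m) * (\<Sum>k = 1..T - s. exp (- (9 / 20 * L) * real k))"
    by (simp add: sum.distrib sum_distrib_left)
  also have "\<dots> \<le> real T * \<epsilon>0 + 2 * CARD('m) * (1 / (9 / 20 * L))"
    using L_pos \<epsilon>0_nonneg by (intro add_mono mult_mono mult_left_mono sum_exp_le) auto
  finally show ?thesis by (simp add: mult.commute)
qed

lemma sum_ex_not_steady:
  "(\<Sum>t\<in>{s..<T}. pr t (\<lambda>h. \<not> always steady s h)) \<le> T * \<epsilon>0 + CARD('m) * (40 / 9 / L + 5 / L\<^sup>2)"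
proof -
  have "(\<Sum>t\<in>{s..<T}. pr t (\<lambda>h. \<not> always steady s h)) \<le> (\<Sum>t\<in>{s..<T}. \<epsilon>0 + CARD('m) *
    (2 * exp (- (9 / 20 * L) * (real T - real t)) + 2 * exp (- (2 / 5 * L\<^sup>2) * (real T - real t))))"
    by (intro sum_mono ex_not_steady) auto
  also have "\<dots> = (\<Sum>k = 1..T - s. \<epsilon>0 + CARD('m) * (2 * exp (- (9 / 20 * L) * real k) + 2 * exp (- (2 / 5 * L\<^sup>2) * real k)))"
    using s by (intro sum_remaining_periods) auto
  also have "\<dots> = real (T - s) * \<epsilon>0 + CARD('m) * (2 * (\<Sum>k = 1..T - s. exp (- (9 / 20 * L) * real k)) +
      2 * (\<Sum>k = 1..T - s. exp (- (2 / 5 * L\<^sup>2) * real k)))"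
    by (simp add: sum.distrib sum_distrib_left distrib_left)
  also have "\<dots> \<le> real T * \<epsilon>0 + CARD('m) * (2 * (1 / (9 / 20 * L)) + 2 * (1 / (2 / 5 * L\<^sup>2)))"
    using L_pos \<epsilon>0_nonneg by (intro add_mono mult_mono[of "real (T - s)"] mult_left_mono sum_exp_le) auto
  finally show ?thesis by simp
qed

text \<open>All terms are brought to the scale \<open>q = \<Lambda> / L\<^sup>2\<close>: those
  without \<open>\<Lambda>\<close> by \<open>card_L_le_\<Lambda>\<close>, where the lower bound on
  every dual price enters, and those with a lower power of \<open>1 / L\<close> by
  \<open>L_le_half\<close>.\<close>

lemma regret_bound:
  "Regret \<mu> c P b (policy) T \<le>
    (48 * real CARD('m) + 4 * real CARD('n) + 12) * \<Lambda> / L\<^sup>2 + 8 * (\<Lambda> + 1) * (T * \<epsilon>0)"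
proof -
  define n where "n = real CARD('n)"
  define m where "m = real CARD('m)"
  define X where "X = (\<Sum>t\<in>{s..<T}. pr t (\<lambda>h. \<not> always steady s h))"
  define Z where "Z = (\<Sum>t<T. pr t (\<lambda>h. \<not> alive h))"
  define E where "E = T * \<epsilon>0"
  define S where "S = (\<Sum>t\<in>{s..<T}. \<Sum>i\<in>UNIV. mean_shortage i t)"
  have E0: "0 \<le> E" using \<epsilon>0_nonneg by (simp add: E_def)
  have n: "1 \<le> n" "1 \<le> m" by (auto simp: n_def m_def Suc_le_eq)
  have Z: "Z \<le> E + 40 / 9 * m / L" using sum_ex_dead by (simp add: Z_def E_def m_def)
  have X: "X \<le> E + m * (40 / 9 / L + 5 / L\<^sup>2)" using sum_ex_not_steady by (simp add: X_def E_def m_def)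
  have S: "profitable * S \<le> 61 / 10 * m / L"
  proof (cases "\<exists>j. 0 < g j")
    case True
    then obtain j where j: "0 < g j" by blast
    have b2: "2 * L \<le> b $ i" for i
    proof -
      have "0 \<le> full_use (pmf P) i" by (intro full_use_nonneg) simp
      then show ?thesis using slack[OF j, of i] by (simp add: full_use_def)
    qed
    have "S = (\<Sum>i\<in>UNIV. \<Sum>t\<in>{s..<T}. mean_shortage i t)"
      unfolding S_def by (rule sum.swap)
    also have "\<dots> \<le> (\<Sum>i\<in>(UNIV :: 'm set). 61 / 10 / L)"
      using b2 by (intro sum_mono sum_ex_late_shortage)
    finally show ?thesis using True by (simp add: m_def)
  qed (use L_pos n in simp)
  have "(\<Sum>t<T. mean_loss t) =
    (\<Sum>t<s. mean_loss t) + (\<Sum>t\<in>{s..<T}. mean_loss t)"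
    using s by (simp add: lessThan_atLeast0 sum.atLeastLessThan_concat)
  moreover have "(\<Sum>t\<in>{s..<T}. mean_loss t) \<le> 3 * \<Lambda> * X + profitable * S + (\<Lambda> + 1) * E"
  proof -
    have "(\<Sum>t\<in>{s..<T}. mean_loss t) \<le> (\<Sum>t\<in>{s..<T}. 3 * \<Lambda> * pr t (\<lambda>h. \<not> always steady s h) +
      profitable * (\<Sum>i\<in>UNIV. mean_shortage i t) + (\<Lambda> + 1) * \<epsilon>0)"
      by (intro sum_mono late_loss_step) auto
    also have "\<dots> = 3 * \<Lambda> * X + profitable * S + real (T - s) * ((\<Lambda> + 1) * \<epsilon>0)"
      unfolding X_def S_def sum.distrib sum_distrib_left by simp
    also have "real (T - s) * ((\<Lambda> + 1) * \<epsilon>0) \<le> real T * ((\<Lambda> + 1) * \<epsilon>0)"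
      using \<Lambda>_pos \<epsilon>0_nonneg by (intro mult_right_mono) auto
    finally show ?thesis by (simp add: E_def mult_ac)
  qed
  ultimately have loss: "(\<Sum>t<T. mean_loss t) \<le>
    \<Lambda> + 2 * n * \<Lambda> / L\<^sup>2 + 5 * m / L + (171 / 100 * n + 1) / L + (3 * \<Lambda> * X + 61 / 10 * m / L + (\<Lambda> + 1) * E)"
    using early_loss[OF s(2-4) \<eta>] S by (simp add: n_def m_def)
  have Z0: "0 \<le> Z" unfolding Z_def by (intro sum_nonneg ex_nonneg) auto
  have "Regret \<mu> c P b (policy) T \<le> \<Lambda> * (1 + X) + (\<Lambda> + \<Gamma>) * Z +
    (\<Sum>t<T. mean_loss t)"
    using regret_le final_capacity by (simp add: X_def Z_def sum_distrib_left[symmetric])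
  also have "\<dots> \<le> \<Lambda> * (1 + X) + (\<Lambda> + 1) * Z + (\<Lambda> + 2 * n * \<Lambda> / L\<^sup>2 + 5 * m / L + (171 / 100 * n + 1) / L + (3 * \<Lambda> * X + 61 / 10 * m / L + (\<Lambda> + 1) * E))"
    using loss Z0 \<Gamma>_bounds by (intro add_mono[OF add_mono[OF order_refl mult_right_mono]]) auto
  \<comment> \<open>Each unsteady period counts four times: once for leftover capacity and three
    times for its loss.\<close>
  also have "\<dots> = 4 * (\<Lambda> * X) + (\<Lambda> + 1) * Z + (2 * \<Lambda> + 2 * n * \<Lambda> / L\<^sup>2 + 111 / 10 * (m / L) + (171 / 100 * n + 1) / L + (\<Lambda> + 1) * E)"
    by (simp add: algebra_simps)
  also have "\<dots> \<le> 4 * (\<Lambda> * (E + m * (40 / 9 / L + 5 / L\<^sup>2))) + (\<Lambda> + 1) * (E + 40 / 9 * m / L) +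
     (2 * \<Lambda> + 2 * n * \<Lambda> / L\<^sup>2 + 111 / 10 * (m / L) + (171 / 100 * n + 1) / L + (\<Lambda> + 1) * E)"
    using X Z \<Lambda>_pos by (intro add_mono mult_left_mono) auto
  also have "\<dots> = (4 * \<Lambda> + 2 * (\<Lambda> + 1)) * E + (20 * m * (\<Lambda> / L\<^sup>2) + 200 / 9 * m * (\<Lambda> / L) + (40 / 9 + 111 / 10) * (m / L)
     + 2 * \<Lambda> + 2 * n * (\<Lambda> / L\<^sup>2) + (171 / 100 * n + 1) * (1 / L))"
    by (simp add: algebra_simps add_divide_distrib)
  also have "\<dots> \<le> 8 * (\<Lambda> + 1) * E + (48 * m + 4 * n + 12) * (\<Lambda> / L\<^sup>2)"
  proof (rule add_mono)
    show "(4 * \<Lambda> + 2 * (\<Lambda> + 1)) * E \<le> 8 * (\<Lambda> + 1) * E" using E0 \<Lambda>_pos by (intro mult_right_mono) auto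
    define q where "q = \<Lambda> / L\<^sup>2"
    have q0: "0 < q" using \<Lambda>_pos L_pos by (simp add: q_def)
    have L2: "L\<^sup>2 \<le> 1 / 4" using power_mono[OF L_le_half, of 2] L_pos by (simp add: power_divide)
    have 1: "\<Lambda> / L \<le> q / 2"
    proof -
      have "\<Lambda> / L = q * L" using L_pos by (simp add: q_def power2_eq_square)
      also have "\<dots> \<le> q * (1 / 2)" using q0 L_le_half by (intro mult_left_mono) auto
      finally show ?thesis by simp
    qed
    have 2: "m / L \<le> q"
    proof -
      have "m / L = m * L / L\<^sup>2" using L_pos by (simp add: power2_eq_square)
      also have "\<dots> \<le> \<Lambda> / L\<^sup>2" using card_L_le_\<Lambda> by (intro divide_right_mono) (auto simp: m_def)
      finally show ?thesis by (simp add: q_def)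
    qed
    have 3: "1 / L \<le> q"
    proof -
      have "1 / L \<le> m / L" using n L_pos by (intro divide_right_mono) auto
      with 2 show ?thesis by linarith
    qed
    have 4: "\<Lambda> \<le> q / 4"
    proof -
      have "\<Lambda> = q * L\<^sup>2" using L_pos by (simp add: q_def)
      also have "\<dots> \<le> q * (1 / 4)" using q0 L2 by (intro mult_left_mono) auto
      finally show ?thesis by simp
    qed
    have "20 * m * q + 200 / 9 * m * (\<Lambda> / L) + (40 / 9 + 111 / 10) * (m / L) + 2 * \<Lambda> + 2 * n * q + (171 / 100 * n + 1) * (1 / L)
      \<le> 20 * m * q + 200 / 9 * m * (q / 2) + (40 / 9 + 111 / 10) * q + 2 * (q / 4) + 2 * n * q + (171 / 100 * n + 1) * q"
      using 1 2 3 4 n by (intro add_mono mult_left_mono order_refl) auto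
    also have "\<dots> = (280 / 9 * m + 371 / 100 * n + (40 / 9 + 111 / 10 + 3 / 2)) * q" by (simp add: algebra_simps)
    \<comment> \<open>The constant \<open>40 / 9 + 111 / 10 + 3 / 2\<close> exceeds 12; since
      \<open>1 <= m\<close>, the gap between \<open>280 / 9\<close> and 48 covers the
      difference.\<close>
    also have "\<dots> \<le> (48 * m + 4 * n + 12) * q" using n q0 by (intro mult_right_mono) auto
    finally show "20 * m * (\<Lambda> / L\<^sup>2) + 200 / 9 * m * (\<Lambda> / L) + (40 / 9 + 111 / 10) * (m / L)
     + 2 * \<Lambda> + 2 * n * (\<Lambda> / L\<^sup>2) + (171 / 100 * n + 1) * (1 / L) \<le> (48 * m + 4 * n + 12) * (\<Lambda> / L\<^sup>2)"
      by (simp add: q_def)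
  qed
  finally show ?thesis by (simp add: E_def m_def n_def)
qed

end

section \<open>Choice of the cut and of the frequency tolerance\<close>

lemma harm_le_ln: "harm n \<le> 1 + ln (real n)" if "1 \<le> n"
proof -
  have "harm (Suc (n - 1)) - ln (real (Suc (n - 1))) \<le> harm (Suc 0) - ln (real (Suc 0))"
    using decseq_harm_diff_ln by (rule decseqD) simp
  then show ?thesis using that by (simp add: harm_def)
qed

theorem theorem2:
  fixes \<mu> :: "'n::finite \<Rightarrow> real"
    and c :: "'n \<Rightarrow> real^'m::finite"
    and P :: "'n pmf"
    and b :: "real^'m"
    and y_opt z_opt gam_opt :: "real^'n"
    and s_opt lam_opt :: "real^'m"
    and L :: real
    and Y :: "nat \<Rightarrow> 'n history \<Rightarrow> real^'n"
  assumes model: "order_model \<mu> c P b"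
    and nondegenerate:
      "nondegenerate (scaled_reward P \<mu>) (scaled_consumption P c) b y_opt s_opt z_opt"
    and all_binding: "s_opt = 0"
    and dual: "dual_optimal (scaled_reward P \<mu>) (scaled_consumption P c) b lam_opt gam_opt"
    and stability: "stability_constant (scaled_reward P \<mu>) (scaled_consumption P c) b y_opt L"
    and selection: "optimal_selection \<mu> c b Y"
  shows "\<exists>\<epsilon> :: nat \<Rightarrow> real. \<epsilon> \<longlonglongrightarrow> 0 \<and>
    (\<forall>T\<ge>1. Regret \<mu> c P b (adaptive_allocation c b Y T) T
       \<le> (48 * real CARD('m) + 4 * real CARD('n) + 12) * (\<Sum>i\<in>UNIV. \<bar>lam_opt $ i\<bar>) / L\<^sup>2 + \<epsilon> T)"
proof -
  interpret stable_orders \<mu> c P b lam_opt L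
    using stable_orders_intro[OF model _ dual stability] nondegenerate all_binding by simp
  define n where "n = real CARD('n)"
  \<comment> \<open>The exponents make \<open>s / T\<close> and \<open>e * ln T\<close> vanish while
    \<open>e\<^sup>2 * s\<close>, at least \<open>T powr (1 / 4)\<close>, outgrows
    \<open>ln T\<close>, so that the stray probability beats every power of
    \<open>T\<close>.\<close>
  define s where "s T = nat \<lceil>real T powr (3 / 4)\<rceil>" for T :: nat
  define e where "e T = real T powr (- 1 / 4)" for T :: nat
  define bound where "bound = (48 * real CARD('m) + 4 * real CARD('n) + 12) * \<Lambda> / L\<^sup>2"
  define err where "err T = 8 * (\<Lambda> + 1) * (real T * (2 * n * real T * exp (- 2 * real T powr (1 / 4))))" for T :: nat
  define reg where "reg T = Regret \<mu> c P b (adaptive_allocation c b Y T) T" for T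
  have abs_lam: "(\<Sum>i\<in>UNIV. \<bar>lam_opt $ i\<bar>) = \<Lambda>"
    unfolding \<Lambda>_def using lam_pos by (intro sum.cong) (auto simp: abs_of_pos)
  have ev: "\<forall>\<^sub>F T in sequentially. late_phase \<mu> c P b lam_opt L Y T (s T) (e T) (L / 20)"
  proof -
    have n0: "0 < n" by (simp add: n_def)
    have "\<forall>\<^sub>F T :: nat in sequentially. 1 \<le> real T \<and> real T powr (3 / 4) + 1 < real T \<and>
      real T powr (3 / 4) + 1 \<le> L / 20 * (real T - (real T powr (3 / 4) + 1)) \<and>
      2 \<le> (real T - (real T powr (3 / 4) + 1)) * L \<and> real T powr (- 1 / 4) < L \<and> n * real T powr (- 1 / 4) \<le> L \<and>
      8 * (n * real T powr (- 1 / 4)) * (1 + ln (real T)) \<le> L / 20"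
      using L_pos n0 by (intro eventually_conj; real_asymp)
    then show ?thesis
    proof eventually_elim
      case (elim T)
      have sT: "real T powr (3 / 4) \<le> real (s T)" "real (s T) \<le> real T powr (3 / 4) + 1"
      proof -
        have "0 \<le> real T powr (3 / 4)" by simp
        then have "real (s T) = real_of_int \<lceil>real T powr (3 / 4)\<rceil>"
          unfolding s_def by (intro of_nat_nat) linarith
        then show "real T powr (3 / 4) \<le> real (s T)" "real (s T) \<le> real T powr (3 / 4) + 1" by linarith+
      qed
      show ?case
      proof unfold_locales
        show "optimal_selection \<mu> c b Y" by (rule selection)
        have "1 \<le> real T powr (3 / 4)" using elim by (intro ge_one_powr_ge_zero) auto
        then show "1 \<le> s T" using sT by linarith
        show "s T < T" using elim sT by linarith
        show "real (s T) \<le> L / 20 * (real T - real (s T))"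
        proof -
          have "L / 20 * (real T - (real T powr (3 / 4) + 1)) \<le> L / 20 * (real T - real (s T))"
            using sT L_pos by (intro mult_left_mono) auto
          then show ?thesis using elim sT by linarith
        qed
        show "2 \<le> (real T - real (s T)) * L"
        proof -
          have "(real T - (real T powr (3 / 4) + 1)) * L \<le> (real T - real (s T)) * L"
            using sT L_pos by (intro mult_right_mono) auto
          then show ?thesis using elim by linarith
        qed
        show "0 \<le> L / 20" "L / 20 \<le> L / 20" using L_pos by auto
        show "0 < e T" "e T < L" "real CARD('n) * e T \<le> L" using elim by (auto simp: e_def n_def)
        have "8 * (n * e T) * harm T \<le> 8 * (n * e T) * (1 + ln (real T))"
          using elim n0 by (intro mult_left_mono harm_le_ln) (auto simp: e_def)
        also have "\<dots> \<le> L / 20" using elim unfolding e_def by blast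
        finally show "8 * (real CARD('n) * e T) * harm T \<le> L / 20" by (simp add: n_def)
      qed
    qed
  qed
  have "\<forall>\<^sub>F T in sequentially. reg T \<le> bound + err T"
    using ev
  proof eventually_elim
    case (elim T)
    interpret late_phase \<mu> c P b lam_opt L Y T "s T" "e T" "L / 20" by (rule elim)
    have "real T powr (1 / 4) \<le> (e T)\<^sup>2 * real (s T)"
    proof -
      have "real T powr (3 / 4) \<le> real (s T)" unfolding s_def by linarith
      then have "(e T)\<^sup>2 * real T powr (3 / 4) \<le> (e T)\<^sup>2 * real (s T)" by (intro mult_left_mono) auto
      moreover have "(e T)\<^sup>2 * real T powr (3 / 4) = real T powr (1 / 4)"
        by (simp add: e_def power2_eq_square powr_add[symmetric])
      ultimately show ?thesis by simp
    qed
    then have "exp (- 2 * (e T)\<^sup>2 * real (s T)) \<le> exp (- 2 * real T powr (1 / 4))" by simp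
    then have "\<epsilon>0 \<le> 2 * n * real T * exp (- 2 * real T powr (1 / 4))"
      unfolding \<epsilon>0_def n_def by (simp add: mult_left_mono)
    then have "8 * (\<Lambda> + 1) * (real T * \<epsilon>0) \<le> err T"
      unfolding err_def using \<Lambda>_pos by (intro mult_left_mono) auto
    then show ?case using regret_bound by (simp add: reg_def bound_def)
  qed
  then obtain T0 where T0: "\<And>T. T0 \<le> T \<Longrightarrow> reg T \<le> bound + err T"
    by (auto simp: eventually_sequentially)
  \<comment> \<open>The estimates hold from \<open>T0\<close> on; below it the remainder is set to
    the actual gap, which does not affect the limit.\<close>
  define \<epsilon> where "\<epsilon> T = (if T0 \<le> T then err T else \<bar>reg T - bound\<bar>)" for T
  have "err \<longlonglongrightarrow> 0" unfolding err_def by real_asymp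
  then have "\<epsilon> \<longlonglongrightarrow> 0"
    by (rule Lim_transform_eventually) (auto simp: \<epsilon>_def eventually_sequentially)
  moreover have "reg T \<le> bound + \<epsilon> T" for T
    using T0[of T] by (auto simp: \<epsilon>_def)
  ultimately show ?thesis
    unfolding abs_lam reg_def bound_def by blast
qed

end
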